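(* Let $n\ge 2$, let $\mathcal M$ be as below and $\mathcal D=\{D\in M(n,\mathbb R):-\tfrac12<\Re(d_k)<\tfrac12,\ k=1,\dots,n\}$, where $d_1,\dots,d_n$ are the characteristic roots of $D$. Then: (a) For all $D\in M(n,\mathbb R)$ and positive definite $W\in M(n,\mathbb R)$ with $W^{-1}DW\in\mathcal M\cap\mathcal D$, every OFBM with spectral parametrization $(D,A)$ where $A\in M(n,\mathbb C)$ satisfies $\Re(AA^* )=W^2$ has minimal symmetry, i.e. its symmetry group is $\{I,-I\}$. (b) The set $\mathcal M\cap\mathcal D$ is open in $M(n,\mathbb R)$ (in particular an $n^2$-dimensional $C^\infty$ manifold in $\mathbb R^{n^2}\cong M(n,\mathbb R)$) and dense in $\mathcal D$ (relative topology); consequently $(M(n,\mathbb R)\setminus\mathcal M)\cap\mathcal D$ is meager. (c) Conversely, for every $M\in\mathcal M\cap\mathcal D$, every OFBM with spectral parametrization $(D,A)$ where $D:=M$ and $\Re(AA^* )=I$ has minimal symmetry.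
   Context: $\mathcal S(n,\mathbb R)$: real symmetric matrices; $\mathcal S_{\neq}$: those with pairwise distinct eigenvalues; $so(n)$: real skew-symmetric matrices. For an orthonormal basis $o_1,\dots,o_n$ of $\mathbb R^n$, $\mathcal L_{\mathrm{invar}}(o_1,\dots,o_n)$ is the set of $L\in so(n)$ for which some subset $\{o_{j_1},\dots,o_{j_k}\}$, $1\le k<n$, spans an invariant subspace of $L$. For $S\in\mathcal S_{\neq}$, $l(S)=so(n)\setminus\mathcal L_{\mathrm{invar}}(o_1,\dots,o_n)$ with $o_1,\dots,o_n$ an orthonormal eigenbasis of $S$, and $\mathcal M=\{S+L:S\in\mathcal S_{\neq},L\in l(S)\}$. For $D\in\mathcal D$ and $A\in M(n,\mathbb C)$, the OFBM with spectral parametrization $(D,A)$ is the zero-mean Gaussian process $B_H(t)=\int_{\mathbb R}\frac{e^{itx}-1}{ix}(x_+^{-D}A+x_-^{-D}\overline A)\tilde B(dx)$, $t\in\mathbb R$, with $H=D+\tfrac12 I$, $x_\pm=\max\{\pm x,0\}$, $x^{-D}=\exp(-D\log x)$ ($0^{-D}:=0$), and $\tilde B$ a $\mathbb C^n$-valued Gaussian random measure with $\tilde B(-dx)=\overline{\tilde B(dx)}$, $E\tilde B(dx)\tilde B(dx)^*=dx$. The symmetry group of a process $X$ is $\{C\in GL(n,\mathbb R):\{CX(t)\}_t\overset{fdd}{=}\{X(t)\}_t\}$; minimal symmetry means this group equals $\{I,-I\}$. *)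

theory Defs
  imports "HOL-Probability.Probability"
begin

definition cmat :: "real^'n^'m \<Rightarrow> complex^'n^'m" where
  "cmat M = (\<chi> i j. complex_of_real (M $ i $ j))"

definition mconj :: "complex^'n^'m \<Rightarrow> complex^'n^'m" where
  "mconj A = (\<chi> i j. cnj (A $ i $ j))"

definition mRe :: "complex^'n^'m \<Rightarrow> real^'n^'m" where
  "mRe A = (\<chi> i j. Re (A $ i $ j))"

definition cadj :: "complex^'n^'m \<Rightarrow> complex^'m^'n" where
  "cadj A = transpose (mconj A)"

fun mpow :: "real^'n^'n \<Rightarrow> nat \<Rightarrow> real^'n^'n" where
  "mpow M 0 = mat 1"
| "mpow M (Suc k) = M ** mpow M k"

definition mexp :: "real^'n^'n \<Rightarrow> real^'n^'n" where
  "mexp M = (\<Sum>k. (1 / fact k) *\<^sub>R mpow M k)"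

definition char_roots :: "real^'n^'n \<Rightarrow> complex set" where
  "char_roots D = {z. det ((\<chi> i j. if i = j then z else 0) - cmat D) = 0}"

definition symmetric_mat :: "real^'n^'n \<Rightarrow> bool" where
  "symmetric_mat S \<longleftrightarrow> transpose S = S"

definition skew_mat :: "real^'n^'n \<Rightarrow> bool" where
  "skew_mat L \<longleftrightarrow> transpose L = - L"

definition pos_def :: "real^'n^'n \<Rightarrow> bool" where
  "pos_def W \<longleftrightarrow> symmetric_mat W \<and> (\<forall>x. x \<noteq> 0 \<longrightarrow> x \<bullet> (W *v x) > 0)"

definition S_neq :: "(real^'n^'n) set" where
  "S_neq = {S. symmetric_mat S \<and> card (char_roots S) = CARD('n)}"

definition orthonormal_basis :: "('n \<Rightarrow> real^'n) \<Rightarrow> bool" where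
  "orthonormal_basis b \<longleftrightarrow> (\<forall>i j. b i \<bullet> b j = (if i = j then 1 else 0))"

definition eigenbasis :: "real^'n^'n \<Rightarrow> ('n \<Rightarrow> real^'n) \<Rightarrow> bool" where
  "eigenbasis S b \<longleftrightarrow> orthonormal_basis b \<and> (\<forall>i. \<exists>c. S *v b i = c *\<^sub>R b i)"

definition L_invar :: "('n \<Rightarrow> real^'n) \<Rightarrow> (real^'n^'n) set" where
  "L_invar b = {L. skew_mat L \<and>
      (\<exists>J. J \<noteq> {} \<and> J \<noteq> UNIV \<and> (\<forall>v \<in> span (b ` J). L *v v \<in> span (b ` J)))}"

definition l_set :: "real^'n^'n \<Rightarrow> (real^'n^'n) set" where
  "l_set S = {L. skew_mat L \<and> (\<forall>b. eigenbasis S b \<longrightarrow> L \<notin> L_invar b)}"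

definition M_set :: "(real^'n^'n) set" where
  "M_set = {S + L | S L. S \<in> S_neq \<and> L \<in> l_set S}"

definition D_set :: "(real^'n^'n) set" where
  "D_set = {D. \<forall>z \<in> char_roots D. - 1/2 < Re z \<and> Re z < 1/2}"

text \<open>\<open>x\<^sup>-\<^sup>D\<close> for \<open>x > 0\<close>, and \<open>0\<close> otherwise (convention \<open>0\<^sup>-\<^sup>D = 0\<close>).\<close>
definition mpowr_neg :: "real \<Rightarrow> real^'n^'n \<Rightarrow> real^'n^'n" where
  "mpowr_neg x D = (if x > 0 then mexp (- (ln x) *\<^sub>R D) else 0)"

definition spec_kernel :: "real \<Rightarrow> real \<Rightarrow> complex" where
  "spec_kernel t x = (exp (\<i> * complex_of_real (t * x)) - 1) / (\<i> * complex_of_real x)"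

definition spec_G :: "real^'n^'n \<Rightarrow> complex^'n^'n \<Rightarrow> real \<Rightarrow> complex^'n^'n" where
  "spec_G D A x = cmat (mpowr_neg (max x 0) D) ** A + cmat (mpowr_neg (max (- x) 0) D) ** mconj A"

text \<open>Covariance \<open>E B\<^sub>H(s) B\<^sub>H(t)\<^sup>T\<close> induced by the spectral integral.\<close>
definition ofbm_cov :: "real^'n^'n \<Rightarrow> complex^'n^'n \<Rightarrow> real \<Rightarrow> real \<Rightarrow> complex^'n^'n" where
  "ofbm_cov D A s t = integral UNIV (\<lambda>x. \<chi> i j.
      spec_kernel s x * cnj (spec_kernel t x) * (spec_G D A x ** cadj (spec_G D A x)) $ i $ j)"

definition gaussian_rv :: "'a measure \<Rightarrow> ('a \<Rightarrow> real) \<Rightarrow> bool" where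
  "gaussian_rv P Y \<longleftrightarrow>
     (\<exists>\<mu> \<sigma>. \<sigma> > 0 \<and> distributed P lborel Y (normal_density \<mu> \<sigma>)) \<or> (\<exists>c. AE \<omega> in P. Y \<omega> = c)"

definition gaussian_process :: "'a measure \<Rightarrow> (real \<Rightarrow> 'a \<Rightarrow> real^'n) \<Rightarrow> bool" where
  "gaussian_process P X \<longleftrightarrow>
     (\<forall>t. X t \<in> borel_measurable P) \<and>
     (\<forall>(k::nat) (ts::nat \<Rightarrow> real) (cs::nat \<Rightarrow> real^'n).
        gaussian_rv P (\<lambda>\<omega>. \<Sum>i<k. cs i \<bullet> X (ts i) \<omega>))"

text \<open>\<open>X\<close> is (a version of) the OFBM with spectral parametrization \<open>(D,A)\<close>:
  a zero-mean Gaussian process whose covariance is the one of the spectral integral.\<close>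
definition is_OFBM :: "'a measure \<Rightarrow> (real \<Rightarrow> 'a \<Rightarrow> real^'n) \<Rightarrow> real^'n^'n \<Rightarrow> complex^'n^'n \<Rightarrow> bool" where
  "is_OFBM P X D A \<longleftrightarrow> prob_space P \<and> gaussian_process P X \<and>
     (\<forall>t j. prob_space.expectation P (\<lambda>\<omega>. X t \<omega> $ j) = 0) \<and>
     (\<forall>s t. (\<chi> j k. complex_of_real
                (prob_space.expectation P (\<lambda>\<omega>. X s \<omega> $ j * X t \<omega> $ k))) = ofbm_cov D A s t)"

definition sym_group :: "'a measure \<Rightarrow> (real \<Rightarrow> 'a \<Rightarrow> real^'n) \<Rightarrow> (real^'n^'n) set" where
  "sym_group P X = {C. invertible C \<and>
     (\<forall>(k::nat) (ts::nat \<Rightarrow> real).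
        distr P (Pi\<^sub>M {..<k} (\<lambda>_. borel)) (\<lambda>\<omega>. \<lambda>i\<in>{..<k}. C *v X (ts i) \<omega>)
      = distr P (Pi\<^sub>M {..<k} (\<lambda>_. borel)) (\<lambda>\<omega>. \<lambda>i\<in>{..<k}. X (ts i) \<omega>))}"

definition minimal_symmetry :: "'a measure \<Rightarrow> (real \<Rightarrow> 'a \<Rightarrow> real^'n) \<Rightarrow> bool" where
  "minimal_symmetry P X \<longleftrightarrow> sym_group P X = {mat 1, - mat 1}"

definition nowhere_dense :: "'b::topological_space set \<Rightarrow> bool" where
  "nowhere_dense S \<longleftrightarrow> interior (closure S) = {}"

definition meager :: "'b::topological_space set \<Rightarrow> bool" where
  "meager S \<longleftrightarrow> (\<exists>F. countable F \<and> (\<forall>T\<in>F. nowhere_dense T) \<and> S \<subseteq> \<Union>F)"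

end

theory Submission
  imports Defs "HOL-Computational_Algebra.Fundamental_Theorem_Algebra"
begin

text \<open>
  The covariance differences \<open>\<Gamma>(t + 1, 1) - \<Gamma>(t, 1)\<close> are the Fourier transform of the finite
  matrix measure \<open>\<bar>k\<^sub>1(x)\<bar>\<^sup>2 G(x) G(x)\<^sup>* dx\<close>. By uniqueness of Fourier transforms a symmetry \<open>C\<close> of the
  process satisfies \<open>C P(r) C\<^sup>T = P(r)\<close> with \<open>P(r) = e\<^sup>r\<^sup>D W\<^sup>2 (e\<^sup>r\<^sup>D)\<^sup>T\<close> for small \<open>r\<close>. The derivatives of order
  0, 1, 2 at \<open>r = 0\<close> show that \<open>U = W\<^sup>-\<^sup>1 C W\<close> is orthogonal and commutes with \<open>S\<close> and \<open>L S - S L\<close>, where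
  \<open>S + L = W\<^sup>-\<^sup>1 D W\<close>. As \<open>S\<close> has simple spectrum, \<open>U\<close> is diagonal with entries \<open>\<plusminus>1\<close> in its eigenbasis, and its
  eigenspaces are invariant under \<open>L\<close>; hence \<open>U = \<plusminus>I\<close>.

  The complement of \<open>M_set\<close> is the projection, along the compact set of orthonormal bases, of a closed
  set, so \<open>M_set\<close> is open; density follows by perturbing a matrix in an eigenbasis of its symmetric part.
\<close>

section \<open>Eigenbases of symmetric matrices\<close>

text \<open>The second derivative is needed because the orders 0 and 1 see only \<open>W\<close> and
  the symmetric part \<open>S\<close>; the skew part \<open>L\<close> first appears at order 2,
  through \<open>L S - S L\<close>. In an eigenbasis of \<open>S\<close> the entries of this
  commutator are those of \<open>L\<close> times differences of eigenvalues, so a simple spectrum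
  gives \<open>L\<close> back. Two analytic obstacles remain. The covariance says something about
  the density only once the integrand is known to be integrable, and this requires growth bounds
  with an exponent below 1/2 for \<open>exp (r D)\<close>, from the characteristic roots of a
  possibly nondiagonalizable \<open>D\<close>. In place of a Jordan form, the vectors whose orbit is
  O(exp (a u)) are shown to form a subspace, and linear factors of an annihilating polynomial are
  stripped off inside it. Secondly, \<open>- I\<close> has to be shown to be a symmetry. Gaussianity
  is given through scalar linear combinations, so equality of the joint laws of \<open>X\<close> and
  \<open>- X\<close> needs a Cramer-Wold argument, which is carried out one coordinate at a time
  from uniqueness on the line.\<close>

lemma inner_matrix_vector: "x \<bullet> (A *v y) = (transpose A *v x) \<bullet> (y::real^'n)"
  by (simp add: dot_lmul_matrix)

lemma symmetric_inner_swap: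
  assumes "symmetric_mat A"
  shows "x \<bullet> (A *v y) = (A *v x) \<bullet> y"
  using assms inner_matrix_vector[of x A y] by (simp add: symmetric_mat_def)

text \<open>First-order condition at an extremum: for \<open>t = - p / (\<bar>q\<bar> + 1)\<close>
  the linear term outweighs the quadratic one.\<close>

lemma quadratic_nonneg_imp_zero:
  fixes p q :: real
  assumes "\<And>t. 0 \<le> 2 * t * p + t\<^sup>2 * q"
  shows "p = 0"
proof (rule ccontr)
  assume "p \<noteq> 0"
  define t where "t = - p / (\<bar>q\<bar> + 1)"
  have "2 * t * p + t\<^sup>2 * q \<le> 2 * t * p + t\<^sup>2 * (\<bar>q\<bar> + 1)"
    by (intro add_left_mono mult_left_mono) auto
  also have "\<dots> = - (p\<^sup>2 / (\<bar>q\<bar> + 1))"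
    by (simp add: t_def power2_eq_square divide_simps)
  also have "\<dots> < 0"
    using \<open>p \<noteq> 0\<close> by (simp add: add_nonneg_pos)
  finally show False
    using assms[of t] by simp
qed

text \<open>A maximizer of the Rayleigh quotient on the unit sphere of \<open>V\<close> is an
  eigenvector. Invariance keeps the residual \<open>r\<close> inside \<open>V\<close>, where
  maximality can be tested along it.\<close>

lemma symmetric_eigenvector:
  fixes A :: "real^'n^'n"
  assumes sym: "symmetric_mat A" and V: "subspace V" "V \<noteq> {0}"
    and inv: "\<And>x. x \<in> V \<Longrightarrow> A *v x \<in> V"
  obtains x c where "x \<in> V" "norm x = 1" "A *v x = c *\<^sub>R x"
proof -
  obtain y where y: "y \<in> V" "y \<noteq> 0"
    using V subspace_0 by blast
  have ne: "sphere 0 1 \<inter> V \<noteq> {}"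
  proof -
    have "(1 / norm y) *\<^sub>R y \<in> sphere 0 1 \<inter> V"
      using y V(1) by (simp add: subspace_scale)
    then show ?thesis by blast
  qed
  have "compact (sphere 0 1 \<inter> V)"
    by (intro compact_Int_closed compact_sphere closed_subspace V)
  moreover have "continuous_on (sphere 0 1 \<inter> V) (\<lambda>x. x \<bullet> (A *v x))"
    by (intro continuous_intros)
  ultimately obtain x where x': "x \<in> sphere 0 1 \<inter> V"
    and mx': "\<forall>z\<in>sphere 0 1 \<inter> V. z \<bullet> (A *v z) \<le> x \<bullet> (A *v x)"
    using continuous_attains_sup ne by blast
  have x: "x \<in> V" "norm x = 1"
    and mx: "\<And>z. z \<in> V \<Longrightarrow> norm z = 1 \<Longrightarrow> z \<bullet> (A *v z) \<le> x \<bullet> (A *v x)"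
    using x' mx' by auto
  define c where "c = x \<bullet> (A *v x)"
  define r where "r = c *\<^sub>R x - A *v x"
  have xx: "x \<bullet> x = 1"
    using x by (simp add: dot_square_norm)
  have nonneg: "0 \<le> c * (z \<bullet> z) - z \<bullet> (A *v z)" if "z \<in> V" for z
  proof (cases "z = 0")
    case False
    have "(z \<bullet> (A *v z)) / (norm z)\<^sup>2 \<le> c"
      using mx[of "(1 / norm z) *\<^sub>R z"] that V(1) False
      by (simp add: subspace_scale c_def matrix_vector_mult_scaleR power2_eq_square)
    then show ?thesis
      using False by (simp add: dot_square_norm divide_simps)
  qed simp
  have rV: "r \<in> V"
    unfolding r_def by (intro subspace_diff subspace_scale V x inv)
  \<comment> \<open>The form \<open>c * (z \<bullet> z) - z \<bullet> (A *v z)\<close> is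
    nonnegative on \<open>V\<close> and vanishes at \<open>x\<close>; along
    \<open>x + t *\<^sub>R r\<close> its linear coefficient is
    \<open>2 * (r \<bullet> r)\<close>.\<close>
  have "r \<bullet> r = 0"
  proof (rule quadratic_nonneg_imp_zero)
    fix t
    have "0 \<le> c * ((x + t *\<^sub>R r) \<bullet> (x + t *\<^sub>R r)) - (x + t *\<^sub>R r) \<bullet> (A *v (x + t *\<^sub>R r))"
      by (intro nonneg subspace_add subspace_scale V x rV)
    also have "\<dots> = 2 * t * (r \<bullet> r) + t\<^sup>2 * (c * (r \<bullet> r) - r \<bullet> (A *v r))"
      using symmetric_inner_swap[OF sym, of x r] xx
      unfolding r_def[symmetric]
      by (simp add: matrix_vector_right_distrib matrix_vector_mult_scaleR inner_add_left inner_add_right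
          power2_eq_square algebra_simps c_def[symmetric] inner_commute[of r "A *v x"])
         (simp add: r_def inner_diff_left inner_diff_right inner_commute algebra_simps)
    finally show "0 \<le> 2 * t * (r \<bullet> r) + t\<^sup>2 * (c * (r \<bullet> r) - r \<bullet> (A *v r))" .
  qed
  then have "A *v x = c *\<^sub>R x"
    by (simp add: r_def)
  then show ?thesis
    using that x by blast
qed

text \<open>Induction on the dimension: the orthogonal complement in \<open>V\<close> of one unit
  eigenvector is again invariant, because \<open>A\<close> is symmetric, and has smaller
  dimension.\<close>

lemma symmetric_subspace_eigenbasis:
  fixes A :: "real^'n^'n"
  assumes sym: "symmetric_mat A"
  shows "subspace V \<Longrightarrow> (\<And>x. x \<in> V \<Longrightarrow> A *v x \<in> V) \<Longrightarrow>
    \<exists>B. B \<subseteq> V \<and> pairwise orthogonal B \<and> (\<forall>x\<in>B. norm x = 1 \<and> (\<exists>c. A *v x = c *\<^sub>R x)) \<and> span B = V"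
proof (induction "dim V" arbitrary: V rule: less_induct)
  case less
  note V = less.prems
  show ?case
  proof (cases "V = {0}")
    case True
    then show ?thesis by (intro exI[of _ "{}"]) simp
  next
    case False
    obtain x c where x: "x \<in> V" "norm x = 1" "A *v x = c *\<^sub>R x"
      using symmetric_eigenvector[OF sym V(1) False V(2)] by blast
    have xx: "x \<bullet> x = 1"
      using x by (simp add: dot_square_norm)
    define U where "U = {v \<in> V. x \<bullet> v = 0}"
    have subU: "subspace U"
      using V(1) unfolding U_def subspace_def by (auto simp: inner_add_right)
    have "A *v v \<in> U" if "v \<in> U" for v
      using that V(2) symmetric_inner_swap[OF sym, of x v] x(3) by (simp add: U_def)
    moreover have "dim U < dim V"
    proof -
      have "x \<notin> U" "U \<subseteq> V"
        by (auto simp: U_def xx)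
      then show ?thesis
        using x(1) subU V(1) by (metis dim_subset le_neq_implies_less order_refl subspace_dim_equal)
    qed
    ultimately obtain B where B: "B \<subseteq> U" "pairwise orthogonal B"
      "\<forall>x\<in>B. norm x = 1 \<and> (\<exists>c. A *v x = c *\<^sub>R x)" "span B = U"
      using less.hyps[of U] subU by blast
    have "span (insert x B) = V"
    proof
      show "span (insert x B) \<subseteq> V"
        using B(1) x(1) V(1) by (intro span_minimal) (auto simp: U_def)
      show "V \<subseteq> span (insert x B)"
      proof
        fix v assume "v \<in> V"
        then have "v - (x \<bullet> v) *\<^sub>R x \<in> U"
          using x(1) V(1) xx by (auto simp: U_def inner_diff_right subspace_diff subspace_scale)
        then show "v \<in> span (insert x B)"
          using B(4) span_breakdown_eq by blast
      qed
    qed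
    moreover have "pairwise orthogonal (insert x B)"
      using B(1,2) by (auto simp: pairwise_insert orthogonal_def U_def inner_commute)
    ultimately show ?thesis
      using B(1,3) x by (intro exI[of _ "insert x B"]) (auto simp: U_def)
  qed
qed

theorem eigenbasis_exists:
  fixes A :: "real^'n^'n"
  assumes "symmetric_mat A"
  obtains b where "eigenbasis A b"
proof -
  obtain B where B: "pairwise orthogonal B"
      "\<forall>x\<in>B. norm x = 1 \<and> (\<exists>c. A *v x = c *\<^sub>R x)" "span B = UNIV"
    using symmetric_subspace_eigenbasis[OF assms, of UNIV] by auto
  have "0 \<notin> B"
    using B(2) by fastforce
  then have ind: "independent B"
    using B(1) pairwise_orthogonal_independent by blast
  then have "card B = CARD('n)"
    using B(3) by (metis dim_UNIV dim_span_eq_card_independent DIM_cart DIM_real mult.right_neutral)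
  then obtain b where b: "bij_betw b (UNIV::'n set) B"
    using finite_same_card_bij[OF finite_class.finite_UNIV independent_imp_finite[OF ind]] by metis
  have "b i \<bullet> b j = (if i = j then 1 else 0)" for i j
  proof -
    have "b i \<in> B" "b j \<in> B" "b i = b j \<longleftrightarrow> i = j"
      using b by (auto simp: bij_betw_def inj_def)
    then show ?thesis
      using B(1,2) by (auto simp: pairwise_def orthogonal_def dot_square_norm)
  qed
  moreover have "\<exists>c. A *v b i = c *\<^sub>R b i" for i
    using b B(2) by (auto simp: bij_betw_def)
  ultimately show ?thesis
    using that unfolding eigenbasis_def orthonormal_basis_def by blast
qed

text \<open>Orthonormality says \<open>B ** transpose B = mat 1\<close> for the matrix with rows
  \<open>b i\<close>. For square matrices the reversed product is then the identity too, which is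
  completeness.\<close>

lemma orthonormal_expansion:
  assumes "orthonormal_basis b"
  shows "v = (\<Sum>i\<in>UNIV. (b i \<bullet> v) *\<^sub>R b i)"
proof -
  define B where "B = (\<chi> i. b i)"
  have "B ** transpose B = mat 1"
    using assms by (simp add: B_def vec_eq_iff matrix_matrix_mult_def transpose_def mat_def
        orthonormal_basis_def inner_vec_def)
  then have "transpose B ** B = mat 1"
    using matrix_left_right_inverse by blast
  then have "v = transpose B *v (B *v v)"
    by (simp only: matrix_vector_mul_assoc matrix_vector_mul_lid)
  also have "B *v v = (\<chi> i. b i \<bullet> v)"
    by (simp add: B_def matrix_vector_mult_def inner_vec_def vec_eq_iff)
  also have "transpose B *v (\<chi> i. b i \<bullet> v) = (\<Sum>i\<in>UNIV. (b i \<bullet> v) *\<^sub>R b i)"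
    unfolding matrix_vector_mult_def transpose_def B_def vec_eq_iff by (simp add: mult.commute)
  finally show ?thesis .
qed

lemma orthonormal_eq_zero:
  assumes "orthonormal_basis b" "\<And>i. b i \<bullet> v = 0"
  shows "v = 0"
  using orthonormal_expansion[OF assms(1), of v] assms(2) by simp

lemma span_orthonormal_subset:
  assumes "orthonormal_basis b"
  shows "span (b ` J) = {v. \<forall>j. j \<notin> J \<longrightarrow> b j \<bullet> v = 0}"
proof
  show "span (b ` J) \<subseteq> {v. \<forall>j. j \<notin> J \<longrightarrow> b j \<bullet> v = 0}"
    using assms by (intro span_minimal) (auto simp: subspace_def inner_add_right orthonormal_basis_def)
  show "{v. \<forall>j. j \<notin> J \<longrightarrow> b j \<bullet> v = 0} \<subseteq> span (b ` J)"
  proof safe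
    fix v assume v: "\<forall>j. j \<notin> J \<longrightarrow> b j \<bullet> v = 0"
    have "(\<Sum>i\<in>UNIV. (b i \<bullet> v) *\<^sub>R b i) \<in> span (b ` J)"
    proof (intro span_sum)
      fix i
      show "(b i \<bullet> v) *\<^sub>R b i \<in> span (b ` J)"
        using v by (cases "i \<in> J") (auto intro: span_scale span_base span_zero)
    qed
    then show "v \<in> span (b ` J)"
      using orthonormal_expansion[OF assms, of v] by simp
  qed
qed

text \<open>Invariance of a coordinate subspace turns into the vanishing of finitely many entries of
  \<open>L\<close> in the basis \<open>b\<close>, a condition that is closed in \<open>b\<close> and
  \<open>L\<close>.\<close>

lemma L_invar_iff:
  assumes "orthonormal_basis b"
  shows "L \<in> L_invar b \<longleftrightarrow> skew_mat L \<and>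
    (\<exists>J. J \<noteq> {} \<and> J \<noteq> UNIV \<and> (\<forall>i\<in>J. \<forall>j\<in>-J. b j \<bullet> (L *v b i) = 0))"
proof -
  have "(\<forall>v\<in>span (b ` J). L *v v \<in> span (b ` J)) \<longleftrightarrow> (\<forall>i\<in>J. \<forall>j\<in>-J. b j \<bullet> (L *v b i) = 0)" for J
  proof
    assume *: "\<forall>v\<in>span (b ` J). L *v v \<in> span (b ` J)"
    have "L *v b i \<in> span (b ` J)" if "i \<in> J" for i
      using * that by (simp add: span_base)
    then show "\<forall>i\<in>J. \<forall>j\<in>-J. b j \<bullet> (L *v b i) = 0"
      unfolding span_orthonormal_subset[OF assms] by simp
  next
    assume *: "\<forall>i\<in>J. \<forall>j\<in>-J. b j \<bullet> (L *v b i) = 0"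
    have "span (b ` J) \<subseteq> {v. L *v v \<in> span (b ` J)}"
    proof (rule span_minimal)
      show "b ` J \<subseteq> {v. L *v v \<in> span (b ` J)}"
        unfolding span_orthonormal_subset[OF assms] using * by auto
      show "subspace {v. L *v v \<in> span (b ` J)}"
        by (auto simp: subspace_def matrix_vector_right_distrib matrix_vector_mult_scaleR
            intro: span_add span_scale span_zero)
    qed
    then show "\<forall>v\<in>span (b ` J). L *v v \<in> span (b ` J)"
      by blast
  qed
  then show ?thesis
    by (simp add: L_invar_def)
qed

section \<open>Characteristic roots as complex eigenvalues\<close>

lemma mat_vector_mult: "(mat z :: 'a::comm_semiring_1^'n^'n) *v v = z *s v"
  by (simp add: vec_eq_iff matrix_vector_mult_def mat_def if_distrib if_distribR cong: if_cong)

lemma char_roots_iff: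
  fixes D :: "real^'n^'n"
  shows "z \<in> char_roots D \<longleftrightarrow> (\<exists>v. v \<noteq> 0 \<and> cmat D *v v = z *s v)"
proof -
  have "((\<chi> i j. if i = j then z else 0) :: complex^'n^'n) = mat z"
    by (simp add: mat_def)
  then have "z \<in> char_roots D \<longleftrightarrow> \<not> invertible (mat z - cmat D)"
    by (simp add: char_roots_def invertible_det_nz)
  also have "\<dots> \<longleftrightarrow> (\<exists>v. v \<noteq> 0 \<and> (mat z - cmat D) *v v = 0)"
    unfolding invertible_left_inverse matrix_left_invertible_ker by blast
  also have "\<dots> \<longleftrightarrow> (\<exists>v. v \<noteq> 0 \<and> cmat D *v v = z *s v)"
    by (auto simp: matrix_vector_mult_diff_rdistrib mat_vector_mult)
  finally show ?thesis .
qed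

definition cvec :: "real^'n \<Rightarrow> complex^'n" where
  "cvec x = (\<chi> i. complex_of_real (x $ i))"

lemma cmat_cvec: "cmat D *v cvec x = cvec (D *v x)"
  by (simp add: cmat_def cvec_def matrix_vector_mult_def vec_eq_iff)

lemma cvec_eq_0_iff [simp]: "cvec x = 0 \<longleftrightarrow> x = 0"
  by (simp add: cvec_def vec_eq_iff)

lemma Re_cmat_vector: "(\<chi> i. Re ((cmat D *v v) $ i)) = D *v (\<chi> i. Re (v $ i))"
  and Im_cmat_vector: "(\<chi> i. Im ((cmat D *v v) $ i)) = D *v (\<chi> i. Im (v $ i))"
  by (simp_all add: cmat_def matrix_vector_mult_def vec_eq_iff)

lemma eigenbasis_eigenvalue:
  assumes "eigenbasis S b"
  shows "S *v b i = (b i \<bullet> (S *v b i)) *\<^sub>R b i"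
proof -
  obtain c where "S *v b i = c *\<^sub>R b i"
    using assms unfolding eigenbasis_def by blast
  moreover have "b i \<bullet> b i = 1"
    using assms by (simp add: eigenbasis_def orthonormal_basis_def)
  ultimately show ?thesis by simp
qed

lemma char_roots_eigenbasis:
  fixes S :: "real^'n^'n"
  assumes sym: "symmetric_mat S" and b: "eigenbasis S b"
  shows "char_roots S = (\<lambda>i. complex_of_real (b i \<bullet> (S *v b i))) ` UNIV"
proof (intro equalityI subsetI)
  have ob: "orthonormal_basis b"
    using b by (simp add: eigenbasis_def)
  define s where "s i = b i \<bullet> (S *v b i)" for i
  have Sb: "S *v b i = s i *\<^sub>R b i" for i
    unfolding s_def by (rule eigenbasis_eigenvalue[OF b])
  {
    fix z assume "z \<in> (\<lambda>i. complex_of_real (b i \<bullet> (S *v b i))) ` UNIV"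
    then obtain i where z: "z = of_real (s i)"
      by (auto simp: s_def)
    have "b i \<noteq> 0"
      using ob by (metis inner_zero_left orthonormal_basis_def zero_neq_one)
    moreover have "cmat S *v cvec (b i) = z *s cvec (b i)"
      unfolding cmat_cvec Sb by (simp add: cvec_def vec_eq_iff z)
    ultimately show "z \<in> char_roots S"
      unfolding char_roots_iff by (metis cvec_eq_0_iff)
  next
    fix z assume "z \<in> char_roots S"
    then obtain v where v: "v \<noteq> 0" "cmat S *v v = z *s v"
      unfolding char_roots_iff by blast
    define x y where "x = (\<chi> i. Re (v $ i))" and "y = (\<chi> i. Im (v $ i))"
    have Sx: "S *v x = Re z *\<^sub>R x - Im z *\<^sub>R y"
      unfolding x_def y_def Re_cmat_vector[symmetric] v(2) by (simp add: vec_eq_iff)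
    have Sy: "S *v y = Re z *\<^sub>R y + Im z *\<^sub>R x"
      unfolding x_def y_def Im_cmat_vector[symmetric] v(2) by (simp add: vec_eq_iff algebra_simps)
    have "x \<noteq> 0 \<or> y \<noteq> 0"
      using v(1) by (auto simp: x_def y_def vec_eq_iff complex_eq_iff)
    then obtain j where j: "b j \<bullet> x \<noteq> 0 \<or> b j \<bullet> y \<noteq> 0"
      using orthonormal_eq_zero[OF ob] by blast
    have "s j * (b j \<bullet> x) = b j \<bullet> (S *v x)" "s j * (b j \<bullet> y) = b j \<bullet> (S *v y)"
      using symmetric_inner_swap[OF sym, of "b j"] by (simp_all add: Sb)
    \<comment> \<open>The two real equations for real and imaginary parts, paired with
      \<open>b j\<close>, recombine into one complex equation; a nonzero coordinate then forces
      \<open>z\<close> to be the real number \<open>s j\<close>.\<close>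
    then have "(of_real (s j) - z) * Complex (b j \<bullet> x) (b j \<bullet> y) = 0"
      by (simp add: Sx Sy inner_diff_right inner_add_right complex_eq_iff algebra_simps)
    moreover have "Complex (b j \<bullet> x) (b j \<bullet> y) \<noteq> 0"
      using j by (simp add: complex_eq_iff)
    ultimately have "z = of_real (s j)"
      by simp
    then show "z \<in> (\<lambda>i. complex_of_real (b i \<bullet> (S *v b i))) ` UNIV"
      by (auto simp: s_def)
  }
qed

lemma S_neq_iff_eigenbasis:
  fixes S :: "real^'n^'n"
  assumes "symmetric_mat S" "eigenbasis S b"
  shows "S \<in> S_neq \<longleftrightarrow> inj (\<lambda>i. b i \<bullet> (S *v b i))"
proof -
  have "S \<in> S_neq \<longleftrightarrow> inj (\<lambda>i. complex_of_real (b i \<bullet> (S *v b i)))"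
    using assms(1) unfolding S_neq_def char_roots_eigenbasis[OF assms] mem_Collect_eq
    by (auto simp: card_image intro!: eq_card_imp_inj_on)
  then show ?thesis
    by (simp add: inj_def)
qed

section \<open>Symmetric and skew parts, and the failure of membership in
  \<open>M_set\<close>\<close>

definition sym_part :: "real^'n^'n \<Rightarrow> real^'n^'n" where
  "sym_part M = (1 / 2) *\<^sub>R (M + transpose M)"

definition skew_part :: "real^'n^'n \<Rightarrow> real^'n^'n" where
  "skew_part M = (1 / 2) *\<^sub>R (M - transpose M)"

lemma symmetric_sym_part: "symmetric_mat (sym_part M)"
  by (simp add: symmetric_mat_def sym_part_def transpose_def vec_eq_iff)

lemma skew_skew_part: "skew_mat (skew_part M)"
  by (simp add: skew_mat_def skew_part_def transpose_def vec_eq_iff field_simps)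

lemma sym_add_skew_part: "sym_part M + skew_part M = M"
  by (simp add: sym_part_def skew_part_def vec_eq_iff field_simps)

lemma
  assumes "symmetric_mat S" "skew_mat L"
  shows sym_part_add: "sym_part (S + L) = S" and skew_part_add: "skew_part (S + L) = L"
proof -
  have "transpose (S + L) = transpose S + transpose L"
    by (simp add: transpose_def vec_eq_iff)
  then have *: "transpose (S + L) = S - L"
    using assms by (simp add: symmetric_mat_def skew_mat_def)
  show "sym_part (S + L) = S" "skew_part (S + L) = L"
    unfolding sym_part_def skew_part_def * by (simp_all add: vec_eq_iff)
qed

text \<open>Intended for eigenbases \<open>b\<close> of \<open>sym_part M\<close>. Both ways of
  falling outside \<open>M_set\<close> are written as finitely many equations, continuous in
  \<open>b\<close> and \<open>M\<close>, so that the degenerate pairs form a closed set.\<close>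

definition degenerate :: "real^'n^'n \<Rightarrow> ('n \<Rightarrow> real^'n) \<Rightarrow> bool" where
  "degenerate M b \<longleftrightarrow>
    (\<exists>i j. i \<noteq> j \<and> b i \<bullet> (sym_part M *v b i) = b j \<bullet> (sym_part M *v b j)) \<or>
    (\<exists>J. J \<noteq> {} \<and> J \<noteq> UNIV \<and> (\<forall>i\<in>J. \<forall>j\<in>-J. b j \<bullet> (skew_part M *v b i) = 0))"

lemma degenerate_iff:
  assumes "eigenbasis (sym_part M) b"
  shows "degenerate M b \<longleftrightarrow> sym_part M \<notin> S_neq \<or> skew_part M \<in> L_invar b"
proof -
  have "orthonormal_basis b"
    using assms by (simp add: eigenbasis_def)
  then show ?thesis
    unfolding degenerate_def L_invar_iff[OF \<open>orthonormal_basis b\<close>]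
      S_neq_iff_eigenbasis[OF symmetric_sym_part assms] inj_def
    using skew_skew_part[of M] by blast
qed

lemma M_set_iff: "M \<in> M_set \<longleftrightarrow> sym_part M \<in> S_neq \<and> skew_part M \<in> l_set (sym_part M)"
proof
  assume "M \<in> M_set"
  then obtain S L where "M = S + L" "S \<in> S_neq" "L \<in> l_set S"
    unfolding M_set_def by blast
  moreover from this have "sym_part M = S" "skew_part M = L"
    using sym_part_add skew_part_add unfolding S_neq_def l_set_def by blast+
  ultimately show "sym_part M \<in> S_neq \<and> skew_part M \<in> l_set (sym_part M)"
    by simp
next
  assume *: "sym_part M \<in> S_neq \<and> skew_part M \<in> l_set (sym_part M)"
  have "M = sym_part M + skew_part M"
    by (simp add: sym_add_skew_part)
  then show "M \<in> M_set"
    unfolding M_set_def using * by blast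
qed

text \<open>An eigenbasis always exists, so the quantifier is not vacuous and simplicity of the
  spectrum can be read off from it. The negation is an existential statement over bases, that is, a
  projection.\<close>

lemma M_set_iff_degenerate:
  "M \<in> M_set \<longleftrightarrow> (\<forall>b. eigenbasis (sym_part M) b \<longrightarrow> \<not> degenerate M b)"
proof -
  obtain b where b: "eigenbasis (sym_part M) b"
    using eigenbasis_exists symmetric_sym_part by blast
  show ?thesis
    unfolding M_set_iff using b degenerate_iff skew_skew_part by (auto simp: l_set_def)
qed

section \<open>Openness and density\<close>

lemma transpose_add: "transpose (A + B) = transpose A + transpose (B :: real^'n^'m)"
  and transpose_scaleR: "transpose (c *\<^sub>R A) = c *\<^sub>R transpose A"
  by (simp_all add: transpose_def vec_eq_iff)

lemma matrix_mult_minus_left: "(- A) ** B = - (A ** (B :: real^'n^'m))"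
  and matrix_mult_minus_right: "C ** (- B) = - (C ** (B :: real^'n^'m))"
  by (simp_all add: matrix_matrix_mult_def vec_eq_iff sum_negf)

lemma continuous_on_mat_vec [continuous_intros]:
  fixes f :: "'a::topological_space \<Rightarrow> real^'m^'n"
  assumes "continuous_on S f" "continuous_on S g"
  shows "continuous_on S (\<lambda>x. f x *v g x)"
  unfolding matrix_vector_mult_def by (intro continuous_intros assms)

lemma continuous_on_sym_part [continuous_intros]:
  assumes "continuous_on S f"
  shows "continuous_on S (\<lambda>x. sym_part (f x))"
  unfolding sym_part_def transpose_def by (intro continuous_intros assms)

lemma continuous_on_skew_part [continuous_intros]:
  assumes "continuous_on S f"
  shows "continuous_on S (\<lambda>x. skew_part (f x))"
  unfolding skew_part_def transpose_def by (intro continuous_intros assms)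

text \<open>A basis is stored as the rows of a matrix, so that the bases form a bounded closed set
  in a Euclidean space.\<close>

lemma compact_orthonormal:
  "compact {B :: real^'n^'n. orthonormal_basis (($) B)}"
proof (rule compact_eq_bounded_closed[THEN iffD2], intro conjI)
  show "bounded {B :: real^'n^'n. orthonormal_basis (($) B)}"
  proof (rule boundedI)
    fix B :: "real^'n^'n" assume "B \<in> {B. orthonormal_basis (($) B)}"
    then have "norm (B $ i) = 1" for i
      by (simp add: orthonormal_basis_def norm_eq_sqrt_inner)
    then show "norm B \<le> of_nat CARD('n)"
      using L2_set_le_sum[of UNIV "\<lambda>i. norm (B $ i)"]
      by (simp add: norm_vec_def)
  qed
  have "{B :: real^'n^'n. orthonormal_basis (($) B)} =
      (\<Inter>i. \<Inter>j. {B. B $ i \<bullet> B $ j = (if i = j then 1 else 0)})"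
    by (auto simp: orthonormal_basis_def)
  also have "closed \<dots>"
    by (intro closed_INT ballI closed_Collect_eq continuous_intros)
  finally show "closed {B :: real^'n^'n. orthonormal_basis (($) B)}" .
qed

lemma closed_Collect_ex_finite:
  assumes "\<And>i::'i::finite. closed {x. P i x}"
  shows "closed {x. \<exists>i. P i x}"
proof -
  have "{x. \<exists>i. P i x} = (\<Union>i. {x. P i x})"
    by blast
  also have "closed \<dots>"
    using assms by (intro closed_UN) auto
  finally show ?thesis .
qed

lemma open_M_set: "open (M_set :: (real^'n^'n) set)"
proof -
  \<comment> \<open>The eigenvalue is written as an inner product, so no quantifier over eigenvalues
    remains and closedness is visible. Orthonormality is left to the compact set along which
    \<open>T\<close> is projected.\<close>
  define T :: "((real^'n^'n) \<times> (real^'n^'n)) set" where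
    "T = {p. (\<forall>i. sym_part (snd p) *v (fst p $ i) =
        (fst p $ i \<bullet> (sym_part (snd p) *v (fst p $ i))) *\<^sub>R (fst p $ i)) \<and> degenerate (snd p) (($) (fst p))}"
  have c1: "closed {p :: (real^'n^'n) \<times> (real^'n^'n). \<forall>i. sym_part (snd p) *v (fst p $ i) =
        (fst p $ i \<bullet> (sym_part (snd p) *v (fst p $ i))) *\<^sub>R (fst p $ i)}"
    by (intro closed_Collect_all closed_Collect_eq continuous_intros)
  have c2: "closed {p :: (real^'n^'n) \<times> (real^'n^'n). \<exists>i j. i \<noteq> j \<and>
      fst p $ i \<bullet> (sym_part (snd p) *v fst p $ i) = fst p $ j \<bullet> (sym_part (snd p) *v fst p $ j)}"
    by (intro closed_Collect_ex_finite closed_Collect_conj closed_Collect_const closed_Collect_eq continuous_intros)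
  have c3: "closed {p :: (real^'n^'n) \<times> (real^'n^'n). \<exists>J. J \<noteq> {} \<and> J \<noteq> UNIV \<and>
      (\<forall>i\<in>J. \<forall>j\<in>-J. fst p $ j \<bullet> (skew_part (snd p) *v fst p $ i) = 0)}"
    unfolding Ball_def
    by (intro closed_Collect_ex_finite closed_Collect_conj closed_Collect_const closed_Collect_all
        closed_Collect_imp open_Collect_const closed_Collect_eq continuous_intros)
  have "closed T"
    unfolding T_def degenerate_def by (intro closed_Collect_conj closed_Collect_disj c1 c2 c3)
  then have "closed {M. \<exists>B. B \<in> {B. orthonormal_basis (($) B)} \<and> (B, M) \<in> T}"
    by (intro closed_compact_projection compact_orthonormal)
  also have "{M. \<exists>B. B \<in> {B. orthonormal_basis (($) B)} \<and> (B, M) \<in> T} = - M_set"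
  proof (intro equalityI subsetI)
    fix M assume "M \<in> {M. \<exists>B. B \<in> {B. orthonormal_basis (($) B)} \<and> (B, M) \<in> T}"
    then obtain B where "eigenbasis (sym_part M) (($) B)" "degenerate M (($) B)"
      unfolding T_def eigenbasis_def by auto
    then show "M \<in> - M_set"
      using M_set_iff_degenerate by blast
  next
    fix M assume "M \<in> - (M_set :: (real^'n^'n) set)"
    then obtain b where b: "eigenbasis (sym_part M) b" "degenerate M b"
      using M_set_iff_degenerate by blast
    have "($) (\<chi> i. b i) = b"
      by auto
    then have "((\<chi> i. b i), M) \<in> T"
      using b eigenbasis_eigenvalue[OF b(1)] unfolding T_def by simp
    moreover have "orthonormal_basis (($) (\<chi> i. b i))"
      unfolding \<open>($) (\<chi> i. b i) = b\<close> using b by (simp add: eigenbasis_def)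
    ultimately show "M \<in> {M. \<exists>B. B \<in> {B. orthonormal_basis (($) B)} \<and> (B, M) \<in> T}"
      by blast
  qed
  finally show ?thesis
    by (simp add: open_closed)
qed

lemma cmod_char_root_le:
  assumes "z \<in> char_roots D"
  shows "cmod z \<le> (\<Sum>i\<in>UNIV. \<Sum>j\<in>UNIV. \<bar>D $ i $ j\<bar>)"
proof -
  obtain v where v: "v \<noteq> 0" "cmat D *v v = z *s v"
    using assms char_roots_iff by blast
  define N where "N = (\<Sum>i\<in>UNIV. cmod (v $ i))"
  have "N \<noteq> 0"
    using v(1) unfolding N_def by (simp add: sum_nonneg_eq_0_iff vec_eq_iff)
  moreover have "0 \<le> N"
    unfolding N_def by (intro sum_nonneg) auto
  ultimately have "0 < N" by simp
  \<comment> \<open>Both sides of \<open>cmat D *v v = z *s v\<close> are compared in the l1 norm;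
    \<open>N\<close> is that of \<open>v\<close>.\<close>
  have "cmod z * N = (\<Sum>i\<in>UNIV. cmod ((cmat D *v v) $ i))"
    unfolding v(2) N_def by (simp add: sum_distrib_left norm_mult)
  also have "\<dots> \<le> (\<Sum>i\<in>UNIV. \<Sum>j\<in>UNIV. \<bar>D $ i $ j\<bar> * N)"
  proof (rule sum_mono)
    fix i
    have "cmod ((cmat D *v v) $ i) \<le> (\<Sum>j\<in>UNIV. \<bar>D $ i $ j\<bar> * cmod (v $ j))"
      unfolding matrix_vector_mult_def cmat_def by (auto intro!: sum_norm_le simp: norm_mult)
    also have "\<dots> \<le> (\<Sum>j\<in>UNIV. \<bar>D $ i $ j\<bar> * N)"
      unfolding N_def by (intro sum_mono mult_left_mono member_le_sum) auto
    finally show "cmod ((cmat D *v v) $ i) \<le> (\<Sum>j\<in>UNIV. \<bar>D $ i $ j\<bar> * N)" .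
  qed
  also have "\<dots> = (\<Sum>i\<in>UNIV. \<Sum>j\<in>UNIV. \<bar>D $ i $ j\<bar>) * N"
    by (simp add: sum_distrib_right)
  finally show ?thesis
    using \<open>0 < N\<close> by simp
qed

lemma continuous_on_char_det:
  "continuous_on S (\<lambda>p. det ((\<chi> i j. if i = j then fst p else 0) - cmat (snd p) :: complex^'n^'n))"
proof -
  have "continuous_on S (\<lambda>p. if i = j then fst p else (0::complex))" for i j :: 'n
    by (cases "i = j") (auto intro: continuous_intros)
  then show ?thesis
    unfolding det_def cmat_def by (simp, intro continuous_intros)
qed

text \<open>Pairs of a matrix and a forbidden root form a closed set, but the roots range over a
  noncompact plane. Where \<open>R D < r\<close> all roots lie in the disc of radius
  \<open>r\<close>, so there the projection can be taken along a compact disc; \<open>D_set\<close>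
  is the union over \<open>r\<close>.\<close>

lemma open_D_set: "open (D_set :: (real^'n^'n) set)"
proof -
  define R :: "real^'n^'n \<Rightarrow> real" where "R D = (\<Sum>i\<in>UNIV. \<Sum>j\<in>UNIV. \<bar>D $ i $ j\<bar>)" for D
  define T :: "(complex \<times> (real^'n^'n)) set" where
    "T = {p. det ((\<chi> i j. if i = j then fst p else 0) - cmat (snd p)) = 0} \<inter> {p. 1/2 \<le> \<bar>Re (fst p)\<bar>}"
  define C where "C r = {D. \<exists>z. z \<in> cball 0 r \<and> (z, D) \<in> T}" for r
  have "closed T"
    unfolding T_def
    by (intro closed_Int closed_Collect_eq closed_Collect_le continuous_on_char_det continuous_intros)
  then have clC: "closed (C r)" for r
    unfolding C_def by (intro closed_compact_projection) auto
  have opR: "open {D. R D < r}" for r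
    unfolding R_def by (intro open_Collect_less continuous_intros)
  have T: "(z, D) \<in> T \<longleftrightarrow> z \<in> char_roots D \<and> \<not> (- 1/2 < Re z \<and> Re z < 1/2)" for z D
    by (auto simp: T_def char_roots_def cong: if_cong)
  have "D_set = (\<Union>r. {D. R D < r} \<inter> - C r)"
  proof (intro equalityI subsetI)
    fix D assume "D \<in> (D_set :: (real^'n^'n) set)"
    then have "D \<notin> C r" for r
      by (auto simp: C_def T D_set_def)
    then show "D \<in> (\<Union>r. {D. R D < r} \<inter> - C r)"
      by (auto intro!: exI[of _ "R D + 1"])
  next
    fix D assume "D \<in> (\<Union>r. {D. R D < r} \<inter> - C r)"
    then obtain r where r: "R D < r" "D \<notin> C r"
      by blast
    show "D \<in> D_set"
      unfolding D_set_def
    proof (intro CollectI ballI)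
      fix z assume z: "z \<in> char_roots D"
      then have "z \<in> cball 0 r"
        using cmod_char_root_le[OF z] r(1) by (simp add: R_def)
      then show "- 1/2 < Re z \<and> Re z < 1/2"
        using r(2) z by (auto simp: C_def T)
    qed
  qed
  also have "open \<dots>"
    by (intro open_UN ballI open_Int opR) (auto simp: clC)
  finally show ?thesis .
qed

text \<open>With a simple spectrum every other eigenbasis is \<open>b\<close> up to reindexing and
  nonzero factors. Off-diagonal entries of the skew part thus stay nonzero in all of them, whereas
  an invariant proper \<open>J\<close> would need some to vanish.\<close>

lemma M_set_offdiag:
  fixes M :: "real^'n^'n"
  assumes ob: "orthonormal_basis b" and s: "\<And>i. sym_part M *v b i = s i *\<^sub>R b i" "inj s"
    and L: "\<And>i j. i \<noteq> j \<Longrightarrow> b j \<bullet> (skew_part M *v b i) \<noteq> 0"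
  shows "M \<in> M_set"
proof -
  have eb: "eigenbasis (sym_part M) b"
    using ob s(1) by (auto simp: eigenbasis_def)
  have "b i \<bullet> (sym_part M *v b i) = s i" for i
    using ob by (simp add: s orthonormal_basis_def)
  then have neq: "sym_part M \<in> S_neq"
    using S_neq_iff_eigenbasis[OF symmetric_sym_part eb] s(2) by simp
  have "skew_part M \<notin> L_invar b'" if b': "eigenbasis (sym_part M) b'" for b'
  proof
    assume inv: "skew_part M \<in> L_invar b'"
    have ob': "orthonormal_basis b'"
      using b' by (simp add: eigenbasis_def)
    have "\<exists>j c. b' i = c *\<^sub>R b j \<and> c \<noteq> 0" for i
    proof -
      obtain t where t: "sym_part M *v b' i = t *\<^sub>R b' i"
        using b' by (auto simp: eigenbasis_def)
      have eq: "s j * (b j \<bullet> b' i) = t * (b j \<bullet> b' i)" for j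
        using symmetric_inner_swap[OF symmetric_sym_part, of "b j" M "b' i"] by (auto simp: s t)
      have "b' i \<bullet> b' i = 1"
        using ob' by (simp add: orthonormal_basis_def)
      then have "b' i \<noteq> 0"
        by auto
      then obtain j where j: "b j \<bullet> b' i \<noteq> 0"
        using orthonormal_eq_zero[OF ob] by blast
      then have "t = s j"
        using eq[of j] by (metis mult_right_cancel)
      then have "b k \<bullet> b' i = 0" if "k \<noteq> j" for k
        using eq[of k] that s(2) by (auto simp: inj_def)
      then have "(\<Sum>k\<in>UNIV. (b k \<bullet> b' i) *\<^sub>R b k) = (\<Sum>k\<in>UNIV. if k = j then (b j \<bullet> b' i) *\<^sub>R b j else 0)"
        by (intro sum.cong) auto
      then have "b' i = (b j \<bullet> b' i) *\<^sub>R b j"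
        using orthonormal_expansion[OF ob, of "b' i"] by simp
      then show ?thesis
        using j by blast
    qed
    then obtain \<pi> c where \<pi>: "\<And>i. b' i = c i *\<^sub>R b (\<pi> i)" "\<And>i. c i \<noteq> (0::real)"
      by metis
    have "\<pi> i \<noteq> \<pi> j" if "i \<noteq> j" for i j
    proof
      assume eq: "\<pi> i = \<pi> j"
      have "b' i \<bullet> b' j = 0"
        using ob' that by (simp add: orthonormal_basis_def)
      moreover have "b' i \<bullet> b' j = c i * c j"
        using ob unfolding \<pi>(1) eq by (simp add: orthonormal_basis_def)
      ultimately show False
        using \<pi>(2) by simp
    qed
    then have "b' j \<bullet> (skew_part M *v b' i) \<noteq> 0" if "i \<noteq> j" for i j
      unfolding \<pi>(1) using L \<pi>(2) that by (simp add: matrix_vector_mult_scaleR)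
    moreover obtain J where J: "J \<noteq> {}" "J \<noteq> UNIV" "\<forall>i\<in>J. \<forall>j\<in>-J. b' j \<bullet> (skew_part M *v b' i) = 0"
      using inv unfolding L_invar_iff[OF ob'] by blast
    moreover obtain i j where "i \<in> J" "j \<notin> J"
      using J(1,2) by auto
    ultimately show False
      by (metis ComplI)
  qed
  then show ?thesis
    unfolding M_set_iff using neq skew_skew_part by (auto simp: l_set_def)
qed

text \<open>In one eigenbasis, the symmetric part is perturbed by a diagonal matrix and the skew
  part by one without zero off-diagonal entries. Each coincidence to be avoided is an affine
  equation in the size \<delta> with nonzero slope, so it excludes a single value.\<close>

lemma dense_M_set:
  fixes D :: "real^'n^'n"
  assumes "e > 0"
  shows "\<exists>M\<in>M_set. dist D M < e"
proof -
  obtain b where eb: "eigenbasis (sym_part D) b"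
    using eigenbasis_exists symmetric_sym_part by blast
  then have ob: "orthonormal_basis b"
    by (simp add: eigenbasis_def)
  define s where "s i = b i \<bullet> (sym_part D *v b i)" for i
  have s: "sym_part D *v b i = s i *\<^sub>R b i" for i
    unfolding s_def by (rule eigenbasis_eigenvalue[OF eb])
  obtain f :: "'n \<Rightarrow> nat" where f: "inj f"
    using finite_imp_inj_to_nat_seg[OF finite_class.finite_UNIV] by metis
  \<comment> \<open>Distinct reals: they separate the eigenvalues through \<open>K1\<close> and give
    \<open>K2\<close> nonzero off-diagonal entries.\<close>
  define \<tau> where "\<tau> i = real (f i)" for i
  have \<tau>: "\<tau> i \<noteq> \<tau> j" if "i \<noteq> j" for i j
    using f that by (auto simp: \<tau>_def inj_def)
  define B where "B = (\<chi> i. b i)"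
  have Bb: "B *v b i = axis i 1" for i
    using ob by (simp add: B_def matrix_vector_mult_def vec_eq_iff orthonormal_basis_def inner_vec_def axis_def)
  have conj: "b k \<bullet> ((transpose B ** K ** B) *v b l) = K $ k $ l" for K k l
  proof -
    have "b k \<bullet> ((transpose B ** K ** B) *v b l) = (B *v b k) \<bullet> (K *v (B *v b l))"
      by (simp only: matrix_vector_mul_assoc[symmetric] inner_matrix_vector[of "b k" "transpose B"]
          transpose_transpose)
    also have "\<dots> = K $ k $ l"
      unfolding Bb by (simp add: inner_axis' matrix_vector_mult_basis column_def)
    finally show ?thesis .
  qed
  define K1 K2 :: "real^'n^'n" where "K1 = (\<chi> i j. if i = j then \<tau> i else 0)" and "K2 = (\<chi> i j. \<tau> i - \<tau> j)"
  define E1 E2 where "E1 = transpose B ** K1 ** B" and "E2 = transpose B ** K2 ** B"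
  have "transpose K1 = K1" "transpose K2 = - K2"
    by (auto simp: K1_def K2_def transpose_def vec_eq_iff)
  then have E: "symmetric_mat E1" "skew_mat E2"
    unfolding symmetric_mat_def skew_mat_def E1_def E2_def
    by (simp_all add: matrix_transpose_mul matrix_mul_assoc matrix_mult_minus_left matrix_mult_minus_right)
  define e' where "e' = e / (norm (E1 + E2) + 1)"
  have "e' > 0"
    using assms by (simp add: e'_def add_nonneg_pos)
  \<comment> \<open>The sizes at which two eigenvalues collide or an off-diagonal entry vanishes.
    For \<open>i = j\<close> division by zero merely contributes the value 0.\<close>
  define bad where "bad = (\<Union>i. \<Union>j. {(s j - s i) / (\<tau> i - \<tau> j), - (b j \<bullet> (skew_part D *v b i)) / (\<tau> j - \<tau> i)})"
  have "finite bad"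
    unfolding bad_def by auto
  moreover have "infinite {0<..<e'}"
    using \<open>e' > 0\<close> by (simp add: infinite_Ioo)
  ultimately obtain \<delta> where \<delta>: "0 < \<delta>" "\<delta> < e'" "\<delta> \<notin> bad"
    by (metis finite_subset greaterThanLessThan_iff subsetI)
  define M where "M = (sym_part D + \<delta> *\<^sub>R E1) + (skew_part D + \<delta> *\<^sub>R E2)"
  have "symmetric_mat (sym_part D + \<delta> *\<^sub>R E1)" "skew_mat (skew_part D + \<delta> *\<^sub>R E2)"
    using E symmetric_sym_part[of D] skew_skew_part[of D]
    by (simp_all add: symmetric_mat_def skew_mat_def transpose_add transpose_scaleR)
  then have parts: "sym_part M = sym_part D + \<delta> *\<^sub>R E1" "skew_part M = skew_part D + \<delta> *\<^sub>R E2"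
    unfolding M_def by (simp_all add: sym_part_add skew_part_add)
  have "M \<in> M_set"
  proof (rule M_set_offdiag[OF ob])
    fix i
    have "b k \<bullet> (E1 *v b i - \<tau> i *\<^sub>R b i) = 0" for k
      using ob conj[of k K1 i] unfolding E1_def
      by (simp add: inner_diff_right K1_def orthonormal_basis_def)
    then have "E1 *v b i = \<tau> i *\<^sub>R b i"
      using orthonormal_eq_zero[OF ob] by (metis eq_iff_diff_eq_0)
    then show "sym_part M *v b i = (s i + \<delta> * \<tau> i) *\<^sub>R b i"
      unfolding parts by (simp add: matrix_vector_mult_add_rdistrib s scaleR_matrix_vector_assoc[symmetric] scaleR_left_distrib)
  next
    show "inj (\<lambda>i. s i + \<delta> * \<tau> i)"
    proof (rule injI, rule ccontr)
      fix i j assume eq: "s i + \<delta> * \<tau> i = s j + \<delta> * \<tau> j" and "i \<noteq> j"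
      then have "\<delta> = (s j - s i) / (\<tau> i - \<tau> j)"
        using \<tau>[of i j] by (simp add: field_simps)
      then show False
        using \<delta>(3) unfolding bad_def by blast
    qed
  next
    fix i j :: 'n assume "i \<noteq> j"
    have "b j \<bullet> (skew_part M *v b i) = b j \<bullet> (skew_part D *v b i) + \<delta> * (\<tau> j - \<tau> i)"
      unfolding parts using conj[of j K2 i]
      by (simp add: matrix_vector_mult_add_rdistrib scaleR_matrix_vector_assoc[symmetric] inner_add_right
          E2_def K2_def)
    moreover have "\<delta> \<noteq> - (b j \<bullet> (skew_part D *v b i)) / (\<tau> j - \<tau> i)"
      using \<delta>(3) unfolding bad_def by blast
    ultimately show "b j \<bullet> (skew_part M *v b i) \<noteq> 0"
      using \<tau>[of i j] \<open>i \<noteq> j\<close> by (auto simp: field_simps)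
  qed
  moreover have "dist D M < e"
  proof -
    have "D - M = - (\<delta> *\<^sub>R (E1 + E2))"
      using sym_add_skew_part[of D] unfolding M_def by (simp add: algebra_simps)
    then have "dist D M = \<delta> * norm (E1 + E2)"
      using \<delta>(1) by (simp add: dist_norm)
    also have "\<dots> \<le> \<delta> * (norm (E1 + E2) + 1)"
      using \<delta>(1) by simp
    also have "\<dots> < e"
      using \<delta>(2) by (simp add: e'_def pos_less_divide_eq add_nonneg_pos)
    finally show ?thesis .
  qed
  ultimately show ?thesis by blast
qed

lemma D_set_subset_closure: "D_set \<subseteq> closure (M_set \<inter> D_set :: (real^'n^'n) set)"
proof
  fix D :: "real^'n^'n" assume D: "D \<in> D_set"
  show "D \<in> closure (M_set \<inter> D_set)"
    unfolding closure_approachable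
  proof (intro allI impI)
    fix e :: real assume "e > 0"
    obtain r where r: "r > 0" "ball D r \<subseteq> D_set"
      using open_D_set D open_contains_ball by blast
    obtain M where "M \<in> M_set" "dist D M < min e r"
      using dense_M_set[of "min e r" D] \<open>e > 0\<close> r(1) by auto
    then show "\<exists>y\<in>M_set \<inter> D_set. dist y D < e"
      using r(2) by (intro bexI[of _ M]) (auto simp: dist_commute)
  qed
qed

text \<open>The set is nowhere dense by itself: its closure avoids the open \<open>M_set\<close>,
  while an open set meeting it meets \<open>D_set\<close> and hence, by density,
  \<open>M_set\<close>.\<close>

lemma meager_compl_M_set: "meager ((UNIV - M_set) \<inter> D_set :: (real^'n^'n) set)"
proof -
  let ?T = "(UNIV - M_set) \<inter> D_set :: (real^'n^'n) set"
  have "closure ?T \<subseteq> - M_set"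
    by (intro closure_minimal) (auto simp: closed_Compl open_M_set)
  have "interior (closure ?T) = {}"
  proof (rule ccontr)
    assume "interior (closure ?T) \<noteq> {}"
    then have "interior (closure ?T) \<inter> ?T \<noteq> {}"
      using open_Int_closure_eq_empty[OF open_interior, of "closure ?T" ?T] interior_subset[of "closure ?T"]
      by blast
    then obtain x where "x \<in> interior (closure ?T) \<inter> D_set"
      by blast
    then have "interior (closure ?T) \<inter> (M_set \<inter> D_set) \<noteq> {}"
      using D_set_subset_closure open_Int_closure_eq_empty[OF open_interior, of "closure ?T" "M_set \<inter> D_set"]
      by blast
    then show False
      using \<open>closure ?T \<subseteq> - M_set\<close> interior_subset[of "closure ?T"] by blast
  qed
  then show ?thesis
    unfolding meager_def nowhere_dense_def by (intro exI[of _ "{?T}"]) auto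
qed

section \<open>Growth of the matrix exponential\<close>

lemma sums_vec:
  fixes f :: "nat \<Rightarrow> 'a::real_normed_vector^'n"
  assumes "\<And>i. (\<lambda>k. f k $ i) sums (l $ i)"
  shows "f sums l"
  unfolding sums_def
  by (rule vec_tendstoI) (use assms in \<open>simp add: sums_def\<close>)

lemma mpow_scaleR: "mpow (u *\<^sub>R D) k = u ^ k *\<^sub>R mpow D k"
  by (induction k) (simp_all add: matrix_scalar_ac scalar_matrix_assoc[symmetric])

lemma mpow_commute: "D ** mpow D k = mpow D k ** D"
proof (induction k)
  case (Suc k)
  then have "D ** (D ** mpow D k) = D ** (mpow D k ** D)"
    by simp
  then show ?case
    by (simp add: matrix_mul_assoc)
qed simp

lemma mpow_entry_bound:
  fixes D :: "real^'n^'n"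
  shows "\<bar>mpow D k $ i $ j\<bar> \<le> (\<Sum>i\<in>UNIV. \<Sum>j\<in>UNIV. \<bar>D $ i $ j\<bar>) ^ k"
proof (induction k arbitrary: i)
  case 0
  then show ?case by (simp add: mat_def)
next
  case (Suc k)
  let ?R = "\<Sum>i\<in>UNIV. \<Sum>j\<in>UNIV. \<bar>D $ i $ j\<bar>"
  have "\<bar>mpow D (Suc k) $ i $ j\<bar> \<le> (\<Sum>l\<in>UNIV. \<bar>D $ i $ l\<bar> * \<bar>mpow D k $ l $ j\<bar>)"
    by (simp add: matrix_matrix_mult_def flip: abs_mult)
  also have "\<dots> \<le> (\<Sum>l\<in>UNIV. \<bar>D $ i $ l\<bar> * ?R ^ k)"
    by (intro sum_mono mult_left_mono Suc) auto
  also have "\<dots> = (\<Sum>l\<in>UNIV. \<bar>D $ i $ l\<bar>) * ?R ^ k"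
    by (simp add: sum_distrib_right)
  also have "\<dots> \<le> ?R * ?R ^ k"
    by (intro mult_right_mono member_le_sum zero_le_power sum_nonneg) auto
  finally show ?case by simp
qed

text \<open>The exponential along the line through \<open>D\<close>, as one scalar power series per
  entry, so that termwise differentiation of real power series applies.\<close>

definition mexp_series :: "real^'n^'n \<Rightarrow> real \<Rightarrow> real^'n^'n" where
  "mexp_series D u = (\<chi> i j. \<Sum>k. mpow D k $ i $ j / fact k * u ^ k)"

lemma summable_mexp:
  fixes D :: "real^'n^'n"
  shows "summable (\<lambda>k. mpow D k $ i $ j / fact k * u ^ k)"
proof (rule summable_comparison_test)
  let ?R = "\<Sum>i\<in>UNIV. \<Sum>j\<in>UNIV. \<bar>D $ i $ j\<bar>"
  show "summable (\<lambda>k. inverse (fact k) * (?R * \<bar>u\<bar>) ^ k)"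
    by (rule summable_exp)
  show "\<exists>N. \<forall>k\<ge>N. norm (mpow D k $ i $ j / fact k * u ^ k) \<le> inverse (fact k) * (?R * \<bar>u\<bar>) ^ k"
    using mpow_entry_bound[of D]
    by (auto simp: abs_mult power_abs power_mult_distrib divide_simps intro!: mult_right_mono)
qed

lemma mexp_eq_series: "mexp (u *\<^sub>R D) = mexp_series D u"
  unfolding mexp_def
proof (rule sums_unique[symmetric], intro sums_vec)
  fix i j
  have "(\<lambda>k. mpow D k $ i $ j / fact k * u ^ k) sums (\<Sum>k. mpow D k $ i $ j / fact k * u ^ k)"
    using summable_mexp by (rule summable_sums)
  then show "(\<lambda>k. ((1 / fact k) *\<^sub>R mpow (u *\<^sub>R D) k) $ i $ j) sums mexp_series D u $ i $ j"
    by (simp add: mpow_scaleR mexp_series_def mult_ac)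
qed

lemma mexp_0: "mexp (0 *\<^sub>R D) = mat 1"
proof -
  have "(\<Sum>k. mpow D k $ i $ j / fact k * 0 ^ k) = mat 1 $ i $ j" for i j
    using powser_zero[of "\<lambda>k. mpow D k $ i $ j / fact k"] by simp
  then show ?thesis
    unfolding mexp_eq_series mexp_series_def by (simp add: vec_eq_iff)
qed

text \<open>The formal derivative has coefficients \<open>mpow D (Suc k) / fact k\<close>. Pulling
  \<open>D\<close> out on the left or on the right gives the two forms; their equality is the
  commutation of \<open>D\<close> with its exponential.\<close>

lemma suminf_diffs_mpow:
  fixes D :: "real^'n^'n"
  shows "(\<Sum>k. diffs (\<lambda>k. mpow D k $ i $ j / fact k) k * u ^ k) = (D ** mexp_series D u) $ i $ j"
    and "(\<Sum>k. diffs (\<lambda>k. mpow D k $ i $ j / fact k) k * u ^ k) = (mexp_series D u ** D) $ i $ j"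
proof -
  have d: "diffs (\<lambda>k. mpow D k $ i $ j / fact k) k = mpow D (Suc k) $ i $ j / fact k" for k
    by (simp add: diffs_def del: mpow.simps of_nat_Suc)
  have "(\<Sum>k. mpow D (Suc k) $ i $ j / fact k * u ^ k) =
      (\<Sum>k. \<Sum>l\<in>UNIV. D $ i $ l * (mpow D k $ l $ j / fact k * u ^ k))"
    by (simp add: matrix_matrix_mult_def sum_divide_distrib sum_distrib_left mult_ac)
  also have "\<dots> = (\<Sum>l\<in>UNIV. D $ i $ l * (\<Sum>k. mpow D k $ l $ j / fact k * u ^ k))"
    by (subst suminf_sum) (intro summable_mult summable_mexp sum.cong refl suminf_mult)+
  finally show "(\<Sum>k. diffs (\<lambda>k. mpow D k $ i $ j / fact k) k * u ^ k) = (D ** mexp_series D u) $ i $ j"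
    unfolding d by (simp add: matrix_matrix_mult_def mexp_series_def)
  have "mpow D (Suc k) = mpow D k ** D" for k
    by (simp add: mpow_commute)
  then have "(\<Sum>k. mpow D (Suc k) $ i $ j / fact k * u ^ k) =
      (\<Sum>k. \<Sum>l\<in>UNIV. (mpow D k $ i $ l / fact k * u ^ k) * D $ l $ j)"
    by (simp only:) (simp add: matrix_matrix_mult_def sum_divide_distrib sum_distrib_left mult_ac)
  also have "\<dots> = (\<Sum>l\<in>UNIV. (\<Sum>k. mpow D k $ i $ l / fact k * u ^ k) * D $ l $ j)"
    by (subst suminf_sum) (intro summable_mult2 summable_mexp sum.cong refl suminf_mult2[symmetric])+
  finally show "(\<Sum>k. diffs (\<lambda>k. mpow D k $ i $ j / fact k) k * u ^ k) = (mexp_series D u ** D) $ i $ j"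
    unfolding d by (simp add: matrix_matrix_mult_def mexp_series_def)
qed

lemma mexp_commute: "D ** mexp (u *\<^sub>R D) = mexp (u *\<^sub>R D) ** D"
proof -
  have "(D ** mexp_series D u) $ i $ j = (mexp_series D u ** D) $ i $ j" for i j
    using suminf_diffs_mpow[of D i j u] by simp
  then show ?thesis
    by (simp add: mexp_eq_series vec_eq_iff)
qed

lemma mexp_has_derivative:
  fixes D :: "real^'n^'n"
  shows "((\<lambda>u. mexp (u *\<^sub>R D) $ i $ j) has_real_derivative (D ** mexp (u *\<^sub>R D)) $ i $ j) (at u)"
  unfolding mexp_eq_series suminf_diffs_mpow(1)[symmetric]
  unfolding mexp_series_def vec_lambda_beta
  by (rule termdiffs_strong_converges_everywhere[OF summable_mexp])

section \<open>Exponential growth of orbits\<close>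

lemma cmat_mult: "cmat (A ** B) = cmat A ** cmat B"
  by (simp add: cmat_def matrix_matrix_mult_def vec_eq_iff)

lemma cmat_mat_1: "cmat (mat 1) = mat 1"
  by (simp add: cmat_def mat_def vec_eq_iff)

text \<open>Commutation moves \<open>D\<close> from the left of the exponential onto
  \<open>w\<close>, so the derivative is again an orbit.\<close>

lemma mexp_orbit_has_vector_derivative:
  fixes D :: "real^'n^'n"
  shows "((\<lambda>u. (cmat (mexp (u *\<^sub>R D)) *v w) $ i) has_vector_derivative
    (cmat (mexp (u *\<^sub>R D)) *v (cmat D *v w)) $ i) (at u)"
proof -
  have "((\<lambda>u. \<Sum>j\<in>UNIV. complex_of_real (mexp (u *\<^sub>R D) $ i $ j) * w $ j) has_vector_derivative
      (\<Sum>j\<in>UNIV. complex_of_real ((D ** mexp (u *\<^sub>R D)) $ i $ j) * w $ j)) (at u)"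
    by (intro has_vector_derivative_sum has_vector_derivative_mult_left has_vector_derivative_of_real)
       (simp add: mexp_has_derivative flip: has_real_derivative_iff_has_vector_derivative)
  moreover have "(\<Sum>j\<in>UNIV. complex_of_real ((D ** mexp (u *\<^sub>R D)) $ i $ j) * w $ j) =
      (cmat (mexp (u *\<^sub>R D)) *v (cmat D *v w)) $ i"
    by (simp only: mexp_commute matrix_vector_mul_assoc cmat_mult[symmetric])
       (simp add: matrix_vector_mult_def cmat_def)
  ultimately show ?thesis
    by (simp add: matrix_vector_mult_def cmat_def)
qed

text \<open>Vectors whose orbit grows at most like \<open>exp (a * u)\<close>. This space is
  invariant under \<open>D\<close> and under complex scalars, and takes the place of a decomposition
  into generalized eigenspaces.\<close>

definition exp_bounded :: "real^'n^'n \<Rightarrow> real \<Rightarrow> (complex^'n) set" where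
  "exp_bounded D a = {w. \<exists>K. \<forall>u\<ge>0. \<forall>i. cmod ((cmat (mexp (u *\<^sub>R D)) *v w) $ i) \<le> K * exp (a * u)}"

lemma exp_boundedI:
  assumes "\<And>u i. 0 \<le> u \<Longrightarrow> cmod ((cmat (mexp (u *\<^sub>R D)) *v w) $ i) \<le> K * exp (a * u)"
  shows "w \<in> exp_bounded D a"
  using assms unfolding exp_bounded_def by blast

lemma exp_boundedD:
  assumes "w \<in> exp_bounded D a"
  shows "\<exists>K\<ge>0. \<forall>u\<ge>0. \<forall>i. cmod ((cmat (mexp (u *\<^sub>R D)) *v w) $ i) \<le> K * exp (a * u)"
proof -
  obtain K where K: "\<forall>u\<ge>0. \<forall>i. cmod ((cmat (mexp (u *\<^sub>R D)) *v w) $ i) \<le> K * exp (a * u)"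
    using assms unfolding exp_bounded_def by blast
  \<comment> \<open>At \<open>u = 0\<close> the exponential factor is 1, so any admissible constant
    is nonnegative.\<close>
  have "0 \<le> cmod ((cmat (mexp (0 *\<^sub>R D)) *v w) $ undefined)"
    by simp
  also have "\<dots> \<le> K"
    using K[rule_format, of 0 undefined] by simp
  finally show ?thesis
    using K by blast
qed

lemma exp_bounded_smult:
  assumes "w \<in> exp_bounded D a"
  shows "c *s w \<in> exp_bounded D a"
proof -
  obtain K where "0 \<le> K" and "\<forall>u\<ge>0. \<forall>i. cmod ((cmat (mexp (u *\<^sub>R D)) *v w) $ i) \<le> K * exp (a * u)"
    using exp_boundedD[OF assms] by blast
  then have K: "0 \<le> K" "\<And>u i. 0 \<le> u \<Longrightarrow> cmod ((cmat (mexp (u *\<^sub>R D)) *v w) $ i) \<le> K * exp (a * u)"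
    by blast+
  show ?thesis
    by (intro exp_boundedI[where K="cmod c * K"])
       (simp add: vector_scalar_commute norm_mult mult.assoc mult_left_mono K)
qed

lemma exp_bounded_add:
  assumes "v \<in> exp_bounded D a" "w \<in> exp_bounded D a"
  shows "v + w \<in> exp_bounded D a"
proof -
  obtain K where "0 \<le> K" and "\<forall>u\<ge>0. \<forall>i. cmod ((cmat (mexp (u *\<^sub>R D)) *v v) $ i) \<le> K * exp (a * u)"
    using exp_boundedD[OF assms(1)] by blast
  then have K: "0 \<le> K" "\<And>u i. 0 \<le> u \<Longrightarrow> cmod ((cmat (mexp (u *\<^sub>R D)) *v v) $ i) \<le> K * exp (a * u)"
    by blast+
  obtain L where "0 \<le> L" and "\<forall>u\<ge>0. \<forall>i. cmod ((cmat (mexp (u *\<^sub>R D)) *v w) $ i) \<le> L * exp (a * u)"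
    using exp_boundedD[OF assms(2)] by blast
  then have L: "0 \<le> L" "\<And>u i. 0 \<le> u \<Longrightarrow> cmod ((cmat (mexp (u *\<^sub>R D)) *v w) $ i) \<le> L * exp (a * u)"
    by blast+
  show ?thesis
  proof (rule exp_boundedI[where K="K + L"])
    fix u :: real and i assume "0 \<le> u"
    then show "cmod ((cmat (mexp (u *\<^sub>R D)) *v (v + w)) $ i) \<le> (K + L) * exp (a * u)"
      using norm_triangle_mono[OF K(2)[of u i] L(2)[of u i]] by (simp add: matrix_vector_right_distrib distrib_right)
  qed
qed

lemma exp_bounded_matrix:
  fixes D :: "real^'n^'n"
  assumes "w \<in> exp_bounded D a"
  shows "cmat D *v w \<in> exp_bounded D a"
proof -
  obtain K where "0 \<le> K" and "\<forall>u\<ge>0. \<forall>i. cmod ((cmat (mexp (u *\<^sub>R D)) *v w) $ i) \<le> K * exp (a * u)"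
    using exp_boundedD[OF assms] by blast
  then have K: "0 \<le> K" "\<And>u i. 0 \<le> u \<Longrightarrow> cmod ((cmat (mexp (u *\<^sub>R D)) *v w) $ i) \<le> K * exp (a * u)"
    by blast+
  let ?R = "\<Sum>i\<in>UNIV. \<Sum>j\<in>UNIV. \<bar>D $ i $ j\<bar>"
  show ?thesis
  proof (rule exp_boundedI[where K="?R * K"])
    fix u :: real and i assume u: "0 \<le> u"
    have "cmat (mexp (u *\<^sub>R D)) *v (cmat D *v w) = cmat D *v (cmat (mexp (u *\<^sub>R D)) *v w)"
      by (simp only: matrix_vector_mul_assoc cmat_mult[symmetric] mexp_commute)
    then have "cmod ((cmat (mexp (u *\<^sub>R D)) *v (cmat D *v w)) $ i) =
        cmod (\<Sum>j\<in>UNIV. complex_of_real (D $ i $ j) * (cmat (mexp (u *\<^sub>R D)) *v w) $ j)"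
      by (simp add: matrix_vector_mult_def[of "cmat D"]) (simp add: cmat_def)
    also have "\<dots> \<le> (\<Sum>j\<in>UNIV. \<bar>D $ i $ j\<bar> * (K * exp (a * u)))"
      by (intro sum_norm_le) (auto simp: norm_mult intro!: mult_left_mono K u)
    also have "\<dots> = (\<Sum>j\<in>UNIV. \<bar>D $ i $ j\<bar>) * (K * exp (a * u))"
      by (simp add: sum_distrib_right)
    also have "\<dots> \<le> ?R * (K * exp (a * u))"
      by (intro mult_right_mono member_le_sum sum_nonneg) (auto simp: K)
    finally show "cmod ((cmat (mexp (u *\<^sub>R D)) *v (cmat D *v w)) $ i) \<le> ?R * K * exp (a * u)"
      by (simp add: mult.assoc)
  qed
qed

lemma scaleR_eq_smult: "c *\<^sub>R w = complex_of_real c *s (w :: complex^'n)"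
  by (simp add: vec_eq_iff scaleR_conv_of_real[where 'a=complex])

lemma subspace_exp_bounded: "subspace (exp_bounded D a)"
proof (rule subspaceI)
  show "0 \<in> exp_bounded D a"
    by (rule exp_boundedI[where K=0]) simp
qed (auto simp: scaleR_eq_smult intro: exp_bounded_smult exp_bounded_add)

text \<open>With \<open>y\<close> the orbit of \<open>w\<close>, the function \<open>exp (-z u) y u\<close> has derivative
  \<open>exp (-z u)\<close> times the orbit of \<open>D w - z w\<close>.\<close>
lemma exp_bounded_char_root:
  fixes D :: "real^'n^'n"
  assumes "cmat D *v w - z *s w \<in> exp_bounded D a" and za: "Re z < a"
  shows "w \<in> exp_bounded D a"
proof -
  define g where "g = cmat D *v w - z *s w"
  obtain K where "0 \<le> K" and "\<forall>u\<ge>0. \<forall>i. cmod ((cmat (mexp (u *\<^sub>R D)) *v g) $ i) \<le> K * exp (a * u)"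
    using exp_boundedD[OF assms(1)[folded g_def]] by blast
  then have K: "0 \<le> K" "\<And>u i. 0 \<le> u \<Longrightarrow> cmod ((cmat (mexp (u *\<^sub>R D)) *v g) $ i) \<le> K * exp (a * u)"
    by blast+
  define \<phi> where "\<phi> u = K / (a - Re z) * exp ((a - Re z) * u)" for u
  define y where "y i u = (cmat (mexp (u *\<^sub>R D)) *v w) $ i" for i u
  define h where "h i u = exp (- z * of_real u) * y i u" for i u
  have Dw: "cmat D *v w = g + z *s w"
    by (simp add: g_def)
  have y': "(y i has_vector_derivative z * y i u + (cmat (mexp (u *\<^sub>R D)) *v g) $ i) (at u)" for i u
    using mexp_orbit_has_vector_derivative[of D w i u] unfolding Dw y_def
    by (simp add: matrix_vector_right_distrib vector_scalar_commute add.commute)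
  have e': "((\<lambda>u. exp (- z * of_real u)) has_vector_derivative (- z * exp (- z * of_real u))) (at u)" for u :: real
    by (rule has_vector_derivative_real_field) (auto intro!: derivative_eq_intros)
  have h': "(h i has_vector_derivative exp (- z * of_real u) * (cmat (mexp (u *\<^sub>R D)) *v g) $ i) (at u)" for i u
    using has_vector_derivative_mult[OF e'[of u] y'[of i u]] unfolding h_def
    by (simp add: algebra_simps)
  have \<phi>': "(\<phi> has_vector_derivative K * exp ((a - Re z) * u)) (at u)" for u
    unfolding \<phi>_def has_real_derivative_iff_has_vector_derivative[symmetric]
    using za by (auto intro!: derivative_eq_intros)
  have h0: "h i 0 = w $ i" for i
    using mexp_0[of D] by (simp add: h_def y_def cmat_mat_1)
  show ?thesis
  proof (rule exp_boundedI[where K="norm w + K / (a - Re z)"])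
    fix u :: real and i assume u: "0 \<le> u"
    have "norm (h i u - h i 0) \<le> \<phi> u - \<phi> 0"
    proof (cases "u = 0")
      case False
      show ?thesis
      proof (rule differentiable_bound_general)
        show "0 < u" using u False by simp
        show "continuous_on {0..u} (h i)" "continuous_on {0..u} \<phi>"
          using h' \<phi>' by (meson continuous_at_imp_continuous_on has_vector_derivative_continuous)+
        show "norm (exp (- z * of_real x) * (cmat (mexp (x *\<^sub>R D)) *v g) $ i) \<le> K * exp ((a - Re z) * x)"
          if "0 < x" "x < u" for x
        proof -
          have "norm (exp (- z * of_real x) * (cmat (mexp (x *\<^sub>R D)) *v g) $ i) \<le>
              exp (- Re z * x) * (K * exp (a * x))"
            unfolding norm_mult norm_exp_eq_Re using K(2)[of x i] that by (intro mult_mono) auto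
          also have "\<dots> = K * exp ((a - Re z) * x)"
            by (simp add: algebra_simps flip: exp_add)
          finally show ?thesis .
        qed
      qed (use h' \<phi>' in auto)
    qed simp
    moreover have "0 \<le> \<phi> 0"
      using za K(1) by (simp add: \<phi>_def)
    ultimately have "norm (h i u) \<le> norm (w $ i) + \<phi> u"
      using norm_triangle_ineq2[of "h i u" "h i 0"] by (simp add: h0)
    also have "\<dots> \<le> norm w + \<phi> u"
      by (simp add: Finite_Cartesian_Product.norm_nth_le)
    finally have hu: "norm (h i u) \<le> norm w + \<phi> u" .
    have "exp (z * of_real u) * exp (- z * of_real u) = 1"
      by (simp add: exp_minus_inverse)
    then have "y i u = exp (z * of_real u) * h i u"
      by (simp only: h_def mult.assoc[symmetric] mult_1_left)
    then have "cmod (y i u) = exp (Re z * u) * norm (h i u)"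
      by (simp add: norm_mult norm_exp_eq_Re)
    also have "\<dots> \<le> exp (Re z * u) * (norm w + \<phi> u)"
      using hu by (intro mult_left_mono) auto
    also have "\<dots> = exp (Re z * u) * norm w + K / (a - Re z) * exp (a * u)"
      by (simp add: \<phi>_def algebra_simps flip: exp_add)
    also have "\<dots> \<le> exp (a * u) * norm w + K / (a - Re z) * exp (a * u)"
      using za u by (intro add_right_mono mult_right_mono) (auto intro: mult_right_mono)
    finally show "cmod ((cmat (mexp (u *\<^sub>R D)) *v w) $ i) \<le> (norm w + K / (a - Re z)) * exp (a * u)"
      by (simp add: y_def algebra_simps)
  qed
qed

text \<open>If \<open>z\<close> is not a characteristic root, \<open>D - z\<close> is injective and
  maps the finite-dimensional space \<open>exp_bounded D a\<close> into itself, hence onto itself;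
  the preimage found there can only be \<open>w\<close>.\<close>

lemma exp_bounded_shift:
  fixes D :: "real^'n^'n"
  assumes a: "\<And>z. z \<in> char_roots D \<Longrightarrow> Re z < a"
    and w: "cmat D *v w - z *s w \<in> exp_bounded D a"
  shows "w \<in> exp_bounded D a"
proof (cases "z \<in> char_roots D")
  case True
  then show ?thesis
    using exp_bounded_char_root a w by blast
next
  case False
  let ?V = "exp_bounded D a"
  define f where "f v = cmat D *v v - z *s v" for v
  have lin: "linear f"
    unfolding f_def
    by (rule linearI) (simp_all add: matrix_vector_right_distrib scaleR_eq_smult vector_scalar_commute
        vector_add_ldistrib vector_ssub_ldistrib vector_smult_assoc mult.commute)
  have "v = 0" if "f v = 0" for v
    using False that unfolding char_roots_iff f_def by auto
  then have inj: "inj f"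
    using lin linear_injective_0 by blast
  have sub: "f ` ?V \<subseteq> ?V"
  proof clarify
    fix v assume "v \<in> ?V"
    then have "cmat D *v v + (- z) *s v \<in> ?V"
      by (intro exp_bounded_add exp_bounded_matrix exp_bounded_smult)
    then show "f v \<in> ?V"
      by (simp add: f_def vec_eq_iff)
  qed
  have "f ` ?V = ?V"
    using sub lin inj subspace_exp_bounded[of D a]
    by (intro subspace_dim_equal linear_subspace_image) (auto simp: dim_image_eq inj_on_subset)
  then obtain v where "v \<in> ?V" "f v = f w"
    using w unfolding f_def by (metis (no_types, lifting) imageE)
  then show ?thesis
    using inj by (metis injD)
qed

text \<open>The vector \<open>p(D) w\<close>, evaluated by Horner's scheme.\<close>

definition poly_orbit :: "real^'n^'n \<Rightarrow> complex poly \<Rightarrow> complex^'n \<Rightarrow> complex^'n" where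
  "poly_orbit D p w = fold_coeffs (\<lambda>a v. a *s w + cmat D *v v) p 0"

lemma poly_orbit_0 [simp]: "poly_orbit D 0 w = 0"
  by (simp add: poly_orbit_def)

lemma poly_orbit_pCons: "poly_orbit D (pCons a p) w = a *s w + cmat D *v poly_orbit D p w"
proof (cases "p = 0 \<and> a = 0")
  case False
  then show ?thesis
    unfolding poly_orbit_def by (cases "p = 0") (auto simp: fold_coeffs_pCons_coeff_not_0_eq)
qed auto

lemma poly_orbit_add: "poly_orbit D (p + q) w = poly_orbit D p w + poly_orbit D q w"
  by (induction p q rule: poly_induct2)
     (simp_all add: poly_orbit_pCons matrix_vector_right_distrib vector_sadd_rdistrib algebra_simps)

lemma poly_orbit_smult: "poly_orbit D (smult c p) w = c *s poly_orbit D p w"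
  by (induction p)
     (simp_all add: poly_orbit_pCons vector_add_ldistrib vector_smult_assoc vector_scalar_commute)

lemma poly_orbit_linear_factor:
  "poly_orbit D ([:- z, 1:] * p) w = cmat D *v poly_orbit D p w - z *s poly_orbit D p w"
proof -
  have "[:- z, 1:] * p = smult (- z) p + pCons 0 p"
    by simp
  then show ?thesis
    by (simp only: poly_orbit_add poly_orbit_smult poly_orbit_pCons) (simp add: vec_eq_iff)
qed

lemma poly_orbit_monom: "poly_orbit D (monom c k) w = c *s ((\<lambda>v. cmat D *v v) ^^ k) w"
  by (induction k) (simp_all add: monom_0 monom_Suc poly_orbit_pCons vector_scalar_commute)

lemma poly_orbit_sum: "poly_orbit D (\<Sum>k\<in>A. p k) w = (\<Sum>k\<in>A. poly_orbit D (p k) w)"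
  by (induction A rule: infinite_finite_induct) (simp_all add: poly_orbit_add)

text \<open>The vectors \<open>w\<close>, \<open>D w\<close>, ..., \<open>D^N w\<close> are one more
  than the real dimension \<open>N\<close>, so already real coefficients give a relation.\<close>

lemma annihilating_poly:
  fixes D :: "real^'n^'n"
  obtains p where "p \<noteq> 0" "poly_orbit D p w = 0"
proof -
  define N where "N = DIM(complex^'n)"
  define v where "v k = ((\<lambda>v. cmat D *v v) ^^ k) w" for k
  have "\<exists>c :: nat \<Rightarrow> real. (\<exists>k\<le>N. c k \<noteq> 0) \<and> (\<Sum>k\<le>N. c k *\<^sub>R v k) = 0"
  proof (cases "inj_on v {..N}")
    case True
    then have "card (v ` {..N}) = Suc N"
      by (simp add: card_image)
    then have "dependent (v ` {..N})"
      by (intro dependent_biggerset) (auto simp: N_def)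
    then obtain c where "\<exists>x\<in>v ` {..N}. c x \<noteq> 0" "(\<Sum>x\<in>v ` {..N}. c x *\<^sub>R x) = 0"
      using dependent_finite[of "v ` {..N}"] by auto
    then show ?thesis
      using True by (intro exI[of _ "c \<circ> v"]) (auto simp: sum.reindex)
  next
    \<comment> \<open>Linear dependence is a notion for sets of vectors, so a repetition among the
      powers has to be turned into a relation separately.\<close>
    case False
    then obtain i j where ij: "i \<le> N" "j \<le> N" "i \<noteq> j" "v i = v j"
      by (auto simp: inj_on_def)
    define c where "c k = (if k = i then 1 else 0) - (if k = j then 1 else (0::real))" for k
    have "(\<Sum>k\<le>N. c k *\<^sub>R v k) = 0"
      using ij by (simp add: c_def scaleR_left_diff_distrib sum_subtractf if_distrib[of "\<lambda>x. x *\<^sub>R _"] cong: if_cong)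
    moreover have "c i \<noteq> 0"
      using ij by (simp add: c_def)
    ultimately show ?thesis
      using ij by blast
  qed
  then obtain c k where c: "k \<le> N" "c k \<noteq> 0" "(\<Sum>k\<le>N. c k *\<^sub>R v k) = 0"
    by blast
  define p where "p = (\<Sum>k\<le>N. monom (complex_of_real (c k)) k)"
  have "coeff p k \<noteq> 0"
    using c by (simp add: p_def coeff_sum)
  then have "p \<noteq> 0"
    by auto
  moreover have "poly_orbit D p w = 0"
    using c(3) by (simp add: p_def poly_orbit_sum poly_orbit_monom v_def scaleR_eq_smult)
  ultimately show ?thesis
    using that by blast
qed

text \<open>Linear factors are split off one at a time and removed by
  \<open>exp_bounded_shift\<close>. That lemma accepts every \<open>z\<close>, so the roots of
  \<open>p\<close> need not be characteristic roots.\<close>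

lemma exp_bounded_poly:
  fixes D :: "real^'n^'n"
  assumes a: "\<And>z. z \<in> char_roots D \<Longrightarrow> Re z < a"
  shows "p \<noteq> 0 \<Longrightarrow> poly_orbit D p w \<in> exp_bounded D a \<Longrightarrow> w \<in> exp_bounded D a"
proof (induction "degree p" arbitrary: p)
  case 0
  then obtain c where p: "p = [:c:]"
    using degree_eq_zeroE by metis
  then have "inverse c *s (c *s w) \<in> exp_bounded D a"
    using 0 by (intro exp_bounded_smult[of "c *s w"]) (simp add: poly_orbit_pCons)
  then show ?case
    using 0 p by (simp add: vector_smult_assoc)
next
  case (Suc n)
  then have "\<not> constant (poly p)"
    by (simp add: constant_degree)
  then obtain z where "poly p z = 0"
    using fundamental_theorem_of_algebra by blast
  then have "[:- z, 1:] dvd p"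
    by (simp add: poly_eq_0_iff_dvd)
  then obtain q where q: "p = [:- z, 1:] * q"
    by (rule dvdE)
  then have "q \<noteq> 0"
    using Suc.prems(1) by auto
  moreover have "n = degree q"
    using Suc.hyps(2) \<open>q \<noteq> 0\<close> unfolding q by (subst (asm) degree_mult_eq) auto
  moreover have "poly_orbit D q w \<in> exp_bounded D a"
    using Suc.prems(2) exp_bounded_shift[OF a] unfolding q poly_orbit_linear_factor by blast
  ultimately show ?case
    using Suc.hyps(1) by blast
qed

text \<open>Every vector has an annihilating polynomial, and 0 is exponentially bounded, so every
  vector is. The strict inequality for \<open>a\<close> absorbs the polynomial factors that a
  nondiagonalizable \<open>D\<close> produces.\<close>

theorem mexp_growth:
  fixes D :: "real^'n^'n"
  assumes a: "\<And>z. z \<in> char_roots D \<Longrightarrow> Re z < a"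
  obtains K where "\<And>u i j. 0 \<le> u \<Longrightarrow> \<bar>mexp (u *\<^sub>R D) $ i $ j\<bar> \<le> K * exp (a * u)"
proof -
  have "w \<in> exp_bounded D a" for w
    using annihilating_poly[of D w] exp_bounded_poly[OF a] exp_boundedI[where K=0 and D=D and w=0 and a=a]
    by (metis matrix_vector_mult_0_right mult_zero_left norm_zero order_refl zero_index)
  then have "\<exists>K. \<forall>u\<ge>0. \<forall>i. cmod ((cmat (mexp (u *\<^sub>R D)) *v axis j 1) $ i) \<le> K * exp (a * u)" for j
    unfolding exp_bounded_def by blast
  then obtain K where K: "\<And>j u i. 0 \<le> u \<Longrightarrow> cmod ((cmat (mexp (u *\<^sub>R D)) *v axis j 1) $ i) \<le> K j * exp (a * u)"
    by metis
  have "\<bar>mexp (u *\<^sub>R D) $ i $ j\<bar> \<le> (\<Sum>j\<in>UNIV. \<bar>K j\<bar>) * exp (a * u)" if "0 \<le> u" for u i j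
  proof -
    have "\<bar>mexp (u *\<^sub>R D) $ i $ j\<bar> \<le> K j * exp (a * u)"
      using K[OF that, where i=i and j=j]
        by (simp add: matrix_vector_mult_def axis_def cmat_def if_distrib cong: if_cong)
    also have "\<dots> \<le> (\<Sum>j\<in>UNIV. \<bar>K j\<bar>) * exp (a * u)"
      using member_le_sum[of j UNIV "\<lambda>j. \<bar>K j\<bar>"] by (intro mult_right_mono) auto
    finally show ?thesis .
  qed
  then show ?thesis
    using that by blast
qed

section \<open>Uniqueness of distributions and centered Gaussian processes\<close>

text \<open>Levy's uniqueness theorem is about probability measures. The value at
  \<open>t = 0\<close> shows that the total masses agree, and division by a nonzero common mass
  reduces to that case.\<close>

lemma finite_measure_eqI_char:
  fixes M N :: "real measure"
  assumes fin: "finite_measure M" "finite_measure N"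
    and sets: "sets M = sets borel" "sets N = sets borel"
    and ch: "\<And>t. (CLINT x|M. iexp (t * x)) = (CLINT x|N. iexp (t * x))"
  shows "M = N"
proof -
  interpret M: finite_measure M by fact
  interpret N: finite_measure N by fact
  have sp: "space M = UNIV" "space N = UNIV"
    using sets sets_eq_imp_space_eq[of _ borel] by auto
  note [measurable_cong] = sets
  define m where "m = measure M UNIV"
  have m: "m = measure N UNIV"
    using ch[of 0] by (simp add: m_def sp)
  show ?thesis
  proof (cases "m = 0")
    case True
    show ?thesis
    proof (rule measure_eqI)
      fix A assume "A \<in> sets M"
      have "measure M A \<le> 0" "measure N A \<le> 0"
        using M.bounded_measure[of A] N.bounded_measure[of A] True m by (simp_all add: m_def sp)
      then show "emeasure M A = emeasure N A"
        by (simp add: M.emeasure_eq_measure N.emeasure_eq_measure measure_le_0_iff)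
    qed (simp add: sets)
  next
    case False
    then have "m > 0"
      by (simp add: m_def zero_less_measure_iff)
    define M' N' where "M' = density M (\<lambda>_. ennreal (1 / m))" and "N' = density N (\<lambda>_. ennreal (1 / m))"
    have e: "emeasure M' A = ennreal (1 / m) * emeasure M A" if "A \<in> sets borel" for A
      using that sets by (simp add: M'_def emeasure_density_const)
    have e': "emeasure N' A = ennreal (1 / m) * emeasure N A" if "A \<in> sets borel" for A
      using that sets by (simp add: N'_def emeasure_density_const)
    have one: "emeasure M' UNIV = 1" "emeasure N' UNIV = 1"
      using \<open>m > 0\<close> m
      by (simp_all add: e e' M.emeasure_eq_measure N.emeasure_eq_measure m_def[symmetric] ennreal_mult[symmetric])
    have M': "real_distribution M'"
      by (intro real_distribution.intro real_distribution_axioms.intro prob_spaceI)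
         (simp_all add: M'_def sets one[unfolded M'_def] sp)
    have N': "real_distribution N'"
      by (intro real_distribution.intro real_distribution_axioms.intro prob_spaceI)
         (simp_all add: N'_def sets one[unfolded N'_def] sp)
    have "char M' t = char N' t" for t
      using \<open>m > 0\<close> ch[of t] unfolding char_def M'_def N'_def
      by (subst (1 2) integral_density) auto
    then have "M' = N'"
      by (intro Levy_uniqueness M' N') auto
    show ?thesis
    proof (rule measure_eqI)
      fix A assume "A \<in> sets M"
      then have "ennreal (1 / m) * emeasure M A = ennreal (1 / m) * emeasure N A"
        using e[of A] e'[of A] \<open>M' = N'\<close> sets by simp
      then show "emeasure M A = emeasure N A"
        using \<open>m > 0\<close> by (simp add: ennreal_mult_cancel_left)
    qed (simp add: sets)
  qed
qed

text \<open>The phase \<open>- (pi / 2)\<close> turns the cosine into a sine, so cosines with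
  arbitrary phase carry the whole characteristic function.\<close>

lemma finite_measure_eqI_cos:
  fixes M N :: "real measure"
  assumes fin: "finite_measure M" "finite_measure N"
    and sets: "sets M = sets borel" "sets N = sets borel"
    and cos: "\<And>\<alpha> t. (\<integral>x. cos (\<alpha> + t * x) \<partial>M) = (\<integral>x. cos (\<alpha> + t * x) \<partial>N)"
  shows "M = N"
proof (rule finite_measure_eqI_char[OF fin sets])
  fix t
  note [measurable_cong] = sets
  have sin: "sin (t * x) = cos (- (pi / 2) + t * x)" for x
    by (simp add: cos_diff)
  have *: "(CLINT x|K. iexp (t * x)) =
      complex_of_real (\<integral>x. cos (0 + t * x) \<partial>K) + \<i> * complex_of_real (\<integral>x. cos (- (pi / 2) + t * x) \<partial>K)"
    if K: "finite_measure K" and [measurable_cong]: "sets K = sets borel" for K :: "real measure"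
  proof -
    interpret finite_measure K by fact
    have int: "integrable K (\<lambda>x. cos (a + t * x))" for a
      by (rule integrable_const_bound[where B=1]) auto
    have "(CLINT x|K. iexp (t * x)) =
        (CLINT x|K. complex_of_real (cos (0 + t * x)) + \<i> * complex_of_real (cos (- (pi / 2) + t * x)))"
      by (intro Bochner_Integration.integral_cong refl)
         (simp add: complex_eq_iff Re_exp Im_exp sin)
    also have "\<dots> = complex_of_real (\<integral>x. cos (0 + t * x) \<partial>K) + \<i> * complex_of_real (\<integral>x. cos (- (pi / 2) + t * x) \<partial>K)"
      using int[of 0] int[of "- (pi / 2)"] by (subst Bochner_Integration.integral_add) auto
    finally show ?thesis .
  qed
  show "(CLINT x|M. iexp (t * x)) = (CLINT x|N. iexp (t * x))"
    unfolding *[OF fin(1) sets(1)] *[OF fin(2) sets(2)] cos ..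
qed

section \<open>Cramer-Wold uniqueness of joint laws, one coordinate at a time\<close>

context prob_space
begin

lemma integrable_bounded:
  fixes f :: "'a \<Rightarrow> real"
  assumes "f \<in> borel_measurable M" "\<And>\<omega>. \<bar>f \<omega>\<bar> \<le> B"
  shows "integrable M f"
  using assms by (intro integrable_const_bound[where B=B]) auto

text \<open>Weighting the sample space by \<rho> or \<sigma> makes the laws of \<open>Y\<close> and
  \<open>Z\<close> finite measures on the line with equal cosine integrals, hence equal
  measures.\<close>

lemma weighted_expectation_eqI:
  fixes Y Z \<rho> \<sigma> :: "'a \<Rightarrow> real"
  assumes [measurable]: "random_variable borel Y" "random_variable borel Z"
      "random_variable borel \<rho>" "random_variable borel \<sigma>" "B \<in> sets borel"
    and \<rho>: "\<And>\<omega>. 0 \<le> \<rho> \<omega>" "\<And>\<omega>. \<rho> \<omega> \<le> K" and \<sigma>: "\<And>\<omega>. 0 \<le> \<sigma> \<omega>" "\<And>\<omega>. \<sigma> \<omega> \<le> K"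
    and cos: "\<And>\<alpha> t. expectation (\<lambda>\<omega>. \<rho> \<omega> * cos (\<alpha> + t * Y \<omega>)) = expectation (\<lambda>\<omega>. \<sigma> \<omega> * cos (\<alpha> + t * Z \<omega>))"
  shows "expectation (\<lambda>\<omega>. \<rho> \<omega> * indicator B (Y \<omega>)) = expectation (\<lambda>\<omega>. \<sigma> \<omega> * indicator B (Z \<omega>))"
proof -
  have int: "(\<integral>x. g x \<partial>distr (density M (\<lambda>\<omega>. ennreal (r \<omega>))) borel W) = expectation (\<lambda>\<omega>. r \<omega> * g (W \<omega>))"
    if [measurable]: "random_variable borel W" "random_variable borel r" "g \<in> borel_measurable borel"
      and "\<And>\<omega>. 0 \<le> r \<omega>" for W r and g :: "real \<Rightarrow> real"
    using that(4) by (subst integral_distr, simp, simp, subst integral_density) auto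
  have fin: "finite_measure (distr (density M (\<lambda>\<omega>. ennreal (r \<omega>))) borel W)"
    if [measurable]: "random_variable borel W" "random_variable borel r"
      and r: "\<And>\<omega>. 0 \<le> r \<omega>" "\<And>\<omega>. r \<omega> \<le> K" for W :: "'a \<Rightarrow> real" and r
  proof (rule finite_measureI)
    have "emeasure (distr (density M (\<lambda>\<omega>. ennreal (r \<omega>))) borel W) UNIV = (\<integral>\<^sup>+\<omega>. ennreal (r \<omega>) \<partial>M)"
      by (subst emeasure_distr, simp, simp, subst emeasure_density)
         (auto intro!: nn_integral_cong split: split_indicator)
    also have "\<dots> \<le> (\<integral>\<^sup>+\<omega>. ennreal K \<partial>M)"
      by (intro nn_integral_mono ennreal_leI r)
    also have "\<dots> < \<infinity>"
      by (simp add: emeasure_space_1)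
    finally show "emeasure (distr (density M (\<lambda>\<omega>. ennreal (r \<omega>))) borel W)
        (space (distr (density M (\<lambda>\<omega>. ennreal (r \<omega>))) borel W)) \<noteq> \<infinity>"
      by simp
  qed
  have "distr (density M (\<lambda>\<omega>. ennreal (\<rho> \<omega>))) borel Y = distr (density M (\<lambda>\<omega>. ennreal (\<sigma> \<omega>))) borel Z"
    using \<rho> \<sigma> cos by (intro finite_measure_eqI_cos fin) (simp_all add: int)
  then show ?thesis
    using int[of Y \<rho> "indicator B"] int[of Z \<sigma> "indicator B"] \<rho> \<sigma> by simp
qed

text \<open>Each induction step trades the frequency of one coordinate for an arbitrary Borel set.
  The indicators already obtained and the remaining cosine act as a weight, so uniqueness on the
  line is enough.\<close>

lemma cos_expectation_imp_mixed:
  fixes Y Z :: "'i \<Rightarrow> 'a \<Rightarrow> real"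
  assumes fin: "finite I"
    and Y [measurable]: "\<And>i. random_variable borel (Y i)" and Z [measurable]: "\<And>i. random_variable borel (Z i)"
    and A [measurable]: "\<And>i. A i \<in> sets borel"
    and cos: "\<And>\<alpha> c. expectation (\<lambda>\<omega>. cos (\<alpha> + (\<Sum>i\<in>I. c i * Y i \<omega>))) = expectation (\<lambda>\<omega>. cos (\<alpha> + (\<Sum>i\<in>I. c i * Z i \<omega>)))"
    and "J \<subseteq> I"
  shows "expectation (\<lambda>\<omega>. (\<Prod>i\<in>J. indicator (A i) (Y i \<omega>)) * cos (\<alpha> + (\<Sum>i\<in>I-J. c i * Y i \<omega>))) =
         expectation (\<lambda>\<omega>. (\<Prod>i\<in>J. indicator (A i) (Z i \<omega>)) * cos (\<alpha> + (\<Sum>i\<in>I-J. c i * Z i \<omega>)))"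
  using finite_subset[OF \<open>J \<subseteq> I\<close> fin] \<open>J \<subseteq> I\<close>
proof (induction J arbitrary: \<alpha> c rule: finite_induct)
  case empty
  then show ?case using cos by simp
next
  case (insert j J)
  have jI: "j \<in> I - J" "J \<subseteq> I"
    using insert.hyps insert.prems by auto
  define q where "q W \<omega> = (\<Prod>i\<in>J. indicator (A i) (W i \<omega>) :: real)" for W :: "'i \<Rightarrow> 'a \<Rightarrow> real" and \<omega>
  define \<theta> where "\<theta> W \<omega> = (\<Sum>i\<in>I - insert j J. c i * W i \<omega>)" for W :: "'i \<Rightarrow> 'a \<Rightarrow> real" and \<omega>
  have [measurable]: "random_variable borel (q W)" "random_variable borel (\<theta> W)"
    if [measurable]: "\<And>i. random_variable borel (W i)" for W
    unfolding q_def \<theta>_def by measurable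
  have q: "0 \<le> q W \<omega>" "q W \<omega> \<le> 1" for W \<omega>
    unfolding q_def by (auto intro!: prod_nonneg prod_le_1)
  have bnd: "\<bar>q W \<omega> * cos x\<bar> \<le> 1" for W \<omega> x
    using q[of W \<omega>] by (simp add: abs_mult mult_le_one)
  \<comment> \<open>Two independent frequencies: \<open>s\<close> for the remaining phase and
    \<open>t\<close> for the coordinate \<open>j\<close>. Below, \<open>s\<close> is taken to be 0
    or 1.\<close>
  have key: "expectation (\<lambda>\<omega>. q Y \<omega> * cos (\<beta> + s * \<theta> Y \<omega> + t * Y j \<omega>)) =
      expectation (\<lambda>\<omega>. q Z \<omega> * cos (\<beta> + s * \<theta> Z \<omega> + t * Z j \<omega>))" for \<beta> s t
  proof -
    have "(\<Sum>i\<in>I - J. ((\<lambda>i. s * c i)(j := t)) i * W i \<omega>) = s * \<theta> W \<omega> + t * W j \<omega>" for W :: "'i \<Rightarrow> 'a \<Rightarrow> real" and \<omega>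
    proof -
      have "I - J - {j} = I - insert j J"
        by auto
      then have "(\<Sum>i\<in>I - J. ((\<lambda>i. s * c i)(j := t)) i * W i \<omega>) =
          t * W j \<omega> + (\<Sum>i\<in>I - insert j J. ((\<lambda>i. s * c i)(j := t)) i * W i \<omega>)"
        by (simp only: sum.remove[OF finite_Diff[OF fin] jI(1)] fun_upd_same)
      also have "(\<Sum>i\<in>I - insert j J. ((\<lambda>i. s * c i)(j := t)) i * W i \<omega>) = s * \<theta> W \<omega>"
        by (simp add: \<theta>_def sum_distrib_left mult.assoc)
      finally show ?thesis by simp
    qed
    then show ?thesis
      using insert.IH[OF jI(2), of \<beta> "(\<lambda>i. s * c i)(j := t)"] unfolding q_def[symmetric]
      by (simp only: add.assoc)
  qed
  \<comment> \<open>A cosine is signed and cannot be a density, but one plus a cosine can. The case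
    \<open>s = 0\<close> supplies the part that is subtracted afterwards.\<close>
  have B: "expectation (\<lambda>\<omega>. (q Y \<omega> * (1 + s * cos (\<alpha> + \<theta> Y \<omega>))) * indicator (A j) (Y j \<omega>)) =
      expectation (\<lambda>\<omega>. (q Z \<omega> * (1 + s * cos (\<alpha> + \<theta> Z \<omega>))) * indicator (A j) (Z j \<omega>))" if s: "s = 0 \<or> s = (1::real)" for s
  proof (rule weighted_expectation_eqI[where K=2])
    fix \<beta> t
    \<comment> \<open>The product-to-sum formula reduces the product of two cosines to single ones;
      the factors \<open>0 *\<close> and \<open>1 *\<close> are kept to match the shape of
      \<open>key\<close>.\<close>
    have prod: "q W \<omega> * (1 + s * cos (\<alpha> + \<theta> W \<omega>)) * cos (\<beta> + t * W j \<omega>) =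
       q W \<omega> * cos (\<beta> + 0 * \<theta> W \<omega> + t * W j \<omega>) + (s / 2) * (q W \<omega> * cos (\<alpha> + \<beta> + 1 * \<theta> W \<omega> + t * W j \<omega>)) +
        (s / 2) * (q W \<omega> * cos (\<alpha> - \<beta> + 1 * \<theta> W \<omega> + (- t) * W j \<omega>))" for W :: "'i \<Rightarrow> 'a \<Rightarrow> real" and \<omega>
    proof -
      have "cos (\<alpha> + \<theta> W \<omega>) * cos (\<beta> + t * W j \<omega>) =
          (cos (\<alpha> + \<beta> + 1 * \<theta> W \<omega> + t * W j \<omega>) + cos (\<alpha> - \<beta> + 1 * \<theta> W \<omega> + (- t) * W j \<omega>)) / 2"
        using cos_times_cos[of "\<alpha> + \<theta> W \<omega>" "\<beta> + t * W j \<omega>"] by (simp add: algebra_simps)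
      moreover have "q W \<omega> * (1 + s * cos (\<alpha> + \<theta> W \<omega>)) * cos (\<beta> + t * W j \<omega>) = q W \<omega> * cos (\<beta> + t * W j \<omega>) +
          s * (q W \<omega> * (cos (\<alpha> + \<theta> W \<omega>) * cos (\<beta> + t * W j \<omega>)))"
        by (simp only: distrib_left distrib_right mult.assoc mult_1_left mult_1_right mult.left_commute)
      ultimately show ?thesis
        by (simp only:) (simp add: distrib_left)
    qed
    have int: "integrable M (\<lambda>\<omega>. q W \<omega> * cos (b + s' * \<theta> W \<omega> + t' * W j \<omega>))"
      if [measurable]: "\<And>i. random_variable borel (W i)" for W b s' t'
      by (rule integrable_bounded[OF _ bnd]) measurable
    have ex: "expectation (\<lambda>\<omega>. q W \<omega> * (1 + s * cos (\<alpha> + \<theta> W \<omega>)) * cos (\<beta> + t * W j \<omega>)) =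
        expectation (\<lambda>\<omega>. q W \<omega> * cos (\<beta> + 0 * \<theta> W \<omega> + t * W j \<omega>)) +
        (s / 2) * expectation (\<lambda>\<omega>. q W \<omega> * cos (\<alpha> + \<beta> + 1 * \<theta> W \<omega> + t * W j \<omega>)) +
        (s / 2) * expectation (\<lambda>\<omega>. q W \<omega> * cos (\<alpha> - \<beta> + 1 * \<theta> W \<omega> + (- t) * W j \<omega>))"
      if [measurable]: "\<And>i. random_variable borel (W i)" for W
      unfolding prod
      by (simp only: Bochner_Integration.integral_add Bochner_Integration.integrable_add
          integrable_mult_right int that integral_mult_right_zero)
    show "expectation (\<lambda>\<omega>. q Y \<omega> * (1 + s * cos (\<alpha> + \<theta> Y \<omega>)) * cos (\<beta> + t * Y j \<omega>)) =
        expectation (\<lambda>\<omega>. q Z \<omega> * (1 + s * cos (\<alpha> + \<theta> Z \<omega>)) * cos (\<beta> + t * Z j \<omega>))"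
      unfolding ex[of Y, OF Y] ex[of Z, OF Z] key ..
  next
    fix \<omega>
    have "\<bar>s * cos x\<bar> \<le> 1" for x
      using s by auto
    then have *: "0 \<le> 1 + s * cos x" "1 + s * cos x \<le> 2" for x
      using abs_le_D1[of "s * cos x" 1] abs_le_D2[of "s * cos x" 1] by (auto simp: algebra_simps)
    show "0 \<le> q Y \<omega> * (1 + s * cos (\<alpha> + \<theta> Y \<omega>))" "0 \<le> q Z \<omega> * (1 + s * cos (\<alpha> + \<theta> Z \<omega>))"
      using q * by auto
    show "q Y \<omega> * (1 + s * cos (\<alpha> + \<theta> Y \<omega>)) \<le> 2" "q Z \<omega> * (1 + s * cos (\<alpha> + \<theta> Z \<omega>)) \<le> 2"
      using mult_mono[OF q(2) *(2)] q * by auto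
  qed measurable
  have split: "expectation (\<lambda>\<omega>. (\<Prod>i\<in>insert j J. indicator (A i) (W i \<omega>)) * cos (\<alpha> + \<theta> W \<omega>)) =
      expectation (\<lambda>\<omega>. (q W \<omega> * (1 + 1 * cos (\<alpha> + \<theta> W \<omega>))) * indicator (A j) (W j \<omega>)) -
      expectation (\<lambda>\<omega>. (q W \<omega> * (1 + 0 * cos (\<alpha> + \<theta> W \<omega>))) * indicator (A j) (W j \<omega>))"
    if [measurable]: "\<And>i. random_variable borel (W i)" for W
  proof -
    have int: "integrable M (\<lambda>\<omega>. (q W \<omega> * (1 + s * cos (\<alpha> + \<theta> W \<omega>))) * indicator (A j) (W j \<omega>))"
      if s: "s = 0 \<or> s = (1::real)" for s
    proof (rule integrable_bounded[where B=2])
      fix \<omega>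
      have "\<bar>1 + s * cos x\<bar> \<le> 2" for x
      proof -
        have "- 1 \<le> s * cos x" "s * cos x \<le> 1"
          using s by auto
        then show ?thesis by linarith
      qed
      then have "\<bar>q W \<omega>\<bar> * \<bar>1 + s * cos (\<alpha> + \<theta> W \<omega>)\<bar> \<le> 1 * 2"
        using q[of W \<omega>] by (intro mult_mono) auto
      then show "\<bar>(q W \<omega> * (1 + s * cos (\<alpha> + \<theta> W \<omega>))) * indicator (A j) (W j \<omega>)\<bar> \<le> 2"
        by (auto simp: abs_mult split: split_indicator)
    qed measurable
    show ?thesis
      using insert.hyps
      by (subst Bochner_Integration.integral_diff[OF int[of 1] int[of 0], symmetric])
         (auto simp: q_def algebra_simps intro!: Bochner_Integration.integral_cong)
  qed
  show ?case
    using split[of Y, OF Y] split[of Z, OF Z] B[of 1] B[of 0] unfolding \<theta>_def by simp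
qed

lemma distr_PiM_eqI_cos:
  fixes Y Z :: "'i \<Rightarrow> 'a \<Rightarrow> real"
  assumes fin: "finite I"
    and [measurable]: "\<And>i. random_variable borel (Y i)" "\<And>i. random_variable borel (Z i)"
    and cos: "\<And>\<alpha> c. expectation (\<lambda>\<omega>. cos (\<alpha> + (\<Sum>i\<in>I. c i * Y i \<omega>))) = expectation (\<lambda>\<omega>. cos (\<alpha> + (\<Sum>i\<in>I. c i * Z i \<omega>)))"
  shows "distr M (Pi\<^sub>M I (\<lambda>_. borel)) (\<lambda>\<omega>. \<lambda>i\<in>I. Y i \<omega>) = distr M (Pi\<^sub>M I (\<lambda>_. borel)) (\<lambda>\<omega>. \<lambda>i\<in>I. Z i \<omega>)"
proof (rule measure_eqI_PiM_finite[OF fin])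
  fix A :: "'i \<Rightarrow> real set" assume A: "\<And>i. i \<in> I \<Longrightarrow> A i \<in> sets borel"
  \<comment> \<open>The mixed statement asks for Borel sets at every index, also outside
    \<open>I\<close>.\<close>
  define A' where "A' i = (if i \<in> I then A i else {})" for i
  have [measurable]: "A' i \<in> sets borel" for i
    using A by (simp add: A'_def)
  have "emeasure (distr M (Pi\<^sub>M I (\<lambda>_. borel)) (\<lambda>\<omega>. \<lambda>i\<in>I. W i \<omega>)) (Pi\<^sub>E I A) =
      ennreal (expectation (\<lambda>\<omega>. \<Prod>i\<in>I. indicator (A' i) (W i \<omega>)))"
    if [measurable]: "\<And>i. random_variable borel (W i)" for W
  proof -
    have "emeasure (distr M (Pi\<^sub>M I (\<lambda>_. borel)) (\<lambda>\<omega>. \<lambda>i\<in>I. W i \<omega>)) (Pi\<^sub>E I A) =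
        emeasure M {\<omega> \<in> space M. \<forall>i\<in>I. W i \<omega> \<in> A' i}"
      using fin A by (subst emeasure_distr) (auto simp: A'_def intro!: arg_cong[where f="emeasure M"] sets_PiM_I_finite)
    also have step: "\<dots> = ennreal (expectation (indicator {\<omega> \<in> space M. \<forall>i\<in>I. W i \<omega> \<in> A' i} :: 'a \<Rightarrow> real))"
      using fin by (simp add: emeasure_eq_measure)
    have ind: "indicator {\<omega> \<in> space M. \<forall>i\<in>I. W i \<omega> \<in> A' i} \<omega> = (\<Prod>i\<in>I. indicator (A' i) (W i \<omega>) :: real)"
      if "\<omega> \<in> space M" for \<omega>
      using that prod_zero_iff[OF fin, of "\<lambda>i. indicator (A' i) (W i \<omega>) :: real"]
      by (cases "\<forall>i\<in>I. W i \<omega> \<in> A' i") (auto simp: indicator_eq_0_iff)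
    from ind have "expectation (indicator {\<omega> \<in> space M. \<forall>i\<in>I. W i \<omega> \<in> A' i} :: 'a \<Rightarrow> real) =
        expectation (\<lambda>\<omega>. \<Prod>i\<in>I. indicator (A' i) (W i \<omega>))"
      by (intro Bochner_Integration.integral_cong refl)
    then show ?thesis by (simp only: calculation step)
  qed
  \<comment> \<open>With \<open>J = I\<close> no frequency is left, and the cosine factor is
    \<open>cos 0 = 1\<close>.\<close>
  then show "emeasure (distr M (Pi\<^sub>M I (\<lambda>_. borel)) (\<lambda>\<omega>. \<lambda>i\<in>I. Y i \<omega>)) (Pi\<^sub>E I A) =
      emeasure (distr M (Pi\<^sub>M I (\<lambda>_. borel)) (\<lambda>\<omega>. \<lambda>i\<in>I. Z i \<omega>)) (Pi\<^sub>E I A)"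
    using cos_expectation_imp_mixed[OF fin, of Y Z A' I 0 "\<lambda>_. 0"] cos by simp
next
  show "range (\<lambda>_::nat. \<Pi>\<^sub>E i\<in>I. UNIV) \<subseteq> prod_algebra I (\<lambda>_. borel :: real measure)"
    using fin by (auto intro!: prod_algebraI_finite)
  show "(\<Union>i::nat. \<Pi>\<^sub>E i\<in>I. UNIV) = space (Pi\<^sub>M I (\<lambda>_. borel :: real measure))"
    by (simp add: space_PiM)
  show "emeasure (distr M (Pi\<^sub>M I (\<lambda>_. borel)) (\<lambda>\<omega>. \<lambda>i\<in>I. Y i \<omega>)) (\<Pi>\<^sub>E i\<in>I. UNIV) \<noteq> \<infinity>" for i :: nat
    by (subst emeasure_distr) (auto simp: emeasure_eq_measure fin intro!: sets_PiM_I_finite)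
qed simp_all

end

lemma borel_measurable_vec_nth [measurable (raw)]:
  fixes f :: "'b \<Rightarrow> real^'n"
  shows "f \<in> borel_measurable N \<Longrightarrow> (\<lambda>x. f x $ i) \<in> borel_measurable N"
  by (rule borel_measurable_continuous_on[where f="\<lambda>x. x $ i"]) (intro continuous_intros)

lemma borel_measurable_vec_lambda [measurable (raw)]:
  fixes f :: "'b \<Rightarrow> 'n::finite \<Rightarrow> real"
  assumes [measurable]: "\<And>i. (\<lambda>x. f x i) \<in> borel_measurable N"
  shows "(\<lambda>x. \<chi> i. f x i) \<in> borel_measurable N"
proof -
  have "(\<lambda>x. \<chi> i. f x i) = (\<lambda>x. \<Sum>i\<in>UNIV. f x i *\<^sub>R axis i 1)"
    by (simp add: fun_eq_iff vec_eq_iff axis_def if_distrib cong: if_cong)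
  then show ?thesis
    by simp
qed

lemma borel_measurable_matrix_vector [measurable (raw)]:
  fixes f :: "'b \<Rightarrow> real^'n"
  shows "f \<in> borel_measurable N \<Longrightarrow> (\<lambda>x. C *v f x) \<in> borel_measurable N"
  by (rule borel_measurable_continuous_on[where f="\<lambda>x. C *v x"]) (intro continuous_intros)

section \<open>Moments and symmetry of centered Gaussian processes\<close>

context prob_space
begin

lemma gaussian_rv_moments:
  assumes Y [measurable]: "random_variable borel Y" and g: "gaussian_rv M Y"
  shows gaussian_rv_integrable: "integrable M Y"
    and gaussian_rv_integrable_square: "integrable M (\<lambda>\<omega>. (Y \<omega>)\<^sup>2)"
    and gaussian_rv_expectation_sin: "expectation Y = 0 \<Longrightarrow> expectation (\<lambda>\<omega>. sin (Y \<omega>)) = 0"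
proof -
  have "integrable M Y \<and> integrable M (\<lambda>\<omega>. (Y \<omega>)\<^sup>2) \<and> (expectation Y = 0 \<longrightarrow> expectation (\<lambda>\<omega>. sin (Y \<omega>)) = 0)"
    using g unfolding gaussian_rv_def
  proof (elim disjE exE conjE)
    fix \<mu> \<sigma> :: real
    assume \<sigma>: "\<sigma> > 0" and D: "distributed M lborel Y (normal_density \<mu> \<sigma>)"
    have i1: "integrable lborel (\<lambda>x. normal_density \<mu> \<sigma> x * x)"
      using integrable_normal_moment_nz_1[OF \<sigma>] .
    have "integrable lborel (\<lambda>x. normal_density \<mu> \<sigma> x * (x - \<mu>)^2 + 2 * \<mu> * (normal_density \<mu> \<sigma> x * x) - \<mu>\<^sup>2 * normal_density \<mu> \<sigma> x)"
      by (intro Bochner_Integration.integrable_add Bochner_Integration.integrable_diff integrable_mult_right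
          integrable_normal_moment integrable_normal_density i1 \<sigma>)
    also have "(\<lambda>x. normal_density \<mu> \<sigma> x * (x - \<mu>)^2 + 2 * \<mu> * (normal_density \<mu> \<sigma> x * x) - \<mu>\<^sup>2 * normal_density \<mu> \<sigma> x) =
        (\<lambda>x. normal_density \<mu> \<sigma> x * x\<^sup>2)"
      by (simp add: power2_eq_square algebra_simps)
    finally have i2: "integrable lborel (\<lambda>x. normal_density \<mu> \<sigma> x * x\<^sup>2)" .
    have "expectation (\<lambda>\<omega>. sin (Y \<omega>)) = 0" if "expectation Y = 0"
    proof -
      have "\<mu> = 0"
        using distributed_integral[OF D, of "\<lambda>x. x"] that integral_normal_moment_nz_1[OF \<sigma>, of \<mu>] by simp
      \<comment> \<open>The centered density is even and the sine is odd, so reflection turns the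
        integral into its negative.\<close>
      then have "(\<integral>x. normal_density \<mu> \<sigma> x * sin x \<partial>lborel) = - (\<integral>x. normal_density \<mu> \<sigma> x * sin x \<partial>lborel)"
        by (subst lborel_integral_real_affine[where c="-1" and t=0]) (simp_all add: normal_density_def)
      then show ?thesis
        using distributed_integral[OF D, of sin] by simp
    qed
    then show ?thesis
      using distributed_integrable[OF D, of "\<lambda>x. x"] distributed_integrable[OF D, of "\<lambda>x. x\<^sup>2"] i1 i2 by simp
  next
    fix c assume c: "AE \<omega> in M. Y \<omega> = c"
    then have "integrable M Y \<longleftrightarrow> integrable M (\<lambda>_. c)"
      by (intro integrable_cong_AE) auto
    moreover have "integrable M (\<lambda>\<omega>. (Y \<omega>)\<^sup>2) \<longleftrightarrow> integrable M (\<lambda>_. c\<^sup>2)"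
      using c by (intro integrable_cong_AE) auto
    moreover have "expectation Y = expectation (\<lambda>_. c)"
      using c by (intro integral_cong_AE) auto
    moreover have "expectation (\<lambda>\<omega>. sin (Y \<omega>)) = expectation (\<lambda>_. sin c)"
      using c by (intro integral_cong_AE) auto
    ultimately show ?thesis
      by (simp add: prob_space)
  qed
  then show "integrable M Y" "integrable M (\<lambda>\<omega>. (Y \<omega>)\<^sup>2)"
    "expectation Y = 0 \<Longrightarrow> expectation (\<lambda>\<omega>. sin (Y \<omega>)) = 0"
    by auto
qed

lemma gaussian_process_combination:
  assumes "gaussian_process M X"
  shows "gaussian_rv M (\<lambda>\<omega>. u \<bullet> X t \<omega>)"
proof -
  have "gaussian_rv M (\<lambda>\<omega>. \<Sum>i<k. cs i \<bullet> X (ts i) \<omega>)" for k :: nat and ts cs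
    using assms by (simp add: gaussian_process_def)
  from this[of "\<lambda>_. u" "\<lambda>_. t" 1] show ?thesis
    by simp
qed

lemma gaussian_process_measurable:
  "gaussian_process M X \<Longrightarrow> X t \<in> borel_measurable M"
  by (simp add: gaussian_process_def)

lemma gaussian_process_integrable:
  assumes g: "gaussian_process M X"
  shows "integrable M (\<lambda>\<omega>. u \<bullet> X t \<omega>)"
proof (rule gaussian_rv_integrable)
  note [measurable] = gaussian_process_measurable[OF g]
  show "random_variable borel (\<lambda>\<omega>. u \<bullet> X t \<omega>)"
    by measurable
qed (rule gaussian_process_combination[OF g])

lemma gaussian_process_integrable_mult:
  assumes g: "gaussian_process M X"
  shows "integrable M (\<lambda>\<omega>. (u \<bullet> X s \<omega>) * (v \<bullet> X t \<omega>))"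
proof (rule Bochner_Integration.integrable_bound)
  note [measurable] = gaussian_process_measurable[OF g]
  show "integrable M (\<lambda>\<omega>. (u \<bullet> X s \<omega>)\<^sup>2 + (v \<bullet> X t \<omega>)\<^sup>2)"
    by (intro Bochner_Integration.integrable_add gaussian_rv_integrable_square gaussian_process_combination g) measurable
  show "AE \<omega> in M. norm ((u \<bullet> X s \<omega>) * (v \<bullet> X t \<omega>)) \<le> norm ((u \<bullet> X s \<omega>)\<^sup>2 + (v \<bullet> X t \<omega>)\<^sup>2)"
  proof (rule AE_I2)
    fix \<omega>
    have "2 * \<bar>a * b\<bar> \<le> a\<^sup>2 + b\<^sup>2" for a b :: real
      using sum_squares_bound[of "\<bar>a\<bar>" "\<bar>b\<bar>"] by (simp add: abs_mult)
    then have "\<bar>a * b\<bar> \<le> a\<^sup>2 + b\<^sup>2" for a b :: real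
      by (smt (verit) abs_ge_zero)
    then show "norm ((u \<bullet> X s \<omega>) * (v \<bullet> X t \<omega>)) \<le> norm ((u \<bullet> X s \<omega>)\<^sup>2 + (v \<bullet> X t \<omega>)\<^sup>2)"
      by simp
  qed
  show "(\<lambda>\<omega>. (u \<bullet> X s \<omega>) * (v \<bullet> X t \<omega>)) \<in> borel_measurable M"
    by measurable
qed

lemma centered_gaussian_process_expectation_sin:
  assumes g: "gaussian_process M X" and mean: "\<And>t j. expectation (\<lambda>\<omega>. X t \<omega> $ j) = 0"
  shows "expectation (\<lambda>\<omega>. sin (\<Sum>i<(k::nat). u i \<bullet> X (ts i) \<omega>)) = 0"
proof (rule gaussian_rv_expectation_sin)
  note [measurable] = gaussian_process_measurable[OF g]
  show "random_variable borel (\<lambda>\<omega>. \<Sum>i<k. u i \<bullet> X (ts i) \<omega>)"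
    by measurable
  show "gaussian_rv M (\<lambda>\<omega>. \<Sum>i<k. u i \<bullet> X (ts i) \<omega>)"
    using g unfolding gaussian_process_def by blast
  have int: "integrable M (\<lambda>\<omega>. X t \<omega> $ j)" for t j
    using gaussian_process_integrable[OF g, of "axis j 1" t] by (simp add: inner_axis')
  have "expectation (\<lambda>\<omega>. v \<bullet> X t \<omega>) = 0" for v t
    unfolding inner_vec_def using int mean by simp
  then show "expectation (\<lambda>\<omega>. \<Sum>i<k. u i \<bullet> X (ts i) \<omega>) = 0"
    using gaussian_process_integrable[OF g] by simp
qed

text \<open>For a linear combination \<open>S\<close>, \<open>cos (\<alpha> + S)\<close> and
  \<open>cos (\<alpha> - S)\<close> differ by a multiple of \<open>sin S\<close>, whose mean is 0.
  Vectors are flattened to real coordinates indexed by time and component for the uniqueness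
  argument, and \<phi> reassembles them.\<close>

lemma centered_gaussian_process_symmetric:
  assumes g: "gaussian_process M X" and mean: "\<And>t j. expectation (\<lambda>\<omega>. X t \<omega> $ j) = 0"
  shows "distr M (Pi\<^sub>M {..<k::nat} (\<lambda>_. borel)) (\<lambda>\<omega>. \<lambda>i\<in>{..<k}. - X (ts i) \<omega>) =
         distr M (Pi\<^sub>M {..<k} (\<lambda>_. borel)) (\<lambda>\<omega>. \<lambda>i\<in>{..<k}. X (ts i) \<omega>)"
proof -
  note [measurable] = gaussian_process_measurable[OF g]
  define I where "I = {..<k} \<times> (UNIV :: 'b set)"
  define Y where "Y p \<omega> = X (ts (fst p)) \<omega> $ snd p" for p \<omega>
  define \<phi> :: "(nat \<times> 'b \<Rightarrow> real) \<Rightarrow> nat \<Rightarrow> real^'b" where "\<phi> y = (\<lambda>i\<in>{..<k}. \<chi> j. y (i, j))" for y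
  have Y [measurable]: "random_variable borel (Y p)" for p
    unfolding Y_def by measurable
  have comp: "(\<lambda>y. y (i, j)) \<in> borel_measurable (Pi\<^sub>M I (\<lambda>_. borel))" if "i < k" for i j
    using that by (intro measurable_component_singleton) (simp add: I_def)
  have \<phi>: "\<phi> \<in> measurable (Pi\<^sub>M I (\<lambda>_. borel)) (Pi\<^sub>M {..<k} (\<lambda>_. borel))"
    unfolding \<phi>_def by (intro measurable_restrict borel_measurable_vec_lambda comp) simp
  have sum: "(\<Sum>p\<in>I. c p * Y p \<omega>) = (\<Sum>i<k. (\<chi> j. c (i, j)) \<bullet> X (ts i) \<omega>)" for c \<omega>
    unfolding I_def Y_def inner_vec_def by (simp add: sum.cartesian_product case_prod_beta)
  have "expectation (\<lambda>\<omega>. cos (\<alpha> + (\<Sum>p\<in>I. c p * - Y p \<omega>))) = expectation (\<lambda>\<omega>. cos (\<alpha> + (\<Sum>p\<in>I. c p * Y p \<omega>)))" for \<alpha> c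
  proof -
    define S where "S \<omega> = (\<Sum>p\<in>I. c p * Y p \<omega>)" for \<omega>
    have [measurable]: "random_variable borel S"
      unfolding S_def by measurable
    have "expectation (\<lambda>\<omega>. sin (S \<omega>)) = 0"
      unfolding S_def sum by (rule centered_gaussian_process_expectation_sin[OF g mean])
    moreover have "integrable M (\<lambda>\<omega>. cos (S \<omega>))" "integrable M (\<lambda>\<omega>. sin (S \<omega>))"
      by (rule integrable_bounded[where B=1]; simp)+
    ultimately have "expectation (\<lambda>\<omega>. cos (\<alpha> + - S \<omega>)) = expectation (\<lambda>\<omega>. cos (\<alpha> + S \<omega>))"
      by (simp add: cos_add cos_diff)
    then show ?thesis
      by (simp add: S_def sum_negf)
  qed
  then have eq: "distr M (Pi\<^sub>M I (\<lambda>_. borel)) (\<lambda>\<omega>. \<lambda>p\<in>I. - Y p \<omega>) = distr M (Pi\<^sub>M I (\<lambda>_. borel)) (\<lambda>\<omega>. \<lambda>p\<in>I. Y p \<omega>)"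
    by (intro distr_PiM_eqI_cos) (auto simp: I_def)
  have push: "distr M (Pi\<^sub>M {..<k} (\<lambda>_. borel)) (\<lambda>\<omega>. \<lambda>i\<in>{..<k}. \<chi> j. W (i, j) \<omega>) =
      distr (distr M (Pi\<^sub>M I (\<lambda>_. borel)) (\<lambda>\<omega>. \<lambda>p\<in>I. W p \<omega>)) (Pi\<^sub>M {..<k} (\<lambda>_. borel)) \<phi>"
    if [measurable]: "\<And>p. random_variable borel (W p)" for W
  proof -
    have "(\<lambda>\<omega>. \<lambda>p\<in>I. W p \<omega>) \<in> measurable M (Pi\<^sub>M I (\<lambda>_. borel))"
      by measurable
    moreover have "\<phi> \<circ> (\<lambda>\<omega>. \<lambda>p\<in>I. W p \<omega>) = (\<lambda>\<omega>. \<lambda>i\<in>{..<k}. \<chi> j. W (i, j) \<omega>)"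
      by (auto simp: \<phi>_def I_def fun_eq_iff restrict_def vec_eq_iff)
    ultimately show ?thesis
      by (simp add: distr_distr \<phi>)
  qed
  have "(\<chi> j. - Y (i, j) \<omega>) = - X (ts i) \<omega>" "(\<chi> j. Y (i, j) \<omega>) = X (ts i) \<omega>" for i \<omega>
    by (simp_all add: Y_def vec_eq_iff)
  then show ?thesis
    using push[of Y, OF Y] push[of "\<lambda>p \<omega>. - Y p \<omega>"] eq by simp
qed

text \<open>Two times suffice: a product of two linear functionals is integrated against the two
  equal laws, and \<open>C\<close> moves across the inner product as its transpose.\<close>

lemma sym_group_second_moments:
  assumes g: "gaussian_process M X" and C: "C \<in> sym_group M X"
  shows "expectation (\<lambda>\<omega>. ((transpose C *v u) \<bullet> X s \<omega>) * ((transpose C *v u) \<bullet> X t \<omega>)) =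
         expectation (\<lambda>\<omega>. (u \<bullet> X s \<omega>) * (u \<bullet> X t \<omega>))"
proof -
  note [measurable] = gaussian_process_measurable[OF g]
  define ts where "ts i = (if i = 0 then s else t)" for i :: nat
  let ?P = "Pi\<^sub>M {..<2::nat} (\<lambda>_. borel :: (real^'b) measure)"
  define f :: "(nat \<Rightarrow> real^'b) \<Rightarrow> real" where "f y = (u \<bullet> y 0) * (u \<bullet> y 1)" for y
  have [measurable]: "(\<lambda>y. y 0) \<in> borel_measurable ?P" "(\<lambda>y. y 1) \<in> borel_measurable ?P"
    by (intro measurable_component_singleton; simp)+
  have f [measurable]: "f \<in> borel_measurable ?P"
    unfolding f_def by measurable
  have "(\<integral>y. f y \<partial>distr M ?P (\<lambda>\<omega>. \<lambda>i\<in>{..<2}. C *v X (ts i) \<omega>)) = (\<integral>y. f y \<partial>distr M ?P (\<lambda>\<omega>. \<lambda>i\<in>{..<2}. X (ts i) \<omega>))"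
    using C unfolding sym_group_def by simp
  moreover have "(\<integral>y. f y \<partial>distr M ?P (\<lambda>\<omega>. \<lambda>i\<in>{..<2}. C *v X (ts i) \<omega>)) =
      expectation (\<lambda>\<omega>. (u \<bullet> (C *v X s \<omega>)) * (u \<bullet> (C *v X t \<omega>)))"
    by (subst integral_distr) (auto simp: f_def ts_def)
  moreover have "(\<integral>y. f y \<partial>distr M ?P (\<lambda>\<omega>. \<lambda>i\<in>{..<2}. X (ts i) \<omega>)) = expectation (\<lambda>\<omega>. (u \<bullet> X s \<omega>) * (u \<bullet> X t \<omega>))"
    by (subst integral_distr) (auto simp: f_def ts_def)
  ultimately show ?thesis
    by (simp only: inner_matrix_vector)
qed

end

section \<open>The spectral density\<close>

lemma cmat_uminus_vector: "cmat (- D) *v v = - (cmat D *v v)"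
  by (simp add: cmat_def matrix_vector_mult_def vec_eq_iff sum_negf)

lemma char_roots_uminus:
  assumes "z \<in> char_roots (- D)"
  shows "- z \<in> char_roots D"
proof -
  obtain v where v: "v \<noteq> 0" "cmat (- D) *v v = z *s v"
    using assms unfolding char_roots_iff by blast
  then have "cmat D *v v = - (z *s v)"
    by (metis cmat_uminus_vector minus_minus)
  also have "\<dots> = (- z) *s v"
    by (simp add: vec_eq_iff)
  finally show ?thesis
    using v(1) char_roots_iff by blast
qed

text \<open>The root set is compact, so the strict bound 1/2 leaves a gap, and \<open>a\<close> is
  the midpoint of it. Inserting 0 makes the set visibly nonempty.\<close>

lemma D_set_uniform_bound:
  fixes D :: "real^'n^'n"
  assumes "D \<in> D_set"
  obtains a where "0 \<le> a" "a < 1/2" "\<And>z. z \<in> char_roots D \<Longrightarrow> \<bar>Re z\<bar> < a"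
proof -
  let ?S = "insert 0 (char_roots D)"
  have "char_roots D = (\<lambda>z. (z, D)) -` {p. det ((\<chi> i j. if i = j then fst p else 0) - cmat (snd p)) = 0}"
    by (auto simp: char_roots_def cong: if_cong)
  moreover have "closed \<dots>"
    by (intro closed_vimage closed_Collect_eq continuous_on_char_det continuous_intros)
  ultimately have "closed (char_roots D)"
    by simp
  moreover have "bounded (char_roots D)"
    using cmod_char_root_le[of _ D] by (auto simp: bounded_iff)
  ultimately have "compact ?S"
    by (simp add: compact_eq_bounded_closed)
  moreover have "continuous_on ?S (\<lambda>z. \<bar>Re z\<bar>)"
    by (intro continuous_intros)
  ultimately obtain w where w: "w \<in> ?S" "\<And>z. z \<in> ?S \<Longrightarrow> \<bar>Re z\<bar> \<le> \<bar>Re w\<bar>"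
    using continuous_attains_sup[of ?S "\<lambda>z. \<bar>Re z\<bar>"] by blast
  have "\<bar>Re w\<bar> < 1/2"
    using w(1) assms by (auto simp: D_set_def)
  then show ?thesis
    using w(2) by (intro that[of "(\<bar>Re w\<bar> + 1/2) / 2"]) force+
qed

text \<open>Negative \<open>r\<close> are covered by the growth bound for \<open>- D\<close>, whose
  characteristic roots are the negatives of those of \<open>D\<close>.\<close>

lemma mexp_growth_D_set:
  fixes D :: "real^'n^'n"
  assumes "D \<in> D_set"
  obtains a K where "0 \<le> a" "a < 1/2" "0 \<le> K" "\<And>r i j. \<bar>mexp (r *\<^sub>R D) $ i $ j\<bar> \<le> K * exp (a * \<bar>r\<bar>)"
proof -
  obtain a where a: "0 \<le> a" "a < 1/2" "\<And>z. z \<in> char_roots D \<Longrightarrow> \<bar>Re z\<bar> < a"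
    using D_set_uniform_bound[OF assms] by blast
  have "Re z < a" if "z \<in> char_roots D" for z
    using a(3)[OF that] by simp
  then obtain K where K: "\<And>u i j. 0 \<le> u \<Longrightarrow> \<bar>mexp (u *\<^sub>R D) $ i $ j\<bar> \<le> K * exp (a * u)"
    using mexp_growth[of D a] by blast
  have "Re z < a" if "z \<in> char_roots (- D)" for z
    using a(3)[OF char_roots_uminus[OF that]] by simp
  then obtain L where L: "\<And>u i j. 0 \<le> u \<Longrightarrow> \<bar>mexp (u *\<^sub>R (- D)) $ i $ j\<bar> \<le> L * exp (a * u)"
    using mexp_growth[of "- D" a] by blast
  have "\<bar>mexp (r *\<^sub>R D) $ i $ j\<bar> \<le> (\<bar>K\<bar> + \<bar>L\<bar>) * exp (a * \<bar>r\<bar>)" for r i j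
  proof (cases "0 \<le> r")
    case True
    have "\<bar>mexp (r *\<^sub>R D) $ i $ j\<bar> \<le> K * exp (a * r)"
      by (rule K[OF True])
    also have "\<dots> \<le> (\<bar>K\<bar> + \<bar>L\<bar>) * exp (a * r)"
      by (intro mult_right_mono) auto
    finally show ?thesis
      using True by simp
  next
    case False
    have "\<bar>mexp (r *\<^sub>R D) $ i $ j\<bar> \<le> L * exp (a * (- r))"
      using L[of "- r" i j] False by simp
    also have "\<dots> \<le> (\<bar>K\<bar> + \<bar>L\<bar>) * exp (a * (- r))"
      by (intro mult_right_mono) auto
    finally show ?thesis
      using False by simp
  qed
  then show ?thesis
    using a by (intro that[of a "\<bar>K\<bar> + \<bar>L\<bar>"]) auto
qed

lemma continuous_on_mexp [continuous_intros]:
  fixes D :: "real^'n^'n"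
  assumes "continuous_on S f"
  shows "continuous_on S (\<lambda>x. mexp (f x *\<^sub>R D) $ i $ j)"
proof -
  have "continuous_on UNIV (\<lambda>r. mexp (r *\<^sub>R D) $ i $ j)"
    by (intro continuous_at_imp_continuous_on ballI DERIV_isCont[OF mexp_has_derivative])
  then show ?thesis
    using continuous_on_compose2[OF _ assms] by blast
qed

section \<open>Integrability of the spectral integrand\<close>

lemma norm_iexp_minus_1_le: "cmod (iexp x - 1) \<le> \<bar>x\<bar>"
  using iexp_approx1[of x 0] by simp

lemma norm_spec_kernel_le: "cmod (spec_kernel t x) \<le> \<bar>t\<bar>"
proof (cases "x = 0")
  case False
  have "cmod (spec_kernel t x) \<le> \<bar>t * x\<bar> / \<bar>x\<bar>"
    using norm_iexp_minus_1_le[of "t * x"] unfolding spec_kernel_def norm_divide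
    by (intro frac_le) (auto simp: norm_mult False)
  then show ?thesis
    using False by (simp add: abs_mult)
qed (simp add: spec_kernel_def)

lemma norm_spec_kernel_le_inverse: "cmod (spec_kernel t x) \<le> 2 / \<bar>x\<bar>"
proof -
  have "cmod (iexp (t * x) - 1) \<le> 2"
    using norm_triangle_ineq4[of "iexp (t * x)" 1] by simp
  then show ?thesis
    unfolding spec_kernel_def norm_divide by (auto simp: norm_mult intro!: divide_right_mono)
qed

text \<open>Majorant on the positive half-line: two factors of size \<open>x powr (- a)\<close> near
  0, and two of size \<open>x powr a\<close> against kernel decay \<open>x powr (- 2)\<close> at
  infinity. Both pieces are integrable exactly because \<open>a < 1/2\<close>. They overlap at 1,
  which an upper bound tolerates.\<close>

definition powr_envelope :: "real \<Rightarrow> real \<Rightarrow> real" where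
  "powr_envelope a x = indicator {0..1} x * x powr (- 2 * a) + indicator {1..} x * x powr (2 * a - 2)"

lemma powr_envelope_measurable [measurable]: "powr_envelope a \<in> borel_measurable borel"
  unfolding powr_envelope_def by measurable

lemma powr_envelope_nonneg: "0 \<le> powr_envelope a x"
  unfolding powr_envelope_def by (auto simp: indicator_def)

lemma integrable_lborel_indicator_powr:
  fixes A :: "real set"
  assumes "(\<lambda>x. x powr e) integrable_on A" "A \<in> sets borel"
  shows "integrable lborel (\<lambda>x. indicator A x * x powr e)"
proof -
  have "(\<lambda>x. x powr e) absolutely_integrable_on A"
    using assms(1) by (rule nonnegative_absolutely_integrable_1) auto
  then have "integrable (completion lborel) (\<lambda>x. indicator A x * x powr e)"
    unfolding set_integrable_def by simp
  moreover have "(\<lambda>x. indicator A x * x powr e) \<in> borel_measurable lborel"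
    using assms(2) by measurable
  ultimately show ?thesis
    by (simp add: integrable_completion)
qed

lemma integrable_powr_envelope:
  assumes "0 \<le> a" "a < 1/2"
  shows "integrable lborel (powr_envelope a)"
  unfolding powr_envelope_def
proof (rule Bochner_Integration.integrable_add)
  show "integrable lborel (\<lambda>x. indicator {0..1} x * x powr (- 2 * a))"
    using has_integral_powr_from_0[of "- 2 * a" 1] assms by (intro integrable_lborel_indicator_powr) (auto intro: has_integral_integrable)
  show "integrable lborel (\<lambda>x. indicator {1..} x * x powr (2 * a - 2))"
    using has_integral_powr_to_inf[of "2 * a - 2" 1] assms by (intro integrable_lborel_indicator_powr) (auto intro: has_integral_integrable)
qed

text \<open>For \<open>\<bar>x\<bar> \<le> 1\<close> the kernels are bounded by the times, beyond
  that by \<open>2 / \<bar>x\<bar>\<close> each, whence the constant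
  \<open>\<bar>s\<bar> * \<bar>t\<bar> + 4\<close>.\<close>

lemma kernel_growth_le_envelope:
  assumes a: "0 \<le> a" and x: "x \<noteq> 0"
  shows "cmod (spec_kernel s x) * cmod (spec_kernel t x) * (exp (a * \<bar>ln \<bar>x\<bar>\<bar>))\<^sup>2 \<le>
    (\<bar>s\<bar> * \<bar>t\<bar> + 4) * (powr_envelope a x + powr_envelope a (- x))"
proof -
  have env: "powr_envelope a \<bar>x\<bar> \<le> powr_envelope a x + powr_envelope a (- x)"
    using powr_envelope_nonneg[of a x] powr_envelope_nonneg[of a "- x"] by (cases "0 \<le> x") auto
  have sq: "(exp (a * \<bar>ln \<bar>x\<bar>\<bar>))\<^sup>2 = exp (2 * a * \<bar>ln \<bar>x\<bar>\<bar>)"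
    by (simp add: power2_eq_square flip: exp_add)
  have "cmod (spec_kernel s x) * cmod (spec_kernel t x) * exp (2 * a * \<bar>ln \<bar>x\<bar>\<bar>) \<le> (\<bar>s\<bar> * \<bar>t\<bar> + 4) * powr_envelope a \<bar>x\<bar>"
  proof (cases "\<bar>x\<bar> \<le> 1")
    case True
    have "exp (2 * a * \<bar>ln \<bar>x\<bar>\<bar>) = \<bar>x\<bar> powr (- 2 * a)"
      using True x by (simp add: powr_def abs_of_nonpos)
    also have "\<dots> \<le> powr_envelope a \<bar>x\<bar>"
      using True by (simp add: powr_envelope_def indicator_def)
    finally have e: "exp (2 * a * \<bar>ln \<bar>x\<bar>\<bar>) \<le> powr_envelope a \<bar>x\<bar>" .
    have "cmod (spec_kernel s x) * cmod (spec_kernel t x) \<le> \<bar>s\<bar> * \<bar>t\<bar>"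
      by (intro mult_mono norm_spec_kernel_le) auto
    also have "\<dots> \<le> \<bar>s\<bar> * \<bar>t\<bar> + 4"
      by simp
    finally show ?thesis
      using e by (intro mult_mono) auto
  next
    case False
    have "cmod (spec_kernel s x) * cmod (spec_kernel t x) \<le> (2 / \<bar>x\<bar>) * (2 / \<bar>x\<bar>)"
      by (intro mult_mono norm_spec_kernel_le_inverse) auto
    also have "\<dots> = 4 * \<bar>x\<bar> powr (- 2)"
      using x by (simp add: powr_minus powr_numeral power2_eq_square field_simps)
    finally have k: "cmod (spec_kernel s x) * cmod (spec_kernel t x) \<le> 4 * \<bar>x\<bar> powr (- 2)" .
    have "exp (2 * a * \<bar>ln \<bar>x\<bar>\<bar>) = \<bar>x\<bar> powr (2 * a)"
      using False by (simp add: powr_def)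
    then have "cmod (spec_kernel s x) * cmod (spec_kernel t x) * exp (2 * a * \<bar>ln \<bar>x\<bar>\<bar>) \<le> 4 * \<bar>x\<bar> powr (- 2) * \<bar>x\<bar> powr (2 * a)"
      using k by (simp add: mult_right_mono)
    also have "\<dots> = 4 * \<bar>x\<bar> powr (2 * a - 2)"
      by (simp add: mult.assoc flip: powr_add)
    also have "\<dots> \<le> (\<bar>s\<bar> * \<bar>t\<bar> + 4) * powr_envelope a \<bar>x\<bar>"
      using False by (intro mult_mono) (auto simp: powr_envelope_def indicator_def)
    finally show ?thesis .
  qed
  also have "\<dots> \<le> (\<bar>s\<bar> * \<bar>t\<bar> + 4) * (powr_envelope a x + powr_envelope a (- x))"
    by (intro mult_left_mono env) auto
  finally show ?thesis
    by (simp only: sq)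
qed

lemma borel_measurable_mpowr_neg [measurable]:
  "(\<lambda>x. mpowr_neg x D $ i $ j) \<in> borel_measurable borel"
proof -
  have [measurable]: "(\<lambda>r. mexp (r *\<^sub>R D) $ i $ j) \<in> borel_measurable borel"
    by (intro borel_measurable_continuous_onI continuous_intros)
  have "(\<lambda>x. mpowr_neg x D $ i $ j) = (\<lambda>x. if x > 0 then mexp (- ln x *\<^sub>R D) $ i $ j else 0)"
    by (auto simp: mpowr_neg_def)
  also have "\<dots> \<in> borel_measurable borel"
    by measurable
  finally show ?thesis .
qed

lemma borel_measurable_cnj [measurable (raw)]:
  "f \<in> borel_measurable M \<Longrightarrow> (\<lambda>x. cnj (f x)) \<in> borel_measurable M"
  by (rule borel_measurable_continuous_on[where f=cnj]) (intro continuous_intros)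

lemma borel_measurable_spec_G [measurable]: "(\<lambda>x. spec_G D A x $ i $ j) \<in> borel_measurable borel"
  unfolding spec_G_def cmat_def matrix_matrix_mult_def by simp

lemma borel_measurable_spec_kernel [measurable]: "spec_kernel t \<in> borel_measurable borel"
  unfolding spec_kernel_def by measurable

lemma spec_G_0: "spec_G D A 0 = 0"
  by (simp add: spec_G_def mpowr_neg_def cmat_def matrix_matrix_mult_def vec_eq_iff)

lemma spec_G_pos: "0 < x \<Longrightarrow> spec_G D A x = cmat (mexp (- ln x *\<^sub>R D)) ** A"
  by (simp add: spec_G_def mpowr_neg_def cmat_def matrix_matrix_mult_def vec_eq_iff)

lemma spec_G_neg: "x < 0 \<Longrightarrow> spec_G D A x = cmat (mexp (- ln (- x) *\<^sub>R D)) ** mconj A"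
  by (simp add: spec_G_def mpowr_neg_def cmat_def matrix_matrix_mult_def vec_eq_iff)

lemma spec_G_growth:
  fixes D :: "real^'n^'n"
  assumes K: "0 \<le> K" "\<And>r i j. \<bar>mexp (r *\<^sub>R D) $ i $ j\<bar> \<le> K * exp (a * \<bar>r\<bar>)"
  shows "cmod (spec_G D A x $ i $ j) \<le> K * (\<Sum>i\<in>UNIV. \<Sum>j\<in>UNIV. cmod (A $ i $ j)) * exp (a * \<bar>ln \<bar>x\<bar>\<bar>)"
proof -
  let ?S = "\<Sum>i\<in>UNIV. \<Sum>j\<in>UNIV. cmod (A $ i $ j)"
  have bound: "cmod ((cmat (mexp (r *\<^sub>R D)) ** B) $ i $ j) \<le> K * ?S * exp (a * \<bar>r\<bar>)"
    if B: "\<And>i j. cmod (B $ i $ j) = cmod (A $ i $ j)" for r and B :: "complex^'n^'n"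
  proof -
    have "cmod ((cmat (mexp (r *\<^sub>R D)) ** B) $ i $ j) \<le> (\<Sum>l\<in>UNIV. (K * exp (a * \<bar>r\<bar>)) * cmod (A $ l $ j))"
      unfolding matrix_matrix_mult_def
      by (auto intro!: sum_norm_le mult_right_mono K(2) simp: norm_mult cmat_def B)
    also have "\<dots> \<le> (\<Sum>l\<in>UNIV. (K * exp (a * \<bar>r\<bar>)) * (\<Sum>j\<in>UNIV. cmod (A $ l $ j)))"
      by (intro sum_mono mult_left_mono member_le_sum) (auto simp: K(1))
    also have "\<dots> = K * ?S * exp (a * \<bar>r\<bar>)"
      by (simp add: sum_distrib_left mult_ac)
    finally show ?thesis .
  qed
  consider "x = 0" | "x > 0" | "x < 0"
    by linarith
  then show ?thesis
  proof cases
    case 1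
    then show ?thesis
      using K(1) by (auto simp: spec_G_0 intro!: mult_nonneg_nonneg sum_nonneg)
  next
    case 2
    then show ?thesis
      using bound[of A "- ln x"] by (simp add: spec_G_pos)
  next
    case 3
    then show ?thesis
      using bound[of "mconj A" "- ln (- x)"] by (simp add: spec_G_neg mconj_def)
  qed
qed

lemma integrable_kernel_spec_G:
  fixes D :: "real^'n^'n"
  assumes "D \<in> D_set"
  shows "integrable lborel (\<lambda>x. spec_kernel s x * cnj (spec_kernel t x) * (spec_G D A x $ i $ l * cnj (spec_G D A x $ j $ l)))"
proof -
  obtain a K where a: "0 \<le> a" "a < 1/2" and K: "0 \<le> K" "\<And>r i j. \<bar>mexp (r *\<^sub>R D) $ i $ j\<bar> \<le> K * exp (a * \<bar>r\<bar>)"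
    using mexp_growth_D_set[OF assms] by blast
  define S where "S = K * (\<Sum>i\<in>UNIV. \<Sum>j\<in>UNIV. cmod (A $ i $ j))"
  have S: "0 \<le> S"
    unfolding S_def by (intro mult_nonneg_nonneg sum_nonneg K) auto
  have G: "cmod (spec_G D A x $ i $ j) \<le> S * exp (a * \<bar>ln \<bar>x\<bar>\<bar>)" for x i j
    unfolding S_def by (rule spec_G_growth[OF K])
  define h where "h x = S\<^sup>2 * ((\<bar>s\<bar> * \<bar>t\<bar> + 4) * (powr_envelope a x + powr_envelope a (- x)))" for x
  have "integrable lborel (\<lambda>x. powr_envelope a (- x))"
    using lborel_integrable_real_affine[OF integrable_powr_envelope[OF a], of "-1" 0] by simp
  then have int: "integrable lborel h"
    unfolding h_def by (intro integrable_mult_right Bochner_Integration.integrable_add integrable_powr_envelope a)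
  show ?thesis
  proof (rule Bochner_Integration.integrable_bound[OF int])
    show "(\<lambda>x. spec_kernel s x * cnj (spec_kernel t x) * (spec_G D A x $ i $ l * cnj (spec_G D A x $ j $ l))) \<in> borel_measurable lborel"
      by measurable
    show "AE x in lborel. norm (spec_kernel s x * cnj (spec_kernel t x) * (spec_G D A x $ i $ l * cnj (spec_G D A x $ j $ l))) \<le> norm (h x)"
    proof (rule AE_I2)
      fix x :: real
      show "norm (spec_kernel s x * cnj (spec_kernel t x) * (spec_G D A x $ i $ l * cnj (spec_G D A x $ j $ l))) \<le> norm (h x)"
      proof (cases "x = 0")
        case False
        have "norm (spec_kernel s x * cnj (spec_kernel t x) * (spec_G D A x $ i $ l * cnj (spec_G D A x $ j $ l))) \<le>
            (cmod (spec_kernel s x) * cmod (spec_kernel t x)) * ((S * exp (a * \<bar>ln \<bar>x\<bar>\<bar>)) * (S * exp (a * \<bar>ln \<bar>x\<bar>\<bar>)))"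
          unfolding norm_mult complex_mod_cnj using S by (intro mult_mono order_refl G) auto
        also have "\<dots> = S\<^sup>2 * (cmod (spec_kernel s x) * cmod (spec_kernel t x) * (exp (a * \<bar>ln \<bar>x\<bar>\<bar>))\<^sup>2)"
          by (simp add: power2_eq_square mult_ac)
        also have "\<dots> \<le> h x"
          unfolding h_def by (intro mult_left_mono kernel_growth_le_envelope a False) auto
        finally show ?thesis
          by simp
      qed (simp add: spec_G_0)
    qed
  qed
qed

text \<open>The definition uses the gauge integral of a matrix-valued function. Lebesgue
  integrability of each entry identifies it, component by component, with Lebesgue integrals that
  can be split linearly.\<close>

lemma ofbm_cov_entry:
  fixes D :: "real^'n^'n"
  assumes "D \<in> D_set"
  shows "ofbm_cov D A s t $ i $ j =
    (\<Sum>l\<in>UNIV. LINT x|lborel. spec_kernel s x * cnj (spec_kernel t x) * (spec_G D A x $ i $ l * cnj (spec_G D A x $ j $ l)))"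
proof -
  define f where "f i j x = spec_kernel s x * cnj (spec_kernel t x) * (spec_G D A x ** cadj (spec_G D A x)) $ i $ j" for i j x
  have f: "f i j = (\<lambda>x. \<Sum>l\<in>UNIV. spec_kernel s x * cnj (spec_kernel t x) * (spec_G D A x $ i $ l * cnj (spec_G D A x $ j $ l)))" for i j
    unfolding f_def matrix_matrix_mult_def cadj_def transpose_def mconj_def
    by (simp add: sum_distrib_left)
  have int: "integrable lborel (f i j)" for i j
    unfolding f by (intro Bochner_Integration.integrable_sum integrable_kernel_spec_G assms)
  have "((\<lambda>x. \<chi> i j. f i j x) has_integral (\<chi> i j. LINT x|lborel. f i j x)) UNIV"
    unfolding has_integral_componentwise_iff[of "\<lambda>x. \<chi> i j. f i j x"]
  proof
    fix b :: "complex^'n^'n" assume "b \<in> Basis"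
    then obtain i j c where b: "b = axis i (axis j c)"
      unfolding Basis_vec_def by blast
    have "(f i j has_integral (LINT x|lborel. f i j x)) UNIV"
      by (rule has_integral_integral_lborel[OF int])
    then have "((\<lambda>x. f i j x \<bullet> c) has_integral ((LINT x|lborel. f i j x) \<bullet> c)) UNIV"
      using has_integral_linear[OF _ bounded_linear_inner_left] by (force simp: o_def)
    then show "((\<lambda>x. (\<chi> i j. f i j x) \<bullet> b) has_integral ((\<chi> i j. LINT x|lborel. f i j x) \<bullet> b)) UNIV"
      by (simp add: b inner_axis)
  qed
  then have "ofbm_cov D A s t = (\<chi> i j. LINT x|lborel. f i j x)"
    unfolding ofbm_cov_def f_def by (rule integral_unique)
  then show ?thesis
    unfolding f by (simp add: integrable_kernel_spec_G[OF assms])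
qed

text \<open>The quadratic form \<open>u^T (G ** cadj G) u\<close> at a real vector, written as a sum
  of squared moduli so that it is visibly real and nonnegative.\<close>

definition spec_norm :: "complex^'n^'n \<Rightarrow> real^'n \<Rightarrow> real" where
  "spec_norm G u = (\<Sum>l\<in>UNIV. (cmod (\<Sum>i\<in>UNIV. complex_of_real (u $ i) * G $ i $ l))\<^sup>2)"

lemma spec_norm_nonneg: "0 \<le> spec_norm G u"
  unfolding spec_norm_def by (intro sum_nonneg) auto

lemma spec_norm_expand:
  "(\<Sum>i\<in>UNIV. \<Sum>j\<in>UNIV. complex_of_real (u $ i * u $ j) * (\<Sum>l\<in>UNIV. G $ i $ l * cnj (G $ j $ l))) =
    complex_of_real (spec_norm G u)"
proof -
  define z where "z l = (\<Sum>i\<in>UNIV. complex_of_real (u $ i) * G $ i $ l)" for l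
  have "(\<Sum>i\<in>UNIV. \<Sum>j\<in>UNIV. complex_of_real (u $ i * u $ j) * (\<Sum>l\<in>UNIV. G $ i $ l * cnj (G $ j $ l))) =
      (\<Sum>i\<in>UNIV. \<Sum>j\<in>UNIV. \<Sum>l\<in>UNIV. (complex_of_real (u $ i) * G $ i $ l) * cnj (complex_of_real (u $ j) * G $ j $ l))"
    by (simp add: sum_distrib_left mult_ac)
  also have "\<dots> = (\<Sum>i\<in>UNIV. \<Sum>l\<in>UNIV. \<Sum>j\<in>UNIV. (complex_of_real (u $ i) * G $ i $ l) * cnj (complex_of_real (u $ j) * G $ j $ l))"
    by (intro sum.cong refl sum.swap)
  also have "\<dots> = (\<Sum>i\<in>UNIV. \<Sum>l\<in>UNIV. (complex_of_real (u $ i) * G $ i $ l) * cnj (z l))"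
    by (simp only: z_def cnj_sum sum_distrib_left)
  also have "\<dots> = (\<Sum>l\<in>UNIV. \<Sum>i\<in>UNIV. (complex_of_real (u $ i) * G $ i $ l) * cnj (z l))"
    by (rule sum.swap)
  also have "\<dots> = (\<Sum>l\<in>UNIV. z l * cnj (z l))"
    by (simp only: z_def sum_distrib_right)
  also have "\<dots> = complex_of_real (spec_norm G u)"
    by (simp only: spec_norm_def z_def of_real_sum complex_norm_square)
  finally show ?thesis .
qed

text \<open>A real vector sees only the real part of \<open>G ** cadj G\<close>; this is why the
  hypothesis on \<open>A\<close> concerns the real part alone.\<close>

lemma spec_norm_eq_inner: "spec_norm G u = u \<bullet> (mRe (G ** cadj G) *v u)"
proof -
  have "spec_norm G u = Re (\<Sum>i\<in>UNIV. \<Sum>j\<in>UNIV. complex_of_real (u $ i * u $ j) * (\<Sum>l\<in>UNIV. G $ i $ l * cnj (G $ j $ l)))"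
    by (simp only: spec_norm_expand Re_complex_of_real)
  also have "\<dots> = (\<Sum>i\<in>UNIV. \<Sum>j\<in>UNIV. u $ i * u $ j * Re ((G ** cadj G) $ i $ j))"
    by (simp add: matrix_matrix_mult_def cadj_def transpose_def mconj_def)
  also have "\<dots> = u \<bullet> (mRe (G ** cadj G) *v u)"
    unfolding inner_vec_def matrix_vector_mult_def mRe_def by (simp add: sum_distrib_left mult_ac)
  finally show ?thesis .
qed

lemma spec_norm_mult: "spec_norm (cmat E ** G) u = spec_norm G (transpose E *v u)"
proof -
  have "(\<Sum>i\<in>UNIV. complex_of_real (u $ i) * (cmat E ** G) $ i $ l) =
      (\<Sum>m\<in>UNIV. complex_of_real ((transpose E *v u) $ m) * G $ m $ l)" for l
  proof -
    have "(\<Sum>i\<in>UNIV. complex_of_real (u $ i) * (cmat E ** G) $ i $ l) =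
        (\<Sum>i\<in>UNIV. \<Sum>m\<in>UNIV. complex_of_real (u $ i) * complex_of_real (E $ i $ m) * G $ m $ l)"
      by (simp add: matrix_matrix_mult_def cmat_def sum_distrib_left mult_ac)
    also have "\<dots> = (\<Sum>m\<in>UNIV. \<Sum>i\<in>UNIV. complex_of_real (u $ i) * complex_of_real (E $ i $ m) * G $ m $ l)"
      by (rule sum.swap)
    also have "\<dots> = (\<Sum>m\<in>UNIV. complex_of_real ((transpose E *v u) $ m) * G $ m $ l)"
      unfolding matrix_vector_mult_def transpose_def by (simp add: sum_distrib_left mult_ac)
    finally show ?thesis .
  qed
  then show ?thesis
    by (simp only: spec_norm_def)
qed

lemma spec_norm_spec_G_pos:
  assumes "0 < x"
  shows "spec_norm (spec_G D A x) u =
    (transpose (mexp (- ln x *\<^sub>R D)) *v u) \<bullet> (mRe (A ** cadj A) *v (transpose (mexp (- ln x *\<^sub>R D)) *v u))"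
  unfolding spec_G_pos[OF assms] spec_norm_mult by (rule spec_norm_eq_inner)

lemma borel_measurable_spec_norm [measurable]: "(\<lambda>x. spec_norm (spec_G D A x) u) \<in> borel_measurable borel"
  unfolding spec_norm_def by measurable

section \<open>Recovering the spectral density from the covariance\<close>

context
  fixes D :: "real^'n^'n"
  assumes D: "D \<in> D_set"
begin

lemma integrable_kernel_spec_norm:
  "integrable lborel (\<lambda>x. spec_kernel s x * cnj (spec_kernel t x) * complex_of_real (spec_norm (spec_G D A x) u))"
proof -
  have eq: "(\<lambda>x. spec_kernel s x * cnj (spec_kernel t x) * complex_of_real (spec_norm (spec_G D A x) u)) =
      (\<lambda>x. \<Sum>i\<in>UNIV. \<Sum>j\<in>UNIV. \<Sum>l\<in>UNIV. complex_of_real (u $ i * u $ j) *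
        (spec_kernel s x * cnj (spec_kernel t x) * (spec_G D A x $ i $ l * cnj (spec_G D A x $ j $ l))))"
    unfolding spec_norm_expand[symmetric] by (simp add: sum_distrib_left mult_ac)
  show ?thesis
    unfolding eq by (intro Bochner_Integration.integrable_sum integrable_mult_right integrable_kernel_spec_G D)
qed

lemma ofbm_cov_quadratic_form:
  "(\<Sum>i\<in>UNIV. \<Sum>j\<in>UNIV. complex_of_real (u $ i * u $ j) * ofbm_cov D A s t $ i $ j) =
    (LINT x|lborel. spec_kernel s x * cnj (spec_kernel t x) * complex_of_real (spec_norm (spec_G D A x) u))"
proof -
  have "(LINT x|lborel. spec_kernel s x * cnj (spec_kernel t x) * complex_of_real (spec_norm (spec_G D A x) u)) =
      (LINT x|lborel. (\<Sum>i\<in>UNIV. \<Sum>j\<in>UNIV. \<Sum>l\<in>UNIV. complex_of_real (u $ i * u $ j) *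
        (spec_kernel s x * cnj (spec_kernel t x) * (spec_G D A x $ i $ l * cnj (spec_G D A x $ j $ l)))))"
    unfolding spec_norm_expand[symmetric] by (simp add: sum_distrib_left mult_ac)
  also have "\<dots> = (\<Sum>i\<in>UNIV. \<Sum>j\<in>UNIV. \<Sum>l\<in>UNIV. complex_of_real (u $ i * u $ j) *
        (LINT x|lborel. spec_kernel s x * cnj (spec_kernel t x) * (spec_G D A x $ i $ l * cnj (spec_G D A x $ j $ l))))"
    by (simp add: integrable_kernel_spec_G[OF D] del: of_real_mult)
  also have "\<dots> = (\<Sum>i\<in>UNIV. \<Sum>j\<in>UNIV. complex_of_real (u $ i * u $ j) * ofbm_cov D A s t $ i $ j)"
    by (simp only: ofbm_cov_entry[OF D] sum_distrib_left)
  finally show ?thesis ..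
qed

text \<open>Multiplied by the conjugate of \<open>spec_kernel 1 x\<close>, this leaves a character
  times a fixed nonnegative weight. At \<open>x = 0\<close> both sides vanish by the convention for
  division by zero.\<close>

lemma spec_kernel_increment: "spec_kernel (t + 1) x - spec_kernel t x = iexp (t * x) * spec_kernel 1 x"
  by (simp add: spec_kernel_def diff_divide_distrib[symmetric] distrib_right distrib_left exp_add right_diff_distrib)

text \<open>The increments of the covariance in the first argument are the Fourier transform of a finite
  measure, which is therefore determined by the covariance.\<close>
lemma spectral_density_unique:
  assumes eq: "\<And>s t. (LINT x|lborel. spec_kernel s x * cnj (spec_kernel t x) * complex_of_real (spec_norm (spec_G D A x) u)) =
      (LINT x|lborel. spec_kernel s x * cnj (spec_kernel t x) * complex_of_real (spec_norm (spec_G D A x) v))"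
  shows "AE x in lborel. (cmod (spec_kernel 1 x))\<^sup>2 * spec_norm (spec_G D A x) u = (cmod (spec_kernel 1 x))\<^sup>2 * spec_norm (spec_G D A x) v"
proof -
  define p where "p u x = (cmod (spec_kernel 1 x))\<^sup>2 * spec_norm (spec_G D A x) u" for u x
  have p [measurable]: "p u \<in> borel_measurable borel" and p0: "0 \<le> p u x" for u x
    unfolding p_def by (simp_all add: spec_norm_nonneg)
  have of_p: "complex_of_real (p u x) = spec_kernel 1 x * cnj (spec_kernel 1 x) * complex_of_real (spec_norm (spec_G D A x) u)" for u x
    unfolding p_def by (simp only: of_real_mult complex_norm_square)
  have "integrable lborel (\<lambda>x. complex_of_real (p u x))" for u
    unfolding of_p by (rule integrable_kernel_spec_norm)
  then have int: "integrable lborel (p u)" for u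
    using integrable_Re[of lborel "\<lambda>x. complex_of_real (p u x)"] by simp
  define \<mu> where "\<mu> u = density lborel (\<lambda>x. ennreal (p u x))" for u
  have fin: "finite_measure (\<mu> u)" for u
  proof (rule finite_measureI)
    have "emeasure (\<mu> u) (space (\<mu> u)) = (\<integral>\<^sup>+x. ennreal (p u x) \<partial>lborel)"
      unfolding \<mu>_def by (simp add: emeasure_density)
    also have "\<dots> < \<infinity>"
      using int[of u] p0 by (simp add: integrable_iff_bounded)
    finally show "emeasure (\<mu> u) (space (\<mu> u)) \<noteq> \<infinity>"
      by simp
  qed
  have char: "(CLINT x|\<mu> w. iexp (t * x)) =
      (LINT x|lborel. spec_kernel (t + 1) x * cnj (spec_kernel 1 x) * complex_of_real (spec_norm (spec_G D A x) w)) -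
      (LINT x|lborel. spec_kernel t x * cnj (spec_kernel 1 x) * complex_of_real (spec_norm (spec_G D A x) w))" for t w
  proof -
    have "(CLINT x|\<mu> w. iexp (t * x)) = (CLINT x|lborel. p w x *\<^sub>R iexp (t * x))"
      unfolding \<mu>_def by (subst integral_density) (auto simp: p0)
    also have "\<dots> = (LINT x|lborel. spec_kernel (t + 1) x * cnj (spec_kernel 1 x) * complex_of_real (spec_norm (spec_G D A x) w) -
        spec_kernel t x * cnj (spec_kernel 1 x) * complex_of_real (spec_norm (spec_G D A x) w))"
      unfolding scaleR_conv_of_real of_p left_diff_distrib[symmetric] spec_kernel_increment
      by (intro Bochner_Integration.integral_cong refl) (simp only: mult_ac)
    finally show ?thesis
      by (simp only: Bochner_Integration.integral_diff integrable_kernel_spec_norm)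
  qed
  have "sets (\<mu> w) = sets borel" for w
    by (simp add: \<mu>_def)
  then have "\<mu> u = \<mu> v"
    by (intro finite_measure_eqI_char[OF fin fin]) (simp_all only: char eq)
  then have "AE x in lborel. ennreal (p u x) = ennreal (p v x)"
    unfolding \<mu>_def by (intro sigma_finite_measure.density_unique[OF sigma_finite_lborel]) auto
  then show ?thesis
    unfolding p_def[symmetric] using p0 by simp
qed

text \<open>Positivity of the sine on (0,2) is the source of the bound 2 here and of
  \<open>ln 2\<close> later.\<close>

lemma spec_kernel_1_nonzero:
  assumes "0 < x" "x < 2"
  shows "spec_kernel 1 x \<noteq> 0"
proof -
  have "Im (iexp x) \<noteq> 0"
    using sin_gt_zero_02[OF assms] by (simp add: Im_exp)
  then have "iexp x \<noteq> 1"
    by auto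
  then show ?thesis
    using assms by (simp add: spec_kernel_def)
qed

text \<open>The nonzero kernel factor cancels, and continuity in \<open>- ln x\<close> upgrades
  equality almost everywhere to every point of the interval.\<close>

lemma spec_norm_eq_near_1:
  assumes eq: "\<And>s t. (LINT x|lborel. spec_kernel s x * cnj (spec_kernel t x) * complex_of_real (spec_norm (spec_G D A x) u)) =
      (LINT x|lborel. spec_kernel s x * cnj (spec_kernel t x) * complex_of_real (spec_norm (spec_G D A x) v))"
    and x: "0 < x" "x < 2"
  shows "spec_norm (spec_G D A x) u = spec_norm (spec_G D A x) v"
proof -
  define f where "f u r = (transpose (mexp (r *\<^sub>R D)) *v u) \<bullet> (mRe (A ** cadj A) *v (transpose (mexp (r *\<^sub>R D)) *v u))" for u r
  have "continuous_on UNIV (\<lambda>r. mexp (r *\<^sub>R D) $ i $ j)" for i j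
    by (intro continuous_intros)
  then have cont: "continuous_on UNIV (f u)" for u
    unfolding f_def transpose_def by (intro continuous_intros)
  define C where "C = {r. f u r = f v r}"
  have "closed C"
    unfolding C_def by (intro closed_Collect_eq cont)
  define g where "g x = f u (- ln x) - f v (- ln x)" for x
  have cg: "continuous_on {0<..<2} g"
    unfolding g_def by (intro continuous_intros continuous_on_compose2[OF cont]) auto
  have "AE y in lborel. y \<in> {0<..<2} \<longrightarrow> g y = 0"
    using spectral_density_unique[OF eq]
  proof (rule AE_mp, intro AE_I2 impI)
    fix y assume "(cmod (spec_kernel 1 y))\<^sup>2 * spec_norm (spec_G D A y) u = (cmod (spec_kernel 1 y))\<^sup>2 * spec_norm (spec_G D A y) v"
      "y \<in> {0<..<2}"
    then show "g y = 0"
      using spec_kernel_1_nonzero[of y] by (simp add: g_def f_def spec_norm_spec_G_pos)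
  qed
  then have ae: "AE y in lebesgue. y \<in> {0<..<2} \<longrightarrow> g y = 0"
    by (rule AE_completion)
  have "g x = 0"
  proof (rule ccontr)
    assume "g x \<noteq> 0"
    define U where "U = {0<..<2} \<inter> g -` (- {0})"
    have "open U"
      unfolding U_def by (intro continuous_open_preimage cg) auto
    moreover have "x \<in> U" "\<And>y. y \<in> U \<Longrightarrow> y \<in> {0<..<2} \<and> g y \<noteq> 0"
      using x \<open>g x \<noteq> 0\<close> by (auto simp: U_def)
    ultimately have U: "open U" "x \<in> U" "\<And>y. y \<in> U \<Longrightarrow> y \<in> {0<..<2} \<and> g y \<noteq> 0"
      by blast+
    \<comment> \<open>Almost every point of the open set \<open>U\<close> would lie in the empty
      set; as that set is closed, every point of \<open>U\<close> would.\<close>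
    have "x \<in> {}"
    proof (rule mem_closed_if_AE_lebesgue_open[OF U(1)])
      show "AE y\<in>U in lebesgue. y \<in> {}"
        using ae U(3) by (auto elim: AE_mp)
    qed (use U(2) in auto)
    then show False by simp
  qed
  then show ?thesis
    using x by (simp add: g_def f_def spec_norm_spec_G_pos)
qed

end

theorem sym_group_spectral:
  fixes D :: "real^'n^'n" and X :: "real \<Rightarrow> 'a \<Rightarrow> real^'n"
  assumes D: "D \<in> D_set" and X: "is_OFBM P X D A" and C: "C \<in> sym_group P X" and r: "\<bar>r\<bar> < ln 2"
  shows "(transpose (mexp (r *\<^sub>R D)) *v (transpose C *v u)) \<bullet> (mRe (A ** cadj A) *v (transpose (mexp (r *\<^sub>R D)) *v (transpose C *v u))) =
     (transpose (mexp (r *\<^sub>R D)) *v u) \<bullet> (mRe (A ** cadj A) *v (transpose (mexp (r *\<^sub>R D)) *v u))"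
proof -
  interpret prob_space P
    using X by (simp add: is_OFBM_def)
  have g: "gaussian_process P X"
    using X by (simp add: is_OFBM_def)
  have cov: "ofbm_cov D A s t $ i $ j = complex_of_real (expectation (\<lambda>\<omega>. X s \<omega> $ i * X t \<omega> $ j))" for s t i j
    using X unfolding is_OFBM_def by (metis (no_types, lifting) vec_lambda_beta)
  have moment: "complex_of_real (expectation (\<lambda>\<omega>. (w \<bullet> X s \<omega>) * (w \<bullet> X t \<omega>))) =
      (LINT x|lborel. spec_kernel s x * cnj (spec_kernel t x) * complex_of_real (spec_norm (spec_G D A x) w))" for w s t
  proof -
    have int: "integrable P (\<lambda>\<omega>. X s \<omega> $ i * X t \<omega> $ j)" for i j
      using gaussian_process_integrable_mult[OF g, of "axis i 1" s "axis j 1" t] by (simp add: inner_axis')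
    have "(\<lambda>\<omega>. (w \<bullet> X s \<omega>) * (w \<bullet> X t \<omega>)) = (\<lambda>\<omega>. \<Sum>i\<in>UNIV. \<Sum>j\<in>UNIV. (w $ i * w $ j) * (X s \<omega> $ i * X t \<omega> $ j))"
      unfolding inner_vec_def by (simp add: sum_product mult_ac)
    then have "expectation (\<lambda>\<omega>. (w \<bullet> X s \<omega>) * (w \<bullet> X t \<omega>)) =
        (\<Sum>i\<in>UNIV. \<Sum>j\<in>UNIV. (w $ i * w $ j) * expectation (\<lambda>\<omega>. X s \<omega> $ i * X t \<omega> $ j))"
      using int by simp
    then show ?thesis
      unfolding ofbm_cov_quadratic_form[OF D, symmetric] cov by simp
  qed
  have "spec_norm (spec_G D A x) (transpose C *v u) = spec_norm (spec_G D A x) u" if "0 < x" "x < 2" for x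
  proof (rule spec_norm_eq_near_1[OF D _ that])
    show "(LINT x|lborel. spec_kernel s x * cnj (spec_kernel t x) * complex_of_real (spec_norm (spec_G D A x) (transpose C *v u))) =
      (LINT x|lborel. spec_kernel s x * cnj (spec_kernel t x) * complex_of_real (spec_norm (spec_G D A x) u))" for s t
      unfolding moment[symmetric] sym_group_second_moments[OF g C] ..
  qed
  \<comment> \<open>The evaluation point is \<open>x = exp (- r)\<close>, which must stay below
    2.\<close>
  moreover have "exp (- r) < exp (ln 2)"
    using r by (subst exp_less_cancel_iff) linarith
  ultimately have "spec_norm (spec_G D A (exp (- r))) (transpose C *v u) = spec_norm (spec_G D A (exp (- r))) u"
    by simp
  then show ?thesis
    unfolding spec_norm_spec_G_pos[where x="exp (- r)", OF exp_gt_zero, unfolded ln_exp minus_minus] .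
qed

section \<open>Symmetries\<close>

definition mat_deriv :: "(real \<Rightarrow> real^'n^'m) \<Rightarrow> real^'n^'m \<Rightarrow> real \<Rightarrow> bool" where
  "mat_deriv F F' r \<longleftrightarrow> (\<forall>i j. ((\<lambda>r. F r $ i $ j) has_real_derivative F' $ i $ j) (at r))"

lemma mat_deriv_const: "mat_deriv (\<lambda>_. A) 0 r"
  by (simp add: mat_deriv_def)

lemma mat_deriv_transpose: "mat_deriv F F' r \<Longrightarrow> mat_deriv (\<lambda>r. transpose (F r)) (transpose F') r"
  by (simp add: mat_deriv_def transpose_def)

lemma mat_deriv_add: "mat_deriv F F' r \<Longrightarrow> mat_deriv G G' r \<Longrightarrow> mat_deriv (\<lambda>r. F r + G r) (F' + G') r"
  by (auto simp: mat_deriv_def intro: DERIV_add)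

lemma mat_deriv_mult:
  assumes "mat_deriv F F' r" "mat_deriv G G' r"
  shows "mat_deriv (\<lambda>r. F r ** G r) (F' ** G r + F r ** G') r"
  unfolding mat_deriv_def
proof (intro allI)
  fix i j
  have "((\<lambda>r. \<Sum>k\<in>UNIV. F r $ i $ k * G r $ k $ j) has_real_derivative
      (\<Sum>k\<in>UNIV. F r $ i $ k * G' $ k $ j + F' $ i $ k * G r $ k $ j)) (at r)"
    using assms unfolding mat_deriv_def by (intro DERIV_sum DERIV_mult') auto
  then show "((\<lambda>r. (F r ** G r) $ i $ j) has_real_derivative (F' ** G r + F r ** G') $ i $ j) (at r)"
    by (simp add: matrix_matrix_mult_def sum.distrib add.commute)
qed

lemma mat_deriv_unique:
  assumes F: "mat_deriv F F' r" and G: "mat_deriv G G' r" and U: "open U" "r \<in> U" "\<And>x. x \<in> U \<Longrightarrow> F x = G x"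
  shows "F' = G'"
proof -
  have "F' $ i $ j = G' $ i $ j" for i j
  proof (rule DERIV_unique)
    show "((\<lambda>r. F r $ i $ j) has_real_derivative F' $ i $ j) (at r)"
      using F by (simp add: mat_deriv_def)
    have "((\<lambda>r. G r $ i $ j) has_real_derivative G' $ i $ j) (at r)"
      using G by (simp add: mat_deriv_def)
    then show "((\<lambda>r. F r $ i $ j) has_real_derivative G' $ i $ j) (at r)"
      by (rule has_field_derivative_transform_within_open[OF _ U(1,2)]) (simp add: U(3))
  qed
  then show ?thesis
    by (simp add: vec_eq_iff)
qed

text \<open>Polarization at \<open>u + v\<close>; symmetry merges the two mixed terms.\<close>

lemma symmetric_eqI:
  fixes X Y :: "real^'n^'n"
  assumes sym: "symmetric_mat X" "symmetric_mat Y" and eq: "\<And>u. u \<bullet> (X *v u) = u \<bullet> (Y *v u)"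
  shows "X = Y"
proof -
  have "u \<bullet> (X *v v) = u \<bullet> (Y *v v)" for u v
    using eq[of "u + v"] eq[of u] eq[of v] symmetric_inner_swap[OF sym(1), of v u]
      symmetric_inner_swap[OF sym(2), of v u]
    by (simp add: matrix_vector_right_distrib inner_add_left inner_add_right inner_commute)
  then have "X *v v = Y *v v" for v
    by (metis vector_eq_ldot)
  then show ?thesis
    by (simp add: matrix_eq)
qed

text \<open>For \<open>Q = mRe (A ** cadj A)\<close> this is the real part of the matrix spectral
  density \<open>spec_G D A x ** cadj (spec_G D A x)\<close> at
  \<open>x = exp (- r)\<close>.\<close>

definition spec_mat :: "real^'n^'n \<Rightarrow> real^'n^'n \<Rightarrow> real \<Rightarrow> real^'n^'n" where
  "spec_mat D Q r = mexp (r *\<^sub>R D) ** Q ** transpose (mexp (r *\<^sub>R D))"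

lemma spec_mat_0: "spec_mat D Q 0 = Q"
  using mexp_0[of D] by (simp add: spec_mat_def transpose_mat)

text \<open>A Lyapunov equation: the derivative is linear in \<open>spec_mat D Q r\<close> itself,
  so the next derivative follows from the product rule without returning to the exponential.\<close>

lemma spec_mat_deriv: "mat_deriv (spec_mat D Q) (D ** spec_mat D Q r + spec_mat D Q r ** transpose D) r"
proof -
  have E: "mat_deriv (\<lambda>r. mexp (r *\<^sub>R D)) (D ** mexp (r *\<^sub>R D)) r"
    by (simp add: mat_deriv_def mexp_has_derivative)
  have "mat_deriv (\<lambda>r. mexp (r *\<^sub>R D) ** Q ** transpose (mexp (r *\<^sub>R D)))
      ((D ** mexp (r *\<^sub>R D) ** Q + mexp (r *\<^sub>R D) ** 0) ** transpose (mexp (r *\<^sub>R D)) +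
       mexp (r *\<^sub>R D) ** Q ** transpose (D ** mexp (r *\<^sub>R D))) r"
    by (intro mat_deriv_mult mat_deriv_transpose mat_deriv_const E)
  then show ?thesis
    by (simp add: spec_mat_def[abs_def] matrix_transpose_mul matrix_mul_assoc)
qed

lemma symmetric_spec_mat:
  assumes "symmetric_mat Q"
  shows "symmetric_mat (B ** Q ** transpose B)"
  using assms by (simp add: symmetric_mat_def matrix_transpose_mul matrix_mul_assoc)

lemma inner_congruence:
  fixes B Q :: "real^'n^'n"
  shows "u \<bullet> ((B ** Q ** transpose B) *v u) = (transpose B *v u) \<bullet> (Q *v (transpose B *v u))"
  unfolding matrix_vector_mul_assoc[symmetric] by (rule inner_matrix_vector)

text \<open>Congruence by a constant \<open>C\<close> is linear and hence commutes with
  differentiation; invariance on an open set therefore passes to the derivative.\<close>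

lemma congruence_deriv:
  fixes C :: "real^'n^'n"
  assumes F: "\<And>r. r \<in> U \<Longrightarrow> mat_deriv F (F' r) r" and U: "open U"
    and C: "\<And>r. r \<in> U \<Longrightarrow> C ** F r ** transpose C = F r" and r: "r \<in> U"
  shows "C ** F' r ** transpose C = F' r"
proof (rule mat_deriv_unique[OF _ F[OF r] U r C])
  have "mat_deriv (\<lambda>r. C ** F r ** transpose C) ((0 ** F r + C ** F' r) ** transpose C + C ** F r ** 0) r"
    by (intro mat_deriv_mult mat_deriv_const F r)
  then show "mat_deriv (\<lambda>r. C ** F r ** transpose C) (C ** F' r ** transpose C) r"
    by simp
qed

text \<open>Differentiating the invariance of the spectral density twice at \<open>x = 1\<close>.\<close>
lemma congruence_spec_mat:
  fixes C D Q :: "real^'n^'n"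
  assumes "0 < \<delta>" and C: "\<And>r. \<bar>r\<bar> < \<delta> \<Longrightarrow> C ** spec_mat D Q r ** transpose C = spec_mat D Q r"
  defines "X \<equiv> D ** Q + Q ** transpose D"
  shows "C ** Q ** transpose C = Q" and "C ** X ** transpose C = X"
    and "C ** (D ** X + X ** transpose D) ** transpose C = D ** X + X ** transpose D"
proof -
  let ?U = "{- \<delta><..<\<delta>}"
  let ?P = "spec_mat D Q"
  let ?P' = "\<lambda>r. D ** ?P r + ?P r ** transpose D"
  have U: "0 \<in> ?U" "open ?U"
    using assms(1) by auto
  have C0: "C ** ?P r ** transpose C = ?P r" if "r \<in> ?U" for r
    using that by (intro C) auto
  have C1: "C ** ?P' r ** transpose C = ?P' r" if "r \<in> ?U" for r
    by (rule congruence_deriv[OF spec_mat_deriv U(2) C0 that])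
  have P': "mat_deriv ?P' (D ** ?P' r + ?P' r ** transpose D) r" for r
  proof -
    have "mat_deriv ?P' ((0 ** ?P r + D ** ?P' r) + (?P' r ** transpose D + ?P r ** 0)) r"
      by (intro mat_deriv_add mat_deriv_mult mat_deriv_const spec_mat_deriv)
    then show ?thesis by simp
  qed
  have C2: "C ** (D ** ?P' 0 + ?P' 0 ** transpose D) ** transpose C = D ** ?P' 0 + ?P' 0 ** transpose D"
    by (rule congruence_deriv[OF P' U(2) C1 U(1)])
  show "C ** Q ** transpose C = Q" "C ** X ** transpose C = X"
    "C ** (D ** X + X ** transpose D) ** transpose C = D ** X + X ** transpose D"
    using C0[OF U(1)] C1[OF U(1)] C2 by (simp_all add: spec_mat_0 X_def)
qed

section \<open>From invariance under congruence to plus or minus the identity\<close>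

lemma matrix_add_rdistrib: "(A + B) ** C = A ** C + B ** (C :: real^'n^'m)"
  by (simp add: matrix_matrix_mult_def vec_eq_iff distrib_right sum.distrib)

lemma pos_def_inverse:
  assumes "pos_def W"
  shows "W ** matrix_inv W = mat 1" and "matrix_inv W ** W = mat 1" and "transpose (matrix_inv W) = matrix_inv W"
proof -
  have sym: "transpose W = W"
    using assms by (simp add: pos_def_def symmetric_mat_def)
  have "x = 0" if "W *v x = 0" for x
    using assms that unfolding pos_def_def by (metis inner_zero_right less_irrefl)
  then have "invertible W"
    unfolding invertible_left_inverse matrix_left_invertible_ker by blast
  then have "W ** matrix_inv W = mat 1 \<and> matrix_inv W ** W = mat 1"
    unfolding invertible_def matrix_inv_def by (rule someI_ex)
  then show inv: "W ** matrix_inv W = mat 1" "matrix_inv W ** W = mat 1"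
    by auto
  have "transpose (matrix_inv W) = transpose (matrix_inv W) ** (W ** matrix_inv W)"
    by (simp add: inv)
  also have "\<dots> = transpose (W ** matrix_inv W) ** matrix_inv W"
    by (simp add: matrix_transpose_mul sym matrix_mul_assoc)
  also have "\<dots> = matrix_inv W"
    by (simp add: inv transpose_mat)
  finally show "transpose (matrix_inv W) = matrix_inv W" .
qed

lemma D_set_conjugate:
  fixes D :: "real^'n^'n"
  assumes "W ** V = mat 1" "V ** D ** W \<in> D_set"
  shows "D \<in> D_set"
proof -
  have "z \<in> char_roots (V ** D ** W)" if "z \<in> char_roots D" for z
  proof -
    obtain v where v: "v \<noteq> 0" "cmat D *v v = z *s v"
      using \<open>z \<in> char_roots D\<close> char_roots_iff by blast
    have WV: "cmat W *v (cmat V *v v) = v"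
      by (simp add: matrix_vector_mul_assoc cmat_mult[symmetric] assms(1) cmat_mat_1)
    then have "cmat V *v v \<noteq> 0"
      using v(1) by auto
    moreover have "cmat (V ** D ** W) *v (cmat V *v v) = cmat V *v (cmat D *v (cmat W *v (cmat V *v v)))"
      by (simp only: cmat_mult matrix_vector_mul_assoc matrix_mul_assoc)
    then have "cmat (V ** D ** W) *v (cmat V *v v) = z *s (cmat V *v v)"
      by (simp only: WV v(2) vector_scalar_commute)
    ultimately show ?thesis
      using char_roots_iff by blast
  qed
  then show ?thesis
    using assms(2) by (auto simp: D_set_def)
qed

lemma orthogonal_commuting_eq_pm_1:
  fixes M U :: "real^'n^'n"
  assumes M: "M \<in> M_set" and orth: "transpose U ** U = mat 1"
    and S: "U ** sym_part M = sym_part M ** U"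
    and K: "U ** (skew_part M ** sym_part M - sym_part M ** skew_part M) =
      (skew_part M ** sym_part M - sym_part M ** skew_part M) ** U"
  shows "U = mat 1 \<or> U = - mat 1"
proof -
  let ?S = "sym_part M" and ?L = "skew_part M"
  obtain b where b: "eigenbasis ?S b"
    using eigenbasis_exists symmetric_sym_part by blast
  have nd: "\<not> degenerate M b"
    using M b M_set_iff_degenerate by blast
  have ob: "orthonormal_basis b"
    using b by (simp add: eigenbasis_def)
  define s where "s i = b i \<bullet> (?S *v b i)" for i
  have Sb: "?S *v b i = s i *\<^sub>R b i" for i
    unfolding s_def by (rule eigenbasis_eigenvalue[OF b])
  have s: "s i \<noteq> s j" if "i \<noteq> j" for i j
    using nd that unfolding degenerate_def s_def by blast
  have Sj: "b j \<bullet> (?S *v v) = s j * (b j \<bullet> v)" for j v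
    by (simp add: symmetric_inner_swap[OF symmetric_sym_part] Sb)
  define c where "c i = b i \<bullet> (U *v b i)" for i
  have U: "U *v b i = c i *\<^sub>R b i" for i
  proof -
    \<comment> \<open>Evaluating \<open>U ** ?S\<close> on either side of the commutation multiplies
      the entry by \<open>s j\<close> and by \<open>s i\<close>, which differ.\<close>
    have "b j \<bullet> (U *v b i) = 0" if "j \<noteq> i" for j
    proof -
      have "s j * (b j \<bullet> (U *v b i)) = b j \<bullet> ((U ** ?S) *v b i)"
        unfolding S by (simp only: Sj matrix_vector_mul_assoc[symmetric])
      also have "\<dots> = s i * (b j \<bullet> (U *v b i))"
        by (simp only: matrix_vector_mul_assoc[symmetric] Sb matrix_vector_mult_scaleR inner_scaleR_right)
      finally show ?thesis
        using s[OF that] by simp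
    qed
    then have "(\<Sum>j\<in>UNIV. (b j \<bullet> (U *v b i)) *\<^sub>R b j) = (\<Sum>j\<in>UNIV. if j = i then c i *\<^sub>R b i else 0)"
      by (intro sum.cong) (auto simp: c_def)
    then show ?thesis
      using orthonormal_expansion[OF ob, of "U *v b i"] by simp
  qed
  have c: "c i = 1 \<or> c i = - 1" for i
  proof -
    have "(U *v b i) \<bullet> (U *v b i) = (transpose U *v (U *v b i)) \<bullet> b i"
      by (rule inner_matrix_vector)
    also have "\<dots> = b i \<bullet> b i"
      by (simp only: matrix_vector_mul_assoc orth matrix_vector_mul_lid)
    finally have "c i * (c i * (b i \<bullet> b i)) = b i \<bullet> b i"
      unfolding U by (simp only: inner_scaleR_left inner_scaleR_right)
    moreover have "b i \<bullet> b i = 1"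
      using ob by (simp add: orthonormal_basis_def)
    ultimately have "c i * c i = 1"
      by (simp only: mult_1_right)
    then show ?thesis
      by (simp add: square_eq_1_iff)
  qed
  have Uj: "b j \<bullet> (U *v v) = c j * (b j \<bullet> v)" for j v
  proof -
    have "b j \<bullet> (U *v v) = (\<Sum>k\<in>UNIV. (b k \<bullet> v) * (c k * (b j \<bullet> b k)))"
      by (subst orthonormal_expansion[OF ob, of v])
         (simp add: matrix_vector_mult_scaleR U inner_sum_right linear_sum[OF matrix_vector_mul_linear] mult.assoc)
    also have "\<dots> = (\<Sum>k\<in>UNIV. if k = j then c j * (b j \<bullet> v) else 0)"
      using ob by (intro sum.cong) (simp_all add: orthonormal_basis_def)
    finally show ?thesis
      by simp
  qed
  have L: "b j \<bullet> (?L *v b i) = 0" if "c i \<noteq> c j" for i j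
  proof -
    let ?K = "?L ** ?S - ?S ** ?L"
    \<comment> \<open>Commutation of \<open>U\<close> with \<open>?K\<close> makes
      \<open>(c i - c j) * (s i - s j)\<close> times the entry of \<open>?L\<close> vanish; with
      \<open>s i \<noteq> s j\<close> the statement descends from the commutator to
      \<open>?L\<close>.\<close>
    have Kv: "b j \<bullet> (?K *v b i) = (s i - s j) * (b j \<bullet> (?L *v b i))"
      by (simp only: matrix_vector_mult_diff_rdistrib matrix_vector_mul_assoc[symmetric] inner_diff_right
          Sj Sb matrix_vector_mult_scaleR inner_scaleR_right left_diff_distrib)
    have "c j * (b j \<bullet> (?K *v b i)) = b j \<bullet> ((U ** ?K) *v b i)"
      by (simp only: matrix_vector_mul_assoc[symmetric] Uj)
    also have "\<dots> = c i * (b j \<bullet> (?K *v b i))"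
      unfolding K by (simp only: matrix_vector_mul_assoc[symmetric] U matrix_vector_mult_scaleR inner_scaleR_right)
    finally have "(s i - s j) * (b j \<bullet> (?L *v b i)) = 0"
      using that unfolding Kv by simp
    then show ?thesis
      using s[of i j] that by auto
  qed
  have eqI: "U = a *\<^sub>R mat 1" if "\<And>i. c i = a" for a
  proof -
    have "U *v v = a *\<^sub>R v" for v
    proof -
      have "b j \<bullet> (U *v v - a *\<^sub>R v) = 0" for j
        by (simp add: inner_diff_right Uj that)
      then show ?thesis
        using orthonormal_eq_zero[OF ob] by (metis eq_iff_diff_eq_0)
    qed
    then show ?thesis
      by (simp add: matrix_eq scaleR_matrix_vector_assoc[symmetric])
  qed
  \<comment> \<open>The indices spanning the eigenspace of \<open>U\<close> for the eigenvalue 1.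
    Its invariance under \<open>?L\<close> contradicts nondegeneracy unless \<open>J\<close> is
    empty or everything.\<close>
  define J where "J = {i. c i = 1}"
  have J: "\<forall>i\<in>J. \<forall>j\<in>-J. b j \<bullet> (?L *v b i) = 0"
    by (auto simp: J_def intro: L)
  have "degenerate M b" if "J \<noteq> {}" "J \<noteq> UNIV"
    unfolding degenerate_def by (intro disjI2 exI[of _ J] conjI that J)
  then consider "J = {}" | "J = UNIV"
    using nd by auto
  then show ?thesis
  proof cases
    case 1
    then have "c i = - 1" for i
      using c[of i] by (auto simp: J_def)
    then show ?thesis
      using eqI[of "- 1"] by simp
  next
    case 2
    then have "c i = 1" for i
      by (auto simp: J_def)
    then show ?thesis
      using eqI[of 1] by simp
  qed
qed

text \<open>Writing \<open>C = W U W\<^sup>-\<^sup>1\<close>, the three congruences say that \<open>U\<close> is orthogonal and commutes with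
  \<open>M + M\<^sup>T = 2 S\<close> and with \<open>M\<^sup>2 + 2 M M\<^sup>T + (M\<^sup>T)\<^sup>2 = 4 S\<^sup>2 + 2 (L S - S L)\<close>.\<close>
lemma congruence_invariant_eq_pm_1:
  fixes C D W :: "real^'n^'n"
  assumes W: "pos_def W" and M: "matrix_inv W ** D ** W \<in> M_set"
    and C: "\<And>r. \<bar>r\<bar> < ln 2 \<Longrightarrow> C ** spec_mat D (W ** W) r ** transpose C = spec_mat D (W ** W) r"
  shows "C = mat 1 \<or> C = - mat 1"
proof -
  define V where "V = matrix_inv W"
  have WV: "W ** V = mat 1" and VW: "V ** W = mat 1" and tV: "transpose V = V"
    unfolding V_def by (rule pos_def_inverse[OF W])+
  have tW: "transpose W = W"
    using W by (simp add: pos_def_def symmetric_mat_def)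
  have cancel: "A ** W ** V = A" "A ** V ** W = A" for A :: "real^'n^'n"
    using WV VW by (simp_all add: matrix_mul_assoc[symmetric])
  define M where "M = V ** D ** W"
  define U where "U = V ** C ** W"
  have tU: "transpose U = W ** transpose C ** V"
    by (simp add: U_def matrix_transpose_mul tW tV matrix_mul_assoc)
  have D: "D = W ** M ** V"
    by (simp add: M_def matrix_mul_assoc WV cancel)
  have tD: "transpose D = V ** transpose M ** W"
    by (simp add: D matrix_transpose_mul tW tV matrix_mul_assoc)
  define Y where "Y = M + transpose M"
  \<comment> \<open>Expressed through \<open>M\<close>, the matrices in the three congruences all
    have the shape \<open>W ** Z ** W\<close>, with \<open>Z\<close> the identity, \<open>Y\<close>,
    and \<open>M ** Y + Y ** transpose M\<close>.\<close>
  have X: "D ** (W ** W) + (W ** W) ** transpose D = W ** Y ** W"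
    unfolding D tD[unfolded D] Y_def
    by (simp add: matrix_mul_assoc cancel matrix_add_ldistrib matrix_add_rdistrib matrix_transpose_mul tW tV)
  have X2: "D ** (W ** Y ** W) + (W ** Y ** W) ** transpose D = W ** (M ** Y + Y ** transpose M) ** W"
    unfolding tD by (subst D)
      (simp add: matrix_mul_assoc cancel matrix_add_ldistrib matrix_add_rdistrib)
  \<comment> \<open>With \<open>C\<close> conjugated into \<open>U\<close>, the outer factors
    \<open>W\<close> cancel and the congruence by \<open>C\<close> becomes one by
    \<open>U\<close>.\<close>
  have conj: "U ** Z ** transpose U = Z" if "C ** (W ** Z ** W) ** transpose C = W ** Z ** W" for Z
  proof -
    have "U ** Z ** transpose U = V ** (C ** (W ** Z ** W) ** transpose C) ** V"
      by (simp only: tU) (simp add: U_def matrix_mul_assoc)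
    also have "\<dots> = Z"
      unfolding that by (simp add: matrix_mul_assoc cancel VW)
    finally show ?thesis .
  qed
  have ln2: "0 < ln (2::real)"
    by simp
  note inv = congruence_spec_mat[OF ln2 C, unfolded X X2]
  have "C ** (W ** mat 1 ** W) ** transpose C = W ** mat 1 ** W"
    using inv(1) by simp
  from conj[OF this] have "U ** transpose U = mat 1"
    by simp
  then have orth: "transpose U ** U = mat 1"
    using matrix_left_right_inverse by blast
  have comm: "U ** Z = Z ** U" if "C ** (W ** Z ** W) ** transpose C = W ** Z ** W" for Z
  proof -
    have "U ** Z = U ** Z ** (transpose U ** U)"
      by (simp add: orth)
    also have "\<dots> = Z ** U"
      by (simp add: matrix_mul_assoc conj[OF that])
    finally show ?thesis .
  qed
  let ?S = "sym_part M" and ?L = "skew_part M"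
  have Y: "Y = 2 *\<^sub>R ?S"
    by (simp add: Y_def sym_part_def)
  have UY: "U ** Y = Y ** U"
    using inv(2) by (intro comm) simp
  then have US: "U ** ?S = ?S ** U"
    unfolding Y by (simp add: matrix_scalar_ac scalar_matrix_assoc[symmetric])
  have MSL: "M = ?S + ?L" "transpose M = ?S - ?L"
    by (simp_all add: sym_part_def skew_part_def vec_eq_iff transpose_def field_simps)
  \<comment> \<open>The skew part cancelled from \<open>Y\<close>; it survives here because
    \<open>M\<close> and \<open>transpose M\<close> carry it with opposite signs on the two sides of
    \<open>?S\<close>.\<close>
  have "M ** Y + Y ** transpose M = 4 *\<^sub>R (?S ** ?S) + 2 *\<^sub>R (?L ** ?S - ?S ** ?L)"
  proof -
    have "M ** Y + Y ** transpose M = 2 *\<^sub>R ((?S + ?L) ** ?S + ?S ** (?S - ?L))"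
      unfolding Y using MSL by (simp add: matrix_scalar_ac scalar_matrix_assoc[symmetric] scaleR_add_right)
    also have "(?S + ?L) ** ?S + ?S ** (?S - ?L) = 2 *\<^sub>R (?S ** ?S) + (?L ** ?S - ?S ** ?L)"
      by (simp add: matrix_add_rdistrib diff_conv_add_uminus matrix_add_ldistrib matrix_mult_minus_right scaleR_2
          del: add_uminus_conv_diff)
    finally show ?thesis
      by (simp add: scaleR_add_right)
  qed
  moreover have "U ** (M ** Y + Y ** transpose M) = (M ** Y + Y ** transpose M) ** U"
    using inv(3) by (intro comm) simp
  \<comment> \<open>Removing the square of \<open>?S\<close>, which commutes with \<open>U\<close>
    anyway, isolates the commutator.\<close>
  moreover have "U ** (?S ** ?S) = (?S ** ?S) ** U"
    by (metis US matrix_mul_assoc)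
  ultimately have "U ** (?L ** ?S - ?S ** ?L) = (?L ** ?S - ?S ** ?L) ** U"
    by (simp add: matrix_add_ldistrib matrix_add_rdistrib matrix_scalar_ac scalar_matrix_assoc[symmetric])
  then have "U = mat 1 \<or> U = - mat 1"
    using M orth US unfolding V_def[symmetric] M_def[symmetric] by (intro orthogonal_commuting_eq_pm_1) auto
  moreover have "C = W ** U ** V"
    by (simp add: U_def matrix_mul_assoc WV cancel)
  ultimately show ?thesis
    by (auto simp: WV matrix_mult_minus_right matrix_mult_minus_left)
qed

theorem OFBM_minimal_symmetry:
  fixes D W :: "real^'n^'n" and X :: "real \<Rightarrow> 'a \<Rightarrow> real^'n"
  assumes W: "pos_def W" and M: "matrix_inv W ** D ** W \<in> M_set \<inter> D_set"
    and A: "mRe (A ** cadj A) = W ** W" and X: "is_OFBM P X D A"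
  shows "minimal_symmetry P X"
proof -
  interpret prob_space P
    using X by (simp add: is_OFBM_def)
  have D: "D \<in> D_set"
    using M by (simp add: D_set_conjugate[OF pos_def_inverse(1)[OF W], of D])
  have sW: "symmetric_mat (W ** W)"
    using W by (simp add: pos_def_def symmetric_mat_def matrix_transpose_mul)
  have "C = mat 1 \<or> C = - mat 1" if C: "C \<in> sym_group P X" for C
  proof (rule congruence_invariant_eq_pm_1[OF W])
    show "matrix_inv W ** D ** W \<in> M_set"
      using M by simp
    fix r :: real assume r: "\<bar>r\<bar> < ln 2"
    show "C ** spec_mat D (W ** W) r ** transpose C = spec_mat D (W ** W) r"
    proof (rule symmetric_eqI)
      show "symmetric_mat (C ** spec_mat D (W ** W) r ** transpose C)" "symmetric_mat (spec_mat D (W ** W) r)"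
        unfolding spec_mat_def by (intro symmetric_spec_mat sW)+
      show "u \<bullet> ((C ** spec_mat D (W ** W) r ** transpose C) *v u) = u \<bullet> (spec_mat D (W ** W) r *v u)" for u
        using sym_group_spectral[OF D X C r, of u] unfolding inner_congruence[of u C] A spec_mat_def
          inner_congruence[of _ "mexp (r *\<^sub>R D)"] .
    qed
  qed
  moreover have "mat 1 \<in> sym_group P X"
  proof -
    have "invertible (mat 1 :: real^'n^'n)"
      unfolding invertible_def by (rule exI[of _ "mat 1"]) simp
    then show ?thesis
      by (simp add: sym_group_def)
  qed
  \<comment> \<open>The opposite inclusion needs the joint laws and not just second moments: a
    centered Gaussian process is symmetric.\<close>
  moreover have "- mat 1 \<in> sym_group P X"
  proof -
    have "(- mat 1 :: real^'n^'n) ** - mat 1 = mat 1"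
      by (simp add: matrix_mult_minus_left matrix_mult_minus_right)
    then have "invertible (- mat 1 :: real^'n^'n)"
      unfolding invertible_def by blast
    moreover have "(- mat 1 :: real^'n^'n) *v x = - x" for x
      by (simp add: matrix_vector_mult_def mat_def vec_eq_iff sum_negf if_distrib if_distribR cong: if_cong)
    ultimately show ?thesis
      using X unfolding sym_group_def is_OFBM_def by (simp add: centered_gaussian_process_symmetric)
  qed
  ultimately show ?thesis
    unfolding minimal_symmetry_def by blast
qed

theorem theorem5p2:
  assumes n2: "CARD('n::finite) \<ge> 2"
  shows
   "(\<forall>(D::real^'n^'n) W. pos_def W \<and> matrix_inv W ** D ** W \<in> M_set \<inter> D_set \<longrightarrow>
        (\<forall>A (P::'a measure) X. mRe (A ** cadj A) = W ** W \<and> is_OFBM P X D A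
             \<longrightarrow> minimal_symmetry P X))
  \<and> (open (M_set \<inter> D_set :: (real^'n^'n) set)
     \<and> D_set \<subseteq> closure (M_set \<inter> D_set :: (real^'n^'n) set)
     \<and> meager ((UNIV - M_set) \<inter> D_set :: (real^'n^'n) set))
  \<and> (\<forall>M::real^'n^'n. M \<in> M_set \<inter> D_set \<longrightarrow>
        (\<forall>A (P::'a measure) X. mRe (A ** cadj A) = mat 1 \<and> is_OFBM P X M A
             \<longrightarrow> minimal_symmetry P X))"
proof (intro conjI)
  show "\<forall>(D::real^'n^'n) W. pos_def W \<and> matrix_inv W ** D ** W \<in> M_set \<inter> D_set \<longrightarrow>
        (\<forall>A (P::'a measure) X. mRe (A ** cadj A) = W ** W \<and> is_OFBM P X D A
             \<longrightarrow> minimal_symmetry P X)"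
    using OFBM_minimal_symmetry by blast
  show "open (M_set \<inter> D_set :: (real^'n^'n) set)"
    by (intro open_Int open_M_set open_D_set)
  show "D_set \<subseteq> closure (M_set \<inter> D_set :: (real^'n^'n) set)"
    by (rule D_set_subset_closure)
  show "meager ((UNIV - M_set) \<inter> D_set :: (real^'n^'n) set)"
    by (rule meager_compl_M_set)
  \<comment> \<open>Part (c) is part (a) with \<open>W\<close> the identity, which is its own
    inverse.\<close>
  have one: "pos_def (mat 1 :: real^'n^'n)"
    by (simp add: pos_def_def symmetric_mat_def transpose_mat)
  have "matrix_inv (mat 1) = (mat 1 :: real^'n^'n)"
    using pos_def_inverse(1)[OF one] by simp
  then show "\<forall>M::real^'n^'n. M \<in> M_set \<inter> D_set \<longrightarrow>
        (\<forall>A (P::'a measure) X. mRe (A ** cadj A) = mat 1 \<and> is_OFBM P X M A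
             \<longrightarrow> minimal_symmetry P X)"
    using OFBM_minimal_symmetry[OF one] by auto
qed

end
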